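(* Let $K$ be a number field of degree $d \geq 2$ with $r_2$ pairs of complex conjugate embeddings, discriminant $\Delta_K$ and ring of integers $\mathcal{O}_K$. Let $I \subset \mathcal{O}_K$ be an ideal and let $J_1,\dots,J_s \subsetneq I$ be distinct nonzero ideals in $\mathcal{O}_K$ ($s \geq 1$). Let $J = J_1 \cdots J_s$. Then there exists an element $\alpha \in I \setminus \bigcup_{i=1}^s J_i$ such that $K = \mathbb{Q}(\alpha)$ and $$h(\alpha) \leq \frac{d\ \mathbb{N}_K(J) |\Delta_K|^{1/2} \left( (d^2-d+4)\ \mathbb{N}_K(J) + 4 \mathbb{N}_K(I) \right)}{4 \mathbb{N}_K(I)} \max \left\{ 1, \left( \frac{2}{\pi} \right)^{r_2} \left( \sum_{i=1}^s \frac{\mathbb{N}_K(I)}{\mathbb{N}_K(J_i)} - \frac{(s-1) \mathbb{N}_K(I)}{\mathbb{N}_K(J)} + \frac{\mathbb{N}_K(J)^{d-1}}{|\Delta_K|^{1/2}} \right) \right\}.$$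
   Context: For a nonzero ideal $I \subseteq \mathcal{O}_K$, $\mathbb{N}_K(I) = |\mathcal{O}_K/I|$ is its norm. For $\alpha \in K$, $h(\alpha) = \prod_{v \in M(K)} \max\{1, |\alpha|_v\}^{d_v/d}$ is the absolute multiplicative Weil height, where $M(K)$ is the set of places of $K$, $d_v = [K_v:\mathbb{Q}_v]$, and each $|\cdot|_v$ extends the usual archimedean or $p$-adic absolute value on $\mathbb{Q}$. *)

theory Defs
  imports
    Complex_Main
    "HOL-Computational_Algebra.Computational_Algebra"
    "HOL-Algebra.Ideal_Product"
    "HOL-Algebra.QuotRing"
    "HOL-Algebra.Embedded_Algebras"
    "HOL-Algebra.Generated_Fields"
    "HOL-Algebra.Algebraic_Closure_Type"
    "Jordan_Normal_Form.Determinant"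
begin

text \<open>The field \<open>K\<close> is a type of class \<^class>\<open>field_char_0\<close>, so \<open>K\<close> itself is \<open>UNIV\<close>; the
  predicate \<open>number_field\<close> says that it has finite degree over \<open>\<rat>\<close>. The long names
  \<open>Modules.module\<close> select the linear algebra of Main, since HOL-Algebra also has
  a locale \<open>module\<close>.\<close>

definition number_field :: "'a::field_char_0 itself \<Rightarrow> bool" where
  "number_field _ \<longleftrightarrow>
     (\<exists>B::'a set. finite B \<and> Modules.module.span (\<lambda>(q::rat) x. of_rat q * x) B = UNIV)"

definition number_field_degree :: "'a::field_char_0 itself \<Rightarrow> nat" where
  "number_field_degree _ = vector_space.dim (\<lambda>(q::rat) (x::'a). of_rat q * x) UNIV"

definition ring_of_integers :: "'a::field_char_0 ring" where
  "ring_of_integers =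
     \<lparr>carrier = {x. algebraic_int x}, monoid.mult = (*), one = 1, zero = 0, add = (+)\<rparr>"

definition ideal_norm :: "'a::field_char_0 set \<Rightarrow> nat" where
  "ideal_norm I = card (carrier (ring_of_integers Quot I))"

definition ideal_family_prod :: "'i set \<Rightarrow> ('i \<Rightarrow> 'a::field_char_0 set) \<Rightarrow> 'a set" where
  "ideal_family_prod A J = finprod (ideals_set ring_of_integers) J A"

definition generates_field :: "'a::field_char_0 \<Rightarrow> bool" where
  "generates_field \<alpha> \<longleftrightarrow> generate_field ring_of_type_algebra (\<rat> \<union> {\<alpha>}) = UNIV"


definition embeddings :: "('a::field_char_0 \<Rightarrow> complex) set" where
  "embeddings = {\<sigma>. field_hom \<sigma>}"

definition complex_pairs :: "'a::field_char_0 itself \<Rightarrow> nat" where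
  "complex_pairs _ =
     card {{\<sigma>, cnj \<circ> \<sigma>} | \<sigma> :: 'a \<Rightarrow> complex. \<sigma> \<in> embeddings \<and> cnj \<circ> \<sigma> \<noteq> \<sigma>}"

definition integral_basis :: "'a::field_char_0 list \<Rightarrow> bool" where
  "integral_basis bs \<longleftrightarrow> distinct bs
     \<and> \<not> Modules.module.dependent (\<lambda>(k::int) (x::'a). of_int k * x) (set bs)
     \<and> Modules.module.span (\<lambda>(k::int) (x::'a). of_int k * x) (set bs)
           = carrier ring_of_integers"

text \<open>The value \<open>det (\<sigma>\<^sub>i \<omega>\<^sub>j)\<^sup>2\<close> depends neither on the integral basis \<open>\<omega>\<close> nor on the
  enumeration of the embeddings, and it is a rational integer.\<close>

definition discriminant :: "'a::field_char_0 itself \<Rightarrow> int" where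
  "discriminant _ = (THE D. \<exists>(bs :: 'a list) \<sigma>s.
     integral_basis bs \<and> distinct \<sigma>s \<and> set \<sigma>s = embeddings \<and>
     of_int D = (det (mat (length \<sigma>s) (length bs) (\<lambda>(i, j). (\<sigma>s ! i) (bs ! j))))\<^sup>2)"


definition absolute_value :: "('a::field \<Rightarrow> real) \<Rightarrow> bool" where
  "absolute_value v \<longleftrightarrow>
     (\<forall>x. v x \<ge> 0) \<and> (\<forall>x. v x = 0 \<longleftrightarrow> x = 0) \<and>
     (\<forall>x y. v (x * y) = v x * v y) \<and> (\<forall>x y. v (x + y) \<le> v x + v y)"

definition padic_abs :: "nat \<Rightarrow> rat \<Rightarrow> real" where
  "padic_abs p q = (if q = 0 then 0 else
     real p powi (int (multiplicity (int p) (snd (quotient_of q)))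
                  - int (multiplicity (int p) (fst (quotient_of q)))))"

text \<open>A place is represented by its unique absolute value that extends the usual
  archimedean or a \<open>p\<close>-adic absolute value of \<open>\<rat>\<close>.\<close>

definition places :: "('a::field_char_0 \<Rightarrow> real) set" where
  "places = {v. absolute_value v \<and>
     ((\<forall>q. v (of_rat q) = \<bar>of_rat q\<bar>) \<or>
      (\<exists>p. prime p \<and> (\<forall>q. v (of_rat q) = padic_abs p q)))}"

text \<open>The completion \<open>K\<^sub>v\<close> is the ring of \<open>v\<close>-Cauchy sequences modulo the null sequences; \<open>\<rat>\<^sub>v\<close>
  is realised inside \<open>K\<^sub>v\<close> as the classes of the Cauchy sequences of rationals.\<close>

definition cauchy_ring :: "('a::field \<Rightarrow> real) \<Rightarrow> (nat \<Rightarrow> 'a) ring" where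
  "cauchy_ring v =
     \<lparr>carrier = {x. \<forall>e>0. \<exists>N. \<forall>m\<ge>N. \<forall>n\<ge>N. v (x m - x n) < e},
      monoid.mult = (\<lambda>x y n. x n * y n),
      one = (\<lambda>n. 1), zero = (\<lambda>n. 0), add = (\<lambda>x y n. x n + y n)\<rparr>"

definition null_sequences :: "('a::field \<Rightarrow> real) \<Rightarrow> (nat \<Rightarrow> 'a) set" where
  "null_sequences v = {x. (\<lambda>n. v (x n)) \<longlonglongrightarrow> 0}"

definition completion :: "('a::field \<Rightarrow> real) \<Rightarrow> (nat \<Rightarrow> 'a) set ring" where
  "completion v = cauchy_ring v Quot null_sequences v"

definition rat_completion :: "('a::field_char_0 \<Rightarrow> real) \<Rightarrow> (nat \<Rightarrow> 'a) set set" where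
  "rat_completion v =
     {null_sequences v +>\<^bsub>cauchy_ring v\<^esub> x | x. x \<in> carrier (cauchy_ring v) \<and> range x \<subseteq> \<rat>}"

definition local_degree :: "('a::field_char_0 \<Rightarrow> real) \<Rightarrow> nat" where
  "local_degree v = ring.dim (completion v) (rat_completion v) (carrier (completion v))"

text \<open>All places with \<open>v \<alpha> \<le> 1\<close> contribute a factor \<open>1\<close>; leaving them out makes the product
  range over a finite set, as \<^const>\<open>prod\<close> requires.\<close>

definition weil_height :: "'a::field_char_0 \<Rightarrow> real" where
  "weil_height \<alpha> = (\<Prod>v | v \<in> places \<and> v \<alpha> > 1.
     max 1 (v \<alpha>) powr (real (local_degree v) / real (number_field_degree TYPE('a))))"

end

theory Submission
  imports Defs "HOL-Analysis.Analysis" "HOL-Library.Function_Algebras" "Jordan_Normal_Form.Char_Poly"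
begin

text \<open>
  Let \<open>N = N(J)\<close>, so that \<open>N O \<subseteq> J\<close>. Ideals of the ring of integers \<open>O\<close> are invertible, hence \<open>I\<close> is not
  the union of the \<open>J\<^sub>i\<close>; fix \<open>x\<close> in \<open>I\<close> outside all of them. Every \<open>\<alpha> \<in> x + N O\<close> is then admissible,
  and it remains to choose a primitive one with small conjugates.

  By AM-GM a nonzero \<open>y \<in> O\<close> satisfies \<open>\<Sum> |\<sigma> y|\<^sup>2 \<ge> d\<close>. If the \<open>y \<in> O\<close> with \<open>\<Sum> |\<sigma> y|\<^sup>2 \<le> |\<Delta>| + d\<close> did not
  span \<open>K\<close>, their images under the Minkowski embedding would lie in a hyperplane with unit normal \<open>w\<close>.
  Minkowski's theorem for a rotated box with side \<open>\<surd>|\<Delta>|\<close> along \<open>w\<close> and sides slightly above \<open>1\<close> in the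
  orthogonal directions yields a nonzero \<open>y \<in> O\<close> of that size; it is off the hyperplane, as otherwise
  \<open>\<Sum> |\<sigma> y|\<^sup>2 < d\<close>. So there is a rational basis \<open>\<omega>\<close> of \<open>K\<close> in \<open>O\<close> with conjugates at most \<open>\<surd>(|\<Delta>| + d)\<close>.

  Writing \<open>\<alpha> = \<Sum> (t\<^sub>k + c\<^sub>k) N \<omega>\<^sub>k\<close> with integers \<open>c\<^sub>k\<close>, the conjugates of \<open>\<alpha>\<close> are distinct unless one of
  \<open>d (d - 1) / 2\<close> affine forms in \<open>c\<close> vanishes. Choosing the \<open>c\<^sub>k\<close> one at a time, this is avoided with
  \<open>\<Sum> |t\<^sub>k + c\<^sub>k| \<le> d (d + 1) / 4\<close>, and \<open>h(\<alpha>) \<le> max |\<sigma> \<alpha>|\<close> is already below the first factor of the bound.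
\<close>

text \<open>An arbitrary integral basis has uncontrolled conjugates, whereas the bound allows only a
  factor of order |\<Delta>|^(1/2). A basis of K over the rationals is enough for the coordinates of
  \<alpha>, so each of its vectors can be sought separately, off a given hyperplane.

  The constant d (d + 1) / 4 is half of d + d (d - 1) / 2: centring a coordinate costs 1/2, and each
  affine form costs another 1/2 in the one coordinate made responsible for it.

  As \<alpha> is integral, only archimedean places can have v(\<alpha>) > 1, and the height estimate
  comes down to their local degrees having sum at most d. Local degrees are dimensions of quotient
  rings of Cauchy sequences, so these places must be identified with embeddings and their
  completions with \<real> or \<complex>.

  That there are d embeddings is obtained without a primitive element, by diagonalising
  multiplication operators simultaneously; that \<alpha> is primitive is then read off from its d
  distinct conjugates.\<close>

interpretation int_mod: Modules.module "\<lambda>(k::int) (x::'a::field_char_0). of_int k * x"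
  by unfold_locales (auto simp: algebra_simps)

interpretation rat_vs: vector_space "\<lambda>(q::rat) (x::'a::field_char_0). of_rat q * x"
  by unfold_locales (auto simp: algebra_simps of_rat_add of_rat_mult)

declare int_mod.scale_scale [simp del] rat_vs.scale_scale [simp del]

section \<open>Algebraic integers\<close>

text \<open>The determinant trick: multiplication by \<open>x\<close> on the generators is given by
  an integer matrix, and the vector of generators, nonzero because of \<open>b0\<close>, is an
  eigenvector with eigenvalue \<open>x\<close>. So \<open>x\<close> is a root of a monic integer
  characteristic polynomial.\<close>

lemma algebraic_int_if_span_stable:
  fixes x :: "'a::field_char_0"
  assumes fin: "finite B" and b0: "b0 \<in> B" "b0 \<noteq> 0"
    and stable: "\<And>b. b \<in> B \<Longrightarrow> x * b \<in> int_mod.span B"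
  shows "algebraic_int x"
proof -
  obtain bs where bs: "set bs = B" "distinct bs" using fin finite_distinct_list by blast
  define n where "n = length bs"
  have "\<exists>u. x * b = (\<Sum>v\<in>B. of_int (u v) * v)" if "b \<in> B" for b
    using stable[OF that] int_mod.span_finite[OF fin] by auto
  then obtain u where u: "\<And>b. b \<in> B \<Longrightarrow> x * b = (\<Sum>v\<in>B. of_int (u b v) * v)" by metis
  define M :: "int mat" where "M = Matrix.mat n n (\<lambda>(i, j). u (bs ! i) (bs ! j))"
  define A :: "'a mat" where "A = map_mat of_int M"
  define v where "v = Matrix.vec n (\<lambda>i. bs ! i)"
  have M: "M \<in> carrier_mat n n" and A: "A \<in> carrier_mat n n" by (auto simp: M_def A_def)
  have "A *\<^sub>v v = x \<cdot>\<^sub>v v"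
  proof (rule eq_vecI)
    fix i assume "i < dim_vec (x \<cdot>\<^sub>v v)"
    then have i: "i < n" by (simp add: v_def)
    have "(A *\<^sub>v v) $ i = (\<Sum>j = 0..<n. of_int (u (bs ! i) (bs ! j)) * bs ! j)"
      using i by (simp add: A_def M_def v_def scalar_prod_def)
    also have "\<dots> = (\<Sum>w\<in>B. of_int (u (bs ! i) w) * w)"
      using bs by (intro sum.reindex_bij_betw[of "\<lambda>j. bs ! j" _ B "\<lambda>w. of_int (u (bs ! i) w) * w"])
        (auto simp: n_def bij_betw_nth atLeast0LessThan)
    also have "\<dots> = x * bs ! i" using u[of "bs ! i"] i bs nth_mem[of i bs] by (simp add: n_def)
    finally show "(A *\<^sub>v v) $ i = (x \<cdot>\<^sub>v v) $ i" using i by (simp add: v_def)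
  qed (simp add: v_def A_def M_def)
  moreover have "v \<noteq> 0\<^sub>v n"
  proof -
    obtain i where "i < n" "bs ! i = b0" using b0 bs by (metis in_set_conv_nth n_def)
    then have "v $ i \<noteq> 0\<^sub>v n $ i" using b0 by (simp add: v_def)
    then show ?thesis by metis
  qed
  ultimately have "eigenvalue A x"
    unfolding eigenvalue_def eigenvector_def using A by (intro exI[of _ v]) (auto simp: v_def)
  then have "poly (char_poly A) x = 0" using eigenvalue_root_char_poly[OF A] by simp
  moreover have "char_poly A = map_poly of_int (char_poly M)"
    unfolding A_def by (rule of_int_hom.char_poly_hom[OF M])
  moreover have "lead_coeff (char_poly M) = 1" using degree_monic_char_poly[OF M] by simp
  ultimately show ?thesis unfolding algebraic_int_altdef_ipoly by metis
qed

lemma int_span_mult_right: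
  fixes c :: "'a::field_char_0"
  assumes "z \<in> int_mod.span S"
  shows "z * c \<in> int_mod.span ((\<lambda>s. s * c) ` S)"
  using assms
proof (induction rule: int_mod.span_induct_alt)
  case base show ?case by (simp add: int_mod.span_zero)
next
  case (step k x y)
  have "of_int k * (x * c) + y * c \<in> int_mod.span ((\<lambda>s. s * c) ` S)"
    using step by (intro int_mod.span_add[OF int_mod.span_scale[OF int_mod.span_base]]) auto
  then show ?case by (simp add: algebra_simps)
qed

lemma int_span_closed_under_mult:
  fixes c :: "'a::field_char_0"
  assumes "z \<in> int_mod.span S" "\<And>s. s \<in> S \<Longrightarrow> c * s \<in> int_mod.span S"
  shows "c * z \<in> int_mod.span S"
proof -
  have "z * c \<in> int_mod.span ((\<lambda>s. s * c) ` S)" by (rule int_span_mult_right) fact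
  moreover have "(\<lambda>s. s * c) ` S \<subseteq> int_mod.span S" using assms(2) by (auto simp: mult.commute)
  ultimately show ?thesis
    by (metis int_mod.span_minimal int_mod.subspace_span mult.commute subsetD)
qed

lemma algebraic_int_power_in_span:
  fixes x :: "'a::field_char_0"
  assumes "algebraic_int x"
  obtains n where "n > 0" "x ^ n \<in> int_mod.span ((\<lambda>i. x ^ i) ` {..<n})"
proof -
  obtain p where p: "poly (map_poly of_int p) x = 0" "lead_coeff p = 1"
    using assms algebraic_int_altdef_ipoly by blast
  define n where "n = degree p"
  have deg: "degree (map_poly of_int p :: 'a poly) = n" by (simp add: n_def)
  have "n > 0"
  proof (rule ccontr)
    assume "\<not> n > 0"
    then obtain c where c: "p = [:c:]" by (auto simp: n_def elim: degree_eq_zeroE)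
    with p show False by simp
  qed
  have "0 = (\<Sum>i\<le>n. of_int (coeff p i) * x ^ i)"
    using p(1) deg by (simp add: poly_altdef coeff_map_poly)
  also have "{..n} = insert n {..<n}" by auto
  finally have "x ^ n = - (\<Sum>i<n. of_int (coeff p i) * x ^ i)"
    using p(2) by (simp add: n_def eq_neg_iff_add_eq_0)
  also have "\<dots> \<in> int_mod.span ((\<lambda>i. x ^ i) ` {..<n})"
    by (intro int_mod.span_neg int_mod.span_sum int_mod.span_scale int_mod.span_base) auto
  finally show ?thesis using that \<open>n > 0\<close> by blast
qed

text \<open>The module is spanned by the products \<open>x ^ i * y ^ j\<close> with bounded
  exponents. Multiplication leaves this set only at the top exponent, where the integral equation
  folds it back. One module stable under both elements serves sum and product alike.\<close>

lemma algebraic_int_common_module: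
  fixes x y :: "'a::field_char_0"
  assumes "algebraic_int x" "algebraic_int y"
  obtains B where "finite B" "1 \<in> B" "\<And>b. b \<in> B \<Longrightarrow> x * b \<in> int_mod.span B"
    "\<And>b. b \<in> B \<Longrightarrow> y * b \<in> int_mod.span B"
proof -
  obtain n where n: "n > 0" "x ^ n \<in> int_mod.span ((\<lambda>i. x ^ i) ` {..<n})"
    using algebraic_int_power_in_span assms by blast
  obtain m where m: "m > 0" "y ^ m \<in> int_mod.span ((\<lambda>i. y ^ i) ` {..<m})"
    using algebraic_int_power_in_span assms by blast
  define B where "B = (\<lambda>(i, j). x ^ i * y ^ j) ` ({..<n} \<times> {..<m})"
  have fB: "finite B" by (simp add: B_def)
  have B: "x ^ i * y ^ j \<in> B" if "i < n" "j < m" for i j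
    unfolding B_def using that by force
  have B1: "1 \<in> B" using B[of 0 0] n m by simp
  have xs: "x * b \<in> int_mod.span B" if b: "b \<in> B" for b
  proof -
    obtain i j where ij: "i < n" "j < m" "b = x ^ i * y ^ j" using b by (auto simp: B_def)
    show ?thesis
    proof (cases "Suc i < n")
      case True
      then show ?thesis using B[of "Suc i" j] ij by (auto intro!: int_mod.span_base simp: mult.assoc)
    next
      case False
      then have "x * b = x ^ n * y ^ j" using ij by (metis Suc_lessI mult.assoc power_Suc)
      also have "\<dots> \<in> int_mod.span ((\<lambda>s. s * y ^ j) ` (\<lambda>i. x ^ i) ` {..<n})"
        using n(2) by (rule int_span_mult_right)
      also have "\<dots> \<subseteq> int_mod.span B" using ij B by (intro int_mod.span_mono) auto
      finally show ?thesis .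
    qed
  qed
  have ys: "y * b \<in> int_mod.span B" if b: "b \<in> B" for b
  proof -
    obtain i j where ij: "i < n" "j < m" "b = x ^ i * y ^ j" using b by (auto simp: B_def)
    show ?thesis
    proof (cases "Suc j < m")
      case True
      have "y * b = x ^ i * y ^ Suc j" using ij by simp
      also have "\<dots> \<in> int_mod.span B" using B[of i "Suc j"] ij True by (intro int_mod.span_base) auto
      finally show ?thesis .
    next
      case False
      then have "y * b = y ^ m * x ^ i"
        using ij by (metis Suc_lessI mult.left_commute mult.commute power_Suc)
      also have "\<dots> \<in> int_mod.span ((\<lambda>s. s * x ^ i) ` (\<lambda>i. y ^ i) ` {..<m})"
        using m(2) by (rule int_span_mult_right)
      also have "\<dots> \<subseteq> int_mod.span B" using ij B
        by (intro int_mod.span_mono) (auto simp: mult.commute)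
      finally show ?thesis .
    qed
  qed
  show ?thesis using that[OF fB B1 xs ys] by blast
qed

lemma algebraic_int_add:
  fixes x y :: "'a::field_char_0"
  assumes "algebraic_int x" "algebraic_int y"
  shows "algebraic_int (x + y)"
proof -
  obtain B where B: "finite B" "1 \<in> B" "\<And>b. b \<in> B \<Longrightarrow> x * b \<in> int_mod.span B"
    "\<And>b. b \<in> B \<Longrightarrow> y * b \<in> int_mod.span B"
    using algebraic_int_common_module[OF assms] by blast
  show ?thesis
    by (rule algebraic_int_if_span_stable[OF B(1,2)]) (auto simp: distrib_right intro!: int_mod.span_add B)
qed

lemma algebraic_int_mult:
  fixes x y :: "'a::field_char_0"
  assumes "algebraic_int x" "algebraic_int y"
  shows "algebraic_int (x * y)"
proof -
  obtain B where B: "finite B" "1 \<in> B" "\<And>b. b \<in> B \<Longrightarrow> x * b \<in> int_mod.span B"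
    "\<And>b. b \<in> B \<Longrightarrow> y * b \<in> int_mod.span B"
    using algebraic_int_common_module[OF assms] by blast
  show ?thesis
  proof (rule algebraic_int_if_span_stable[OF B(1,2)])
    fix b assume "b \<in> B"
    then show "x * y * b \<in> int_mod.span B"
      unfolding mult.assoc by (intro int_span_closed_under_mult[OF B(4) B(3)])
  qed simp
qed

lemma algebraic_int_diff:
  "algebraic_int x \<Longrightarrow> algebraic_int y \<Longrightarrow> algebraic_int (x - y :: 'a::field_char_0)"
  by (metis algebraic_int_add algebraic_int_minus diff_conv_add_uminus)

lemma algebraic_int_of_int: "algebraic_int (of_int k :: 'a::field_char_0)"
  by (simp add: int_imp_algebraic_int)

lemma algebraic_int_of_nat: "algebraic_int (of_nat k :: 'a::field_char_0)"
  by (simp add: int_imp_algebraic_int)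

lemma algebraic_int_one: "algebraic_int (1 :: 'a::field_char_0)"
  by (simp add: int_imp_algebraic_int)

lemma algebraic_int_sum:
  "(\<And>i. i \<in> A \<Longrightarrow> algebraic_int (f i :: 'a::field_char_0)) \<Longrightarrow> algebraic_int (sum f A)"
  by (induction A rule: infinite_finite_induct) (auto intro: algebraic_int_add)

lemma algebraic_int_prod:
  "(\<And>i. i \<in> A \<Longrightarrow> algebraic_int (f i :: 'a::field_char_0)) \<Longrightarrow> algebraic_int (prod f A)"
  by (induction A rule: infinite_finite_induct) (auto intro: algebraic_int_mult algebraic_int_one)

lemma algebraic_int_power: "algebraic_int (x :: 'a::field_char_0) \<Longrightarrow> algebraic_int (x ^ n)"
  by (induction n) (auto intro: algebraic_int_mult algebraic_int_one)

text \<open>Multiplying the equation of degree n by the (n-1)-st power of its leading coefficient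
  \<open>c\<close> turns it into a monic equation for \<open>c * x\<close>.\<close>

lemma algebraic_imp_multiple_algebraic_int:
  fixes x :: "'a::field_char_0"
  assumes "p \<noteq> 0" "poly (map_poly of_int p) x = 0"
  obtains m :: int where "m > 0" "algebraic_int (of_int m * x)"
proof -
  define n where "n = degree p"
  define c where "c = lead_coeff p"
  have c: "c \<noteq> 0" using assms(1) by (simp add: c_def)
  have deg: "degree (map_poly of_int p :: 'a poly) = n" by (simp add: n_def)
  have n0: "n > 0"
  proof (rule ccontr)
    assume "\<not> n > 0"
    then obtain c where c: "p = [:c:]" by (auto simp: n_def elim: degree_eq_zeroE)
    with assms show False by simp
  qed
  define y where "y = of_int c * x"
  let ?B = "(\<lambda>i. y ^ i) ` {..<n}"
  have "0 = (\<Sum>i\<le>n. of_int (coeff p i) * x ^ i)"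
    using assms(2) deg by (simp add: poly_altdef coeff_map_poly)
  also have "{..n} = insert n {..<n}" by auto
  finally have eq: "of_int c * x ^ n = - (\<Sum>i<n. of_int (coeff p i) * x ^ i)"
    by (simp add: n_def c_def eq_neg_iff_add_eq_0)
  have "y ^ n = of_int (c ^ (n - 1)) * (of_int c * x ^ n)"
    using n0 by (simp add: y_def power_mult_distrib flip: power_minus_mult[OF n0, of "of_int c"])
  also have "\<dots> = - (\<Sum>i<n. of_int (coeff p i * c ^ (n - 1 - i)) * y ^ i)"
    unfolding eq sum_distrib_left mult_minus_right
  proof (intro arg_cong[where f = uminus] sum.cong refl)
    fix i assume "i \<in> {..<n}"
    then have "c ^ (n - 1) = c ^ (n - 1 - i) * c ^ i" by (simp flip: power_add)
    then show "of_int (c ^ (n - 1)) * (of_int (coeff p i) * x ^ i) =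
      of_int (coeff p i * c ^ (n - 1 - i)) * y ^ i"
      by (simp add: y_def power_mult_distrib mult_ac)
  qed
  also have "\<dots> \<in> int_mod.span ?B"
    by (intro int_mod.span_neg int_mod.span_sum int_mod.span_scale int_mod.span_base) auto
  finally have yn: "y ^ n \<in> int_mod.span ?B" .
  have "algebraic_int y"
  proof (rule algebraic_int_if_span_stable)
    show "y ^ 0 \<in> ?B" using n0 by blast
    fix b assume "b \<in> ?B"
    then obtain i where i: "i < n" "b = y ^ i" by auto
    show "y * b \<in> int_mod.span ?B"
    proof (cases "Suc i < n")
      case True
      then show ?thesis using i by (auto intro!: int_mod.span_base simp flip: power_Suc)
    next
      case False
      then show ?thesis using i yn by (metis Suc_lessI power_Suc)
    qed
  qed auto
  show ?thesis
  proof (cases "c > 0")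
    case True then show ?thesis using that \<open>algebraic_int y\<close> by (simp add: y_def)
  next
    case False
    then show ?thesis using that[of "- c"] \<open>algebraic_int y\<close> c by (simp add: y_def)
  qed
qed

section \<open>Embeddings of a number field\<close>

text \<open>These maps form a complex vector space of dimension d; the embeddings will turn out to
  be a basis of it.\<close>

definition rat_linear :: "('a::field_char_0 \<Rightarrow> complex) \<Rightarrow> bool" where
  "rat_linear w \<longleftrightarrow> (\<forall>x y. w (x + y) = w x + w y) \<and> (\<forall>q x. w (of_rat q * x) = of_rat q * w x)"

lemma rat_linear_0: "rat_linear w \<Longrightarrow> w 0 = 0"
  unfolding rat_linear_def by (metis add_cancel_right_right)

lemma rat_linear_sum: "rat_linear w \<Longrightarrow> w (sum f A) = (\<Sum>i\<in>A. w (f i))"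
  by (induction A rule: infinite_finite_induct) (auto simp: rat_linear_0 rat_linear_def)

lemma sum_fun_apply: "sum f A x = (\<Sum>i\<in>A. f i x)" for f :: "'b \<Rightarrow> 'c \<Rightarrow> 'd::comm_monoid_add"
  by (induction A rule: infinite_finite_induct) auto

interpretation fn_vs: vector_space "\<lambda>(c::complex) (f::'a \<Rightarrow> complex) x. c * f x"
  by unfold_locales (auto simp: algebra_simps fun_eq_iff)

declare fn_vs.scale_scale [simp del]

lemma field_hom_of_rat:
  fixes \<sigma> :: "'a::field_char_0 \<Rightarrow> complex"
  assumes "field_hom \<sigma>"
  shows "\<sigma> (of_rat q) = of_rat q"
proof -
  interpret field_hom \<sigma> by fact
  show ?thesis by (cases q) (simp add: of_rat_rat hom_distribs)
qed

lemma field_hom_rat_linear: "field_hom \<sigma> \<Longrightarrow> rat_linear \<sigma>"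
proof -
  assume \<sigma>: "field_hom \<sigma>"
  then interpret field_hom \<sigma> .
  show ?thesis by (simp add: rat_linear_def hom_distribs field_hom_of_rat[OF \<sigma>])
qed

lemma embedding_cnj: "\<sigma> \<in> embeddings \<Longrightarrow> cnj \<circ> \<sigma> \<in> embeddings"
proof -
  assume "\<sigma> \<in> embeddings"
  then interpret field_hom \<sigma> by (simp add: embeddings_def)
  show ?thesis unfolding embeddings_def mem_Collect_eq
    by unfold_locales (simp_all add: hom_distribs)
qed

lemma number_field_basis:
  assumes "number_field TYPE('a::field_char_0)"
  obtains B :: "'a::field_char_0 set" where "finite B" "\<not> rat_vs.dependent B" "rat_vs.span B = UNIV"
    "card B = number_field_degree TYPE('a)"
proof -
  obtain S :: "'a set" where S: "finite S" "rat_vs.span S = UNIV"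
    using assms unfolding number_field_def by auto
  obtain B :: "'a set" where B: "B \<subseteq> UNIV" "\<not> rat_vs.dependent B" "UNIV \<subseteq> rat_vs.span B" "card B = rat_vs.dim (UNIV :: 'a set)"
    by (rule rat_vs.basis_exists[of "UNIV :: 'a set"]) (erule (3) that)
  have "finite B" using rat_vs.independent_span_bound[OF S(1) B(2)] S(2) by auto
  then show ?thesis using that B unfolding number_field_degree_def by blast
qed

lemma number_field_annihilator:
  fixes x :: "'a::field_char_0"
  assumes "number_field TYPE('a)"
  obtains p :: "rat poly" where "p \<noteq> 0" "poly (map_poly of_rat p) x = 0"
proof -
  obtain S :: "'a set" where S: "finite S" "rat_vs.span S = UNIV"
    using assms unfolding number_field_def by auto
  let ?n = "card S"
  interpret mp: map_poly_comm_ring_hom "of_rat :: rat \<Rightarrow> 'a" ..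
  \<comment> \<open>Linear dependence is a property of sets, so coinciding powers of
    \<open>x\<close> would escape it; they give a relation directly.\<close>
  show ?thesis
  proof (cases "inj_on (\<lambda>i. x ^ i) {..?n}")
    case True
    then have "card ((\<lambda>i. x ^ i) ` {..?n}) = Suc ?n" by (simp add: card_image)
    then have "rat_vs.dependent ((\<lambda>i. x ^ i) ` {..?n})"
      using rat_vs.independent_span_bound[OF S(1)] S(2) by fastforce
    then obtain u v where u: "(\<Sum>v\<in>(\<lambda>i. x ^ i) ` {..?n}. of_rat (u v) * v) = 0"
      and v: "v \<in> (\<lambda>i. x ^ i) ` {..?n}" "u v \<noteq> 0"
      using rat_vs.dependent_finite by blast
    define p where "p = (\<Sum>i\<le>?n. monom (u (x ^ i)) i)"
    have cp: "coeff p i = u (x ^ i)" if "i \<le> ?n" for i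
      using that by (simp add: p_def coeff_sum)
    have "p \<noteq> 0" using v cp by (metis (no_types, lifting) atMost_iff coeff_0 image_iff)
    moreover have "poly (map_poly of_rat p) x = 0"
      using u True by (simp add: p_def mp.hom_sum sum.reindex poly_sum poly_monom)
    ultimately show ?thesis using that by blast
  next
    case False
    then obtain i j where "i \<noteq> j" "x ^ i = x ^ j" by (auto simp: inj_on_def)
    then have "monom (1::rat) i - monom 1 j \<noteq> 0" and
      "poly (map_poly of_rat (monom (1::rat) i - monom 1 j)) x = 0"
      by (auto simp: monom_eq_iff' mp.hom_minus poly_monom)
    then show ?thesis using that by blast
  qed
qed

text \<open>For an annihilator of least degree, the cofactor of gcd(p, p') also annihilates
  \<open>x\<close>, so the gcd is constant. The Bezout identity then excludes multiple roots over
  the complex numbers. Simple roots are what makes multiplication by \<open>x\<close>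
  diagonalisable.\<close>

lemma number_field_squarefree_annihilator:
  fixes x :: "'a::field_char_0"
  assumes "number_field TYPE('a)"
  obtains p :: "rat poly" where "p \<noteq> 0" "poly (map_poly of_rat p) x = 0"
    "rsquarefree (map_poly of_rat p :: complex poly)"
proof -
  interpret mp: map_poly_comm_ring_hom "of_rat :: rat \<Rightarrow> 'a" ..
  interpret mpc: map_poly_comm_ring_hom "of_rat :: rat \<Rightarrow> complex" ..
  define P where "P p \<longleftrightarrow> p \<noteq> 0 \<and> poly (map_poly of_rat p) x = 0" for p :: "rat poly"
  obtain p0 where "P p0" using number_field_annihilator[OF assms] unfolding P_def by blast
  then obtain p where p: "P p" and min: "\<And>q. P q \<Longrightarrow> degree p \<le> degree q"
    using ex_has_least_nat[of P p0 degree] by blast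
  have deg: "degree p > 0"
  proof (rule ccontr)
    assume "\<not> degree p > 0"
    then obtain c where "p = [:c:]" by (auto elim: degree_eq_zeroE)
    with p show False by (auto simp: P_def)
  qed
  define g where "g = gcd p (pderiv p)"
  obtain h where h: "p = g * h" using gcd_dvd1[of p "pderiv p"] unfolding g_def by (elim dvdE)
  have nz: "g \<noteq> 0" "h \<noteq> 0" using h p by (auto simp: P_def)
  have pd: "pderiv p \<noteq> 0" using deg by (simp add: pderiv_eq_0_iff)
  have dg: "degree g < degree p"
  proof -
    have "degree g \<le> degree (pderiv p)" using pd unfolding g_def by (intro dvd_imp_degree_le) auto
    then show ?thesis using deg by (simp add: degree_pderiv)
  qed
  have "poly (map_poly of_rat g) x \<noteq> 0" using min[of g] dg nz by (auto simp: P_def)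
  then have "poly (map_poly of_rat h) x = 0"
    using p by (simp add: P_def h mp.hom_mult)
  then have "degree p \<le> degree h" using min[of h] nz by (simp add: P_def)
  then have "degree g = 0" using nz by (simp add: h degree_mult_eq)
  then have "is_unit g" using nz by (simp add: is_unit_iff_degree)
  then have "g = 1" unfolding g_def using is_unit_gcd_iff by blast
  obtain u v where uv: "u * p + v * pderiv p = 1"
    using bezout_coefficients_fst_snd[of p "pderiv p"] \<open>g = 1\<close> unfolding g_def by metis
  have "rsquarefree (map_poly of_rat p :: complex poly)"
    unfolding rsquarefree_roots
  proof (intro allI notI)
    fix a :: complex
    assume a: "poly (map_poly of_rat p) a = 0 \<and> poly (pderiv (map_poly of_rat p)) a = 0"
    have "pderiv (map_poly of_rat p :: complex poly) = map_poly of_rat (pderiv p)"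
      by (rule poly_eqI) (simp add: coeff_pderiv coeff_map_poly of_rat_mult of_rat_add)
    then have "poly (map_poly of_rat (u * p + v * pderiv p)) a = 0"
      using a by (simp add: mpc.hom_add mpc.hom_mult)
    then show False using uv by simp
  qed
  then show ?thesis using that p by (auto simp: P_def)
qed

text \<open>With \<open>T u = (\<lambda>y. u (x * y))\<close>, the fold is the product of the operators \<open>T - r\<close>.\<close>

lemma eigenspace_decomposition:
  fixes x :: "'a::field_char_0" and P :: "('a \<Rightarrow> complex) \<Rightarrow> bool"
  assumes add: "\<And>u v. P u \<Longrightarrow> P v \<Longrightarrow> P (\<lambda>y. u y + v y)"
    and scale: "\<And>u c. P u \<Longrightarrow> P (\<lambda>y. c * u y)"
    and shift: "\<And>u. P u \<Longrightarrow> P (\<lambda>y. u (x * y))"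
    and "distinct rs" "P w" "fold (\<lambda>r u y. u (x * y) - r * u y) rs w = (\<lambda>y. 0)"
  shows "\<exists>u. (\<forall>r\<in>set rs. P (u r) \<and> (\<forall>y. u r (x * y) = r * u r y)) \<and> w = (\<lambda>y. \<Sum>r\<in>set rs. u r y)"
  using assms(4-)
proof (induction rs arbitrary: w)
  case Nil then show ?case by simp
next
  case (Cons r rs)
  let ?w1 = "\<lambda>y. w (x * y) - r * w y"
  have "P ?w1" using add[OF shift[OF Cons.prems(2)] scale[OF Cons.prems(2), of "- r"]] by simp
  then obtain u where u: "\<And>t. t \<in> set rs \<Longrightarrow> P (u t)" "\<And>t y. t \<in> set rs \<Longrightarrow> u t (x * y) = t * u t y"
    and w1: "?w1 = (\<lambda>y. \<Sum>t\<in>set rs. u t y)"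
    using Cons.IH[of ?w1] Cons.prems by auto
  \<comment> \<open>\<open>f t\<close> solves (T - r) f = u t, because T acts on \<open>u t\<close>
    as the scalar t and t differs from r. What remains of \<open>w\<close> after subtracting all
    \<open>f t\<close> is killed by T - r.\<close>
  define f where "f t = (\<lambda>y. u t y / (t - r))" for t
  define g where "g = (\<lambda>y. w y - (\<Sum>t\<in>set rs. f t y))"
  have Pf: "P (f t)" if "t \<in> set rs" for t
    using scale[OF u(1)[OF that], of "1 / (t - r)"] by (simp add: f_def)
  have P0: "P (\<lambda>y. 0)" using scale[OF Cons.prems(2), of 0] by simp
  have Psum: "P (\<lambda>y. \<Sum>t\<in>A. f t y)" if "finite A" "A \<subseteq> set rs" for A
    using that
  proof (induction A rule: finite_induct)
    case (insert t A)
    then show ?case using add[OF Pf[of t] insert.IH] by simp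
  qed (simp add: P0)
  have "P g" using add[OF Cons.prems(2) scale[OF Psum, of "set rs" "-1"]] by (simp add: g_def)
  moreover have "g (x * y) = r * g y" for y
  proof -
    have "(\<Sum>t\<in>set rs. f t (x * y)) - r * (\<Sum>t\<in>set rs. f t y) = (\<Sum>t\<in>set rs. u t y)"
      unfolding sum_distrib_left sum_subtractf[symmetric]
    proof (rule sum.cong[OF refl])
      fix t assume t: "t \<in> set rs"
      then have "t \<noteq> r" using Cons.prems by auto
      then show "f t (x * y) - r * f t y = u t y"
        by (simp add: f_def u(2)[OF t] diff_divide_distrib[symmetric] left_diff_distrib[symmetric])
    qed
    also have "\<dots> = w (x * y) - r * w y" using w1 by (simp add: fun_eq_iff)
    finally show ?thesis by (simp add: g_def algebra_simps)
  qed
  moreover have "f t (x * y) = t * f t y" if "t \<in> set rs" for t y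
    using u(2)[OF that] by (simp add: f_def)
  moreover have "w = (\<lambda>y. \<Sum>t\<in>set (r # rs). (f(r := g)) t y)"
  proof
    fix y
    have "(\<Sum>t\<in>set rs. (f(r := g)) t y) = (\<Sum>t\<in>set rs. f t y)"
      using Cons.prems by (intro sum.cong) auto
    then show "w y = (\<Sum>t\<in>set (r # rs). (f(r := g)) t y)" using Cons.prems by (simp add: g_def)
  qed
  ultimately show ?case using Pf by (intro exI[of _ "f(r := g)"]) auto
qed

text \<open>The fold is the polynomial with roots \<open>rs\<close> evaluated at the shift operator.
  When that polynomial is, up to its leading coefficient, a rational annihilator of
  \<open>x\<close>, the fold vanishes on every rational linear map.\<close>

lemma fold_shift_eq_poly:
  fixes x :: "'a::field_char_0" and w :: "'a \<Rightarrow> complex"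
  shows "fold (\<lambda>r u y. u (x * y) - r * u y) rs w y =
    (\<Sum>i\<le>length rs. coeff (\<Prod>r\<leftarrow>rs. [:- r, 1:]) i * w (x ^ i * y))"
proof (induction rs arbitrary: w)
  case Nil then show ?case by simp
next
  case (Cons r rs)
  let ?Q = "\<Prod>r\<leftarrow>rs. [:- r, 1:]" and ?n = "length rs"
  have "degree ?Q \<le> ?n"
  proof (induction rs)
    case (Cons a rs)
    have "degree ([:- a, 1:] * (\<Prod>r\<leftarrow>rs. [:- r, 1:])) \<le> 1 + degree (\<Prod>r\<leftarrow>rs. [:- r, 1:])"
      by (rule order_trans[OF degree_mult_le]) simp
    then show ?case using Cons by simp
  qed simp
  then have top: "coeff ?Q (Suc ?n) = 0" by (intro coeff_eq_0) simp
  have "fold (\<lambda>r u y. u (x * y) - r * u y) (r # rs) w y =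
    (\<Sum>i\<le>?n. coeff ?Q i * (w (x ^ Suc i * y) - r * w (x ^ i * y)))"
    using Cons[of "\<lambda>y. w (x * y) - r * w y"] by (simp add: mult_ac)
  also have "\<dots> = (\<Sum>i\<le>?n. coeff ?Q i * w (x ^ Suc i * y)) - r * (\<Sum>i\<le>?n. coeff ?Q i * w (x ^ i * y))"
    by (simp add: sum_subtractf algebra_simps sum_distrib_left)
  also have "(\<Sum>i\<le>?n. coeff ?Q i * w (x ^ Suc i * y)) = (\<Sum>i\<le>Suc ?n. coeff (pCons 0 ?Q) i * w (x ^ i * y))"
    by (subst sum.atMost_Suc_shift) simp
  also have "(\<Sum>i\<le>?n. coeff ?Q i * w (x ^ i * y)) = (\<Sum>i\<le>Suc ?n. coeff ?Q i * w (x ^ i * y))"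
    using top by simp
  finally show ?case
    by (simp add: sum_subtractf algebra_simps sum_distrib_left)
qed

text \<open>The operators u(y) \<mapsto> u(x * y) commute and are diagonalisable, so
  \<open>w\<close> is a sum of joint eigenvectors for all \<open>x\<close> in a finite spanning set
  of K. A nonzero joint eigenvector is a scalar multiple of its eigenvalue function, and that
  function is an embedding.\<close>

lemma rat_linear_in_span_embeddings:
  fixes w :: "'a::field_char_0 \<Rightarrow> complex"
  assumes K: "number_field TYPE('a)" and w: "rat_linear w"
  shows "w \<in> fn_vs.span embeddings"
proof -
  define joint where "joint \<psi> A u \<longleftrightarrow> rat_linear u \<and> (\<forall>x\<in>A. \<forall>y. u (x * y) = \<psi> x * u y)"
    for \<psi> :: "'a \<Rightarrow> complex" and A u
  have step: "u \<in> fn_vs.span {u. \<exists>\<psi>. joint \<psi> (insert x A) u}" if u: "joint \<psi> A u" and x: "x \<notin> A" for \<psi> x A u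
  proof -
    obtain p :: "rat poly" where p: "p \<noteq> 0" "poly (map_poly of_rat p) x = 0"
      "rsquarefree (map_poly of_rat p :: complex poly)"
      using number_field_squarefree_annihilator[OF K] by blast
    let ?q = "map_poly of_rat p :: complex poly"
    have q0: "?q \<noteq> 0" using p(1) by (simp add: map_poly_eq_0_iff)
    have "finite {z. poly ?q z = 0}" using q0 by (rule poly_roots_finite)
    then obtain rs where rs: "set rs = {z. poly ?q z = 0}" "distinct rs"
      using finite_distinct_list by blast
    let ?Q = "\<Prod>r\<leftarrow>rs. [:- r, 1:]"
    have Q: "smult (lead_coeff ?q) ?Q = ?q"
      using complex_poly_decompose_rsquarefree[OF p(3)]
      unfolding rs(1)[symmetric] prod.distinct_set_conv_list[OF rs(2)] .
    have degq: "degree ?q = length rs"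
    proof -
      have "degree ?Q = length rs" by (rule degree_linear_factors)
      then show ?thesis using Q q0 by (metis degree_smult_eq leading_coeff_0_iff)
    qed
    have ru: "rat_linear u" using u by (simp add: joint_def)
    have zero: "fold (\<lambda>r u y. u (x * y) - r * u y) rs u = (\<lambda>y. 0)"
    proof
      fix y
      have "lead_coeff ?q * fold (\<lambda>r u y. u (x * y) - r * u y) rs u y
         = (\<Sum>i\<le>length rs. coeff (smult (lead_coeff ?q) ?Q) i * u (x ^ i * y))"
        unfolding fold_shift_eq_poly by (simp add: sum_distrib_left mult.assoc)
      also have "\<dots> = (\<Sum>i\<le>length rs. u (of_rat (coeff p i) * (x ^ i * y)))"
        unfolding Q using ru by (simp add: coeff_map_poly rat_linear_def)
      also have "\<dots> = u (\<Sum>i\<le>length rs. of_rat (coeff p i) * (x ^ i * y))"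
        by (rule rat_linear_sum[OF ru, symmetric])
      also have "(\<Sum>i\<le>length rs. of_rat (coeff p i) * (x ^ i * y)) = poly (map_poly of_rat p) x * y"
      proof -
        have "degree (map_poly of_rat p :: 'a poly) = degree p" "degree ?q = degree p"
          by (rule degree_map_poly; simp)+
        then show ?thesis using degq
          by (simp add: poly_altdef coeff_map_poly sum_distrib_right mult.assoc)
      qed
      also have "u \<dots> = 0" using p rat_linear_0[OF ru] by simp
      finally show "fold (\<lambda>r u y. u (x * y) - r * u y) rs u y = 0" using q0 by simp
    qed
    have shift: "joint \<psi> A (\<lambda>y. v (x * y))" if "joint \<psi> A v" for v
      using that unfolding joint_def rat_linear_def by (metis distrib_left mult.left_commute)
    have "\<exists>v. (\<forall>r\<in>set rs. joint \<psi> A (v r) \<and> (\<forall>y. v r (x * y) = r * v r y)) \<and> u = (\<lambda>y. \<Sum>r\<in>set rs. v r y)"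
      by (rule eigenspace_decomposition[where P = "joint \<psi> A", OF _ _ shift rs(2) u zero])
        (auto simp: joint_def rat_linear_def distrib_left mult.left_commute)
    then obtain v where v: "\<And>r. r \<in> set rs \<Longrightarrow> joint \<psi> A (v r)"
      "\<And>r y. r \<in> set rs \<Longrightarrow> v r (x * y) = r * v r y" "u = (\<lambda>y. \<Sum>r\<in>set rs. v r y)" by blast
    have "joint (\<psi>(x := r)) (insert x A) (v r)" if "r \<in> set rs" for r
      using v(1,2)[OF that] x by (auto simp: joint_def)
    then have "sum v (set rs) \<in> fn_vs.span {u. \<exists>\<psi>. joint \<psi> (insert x A) u}"
      by (intro fn_vs.span_sum fn_vs.span_base) blast
    moreover have "sum v (set rs) = u" unfolding v(3) by (auto simp: fun_eq_iff sum_fun_apply)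
    ultimately show ?thesis by simp
  qed
  have main: "u \<in> fn_vs.span {u. \<exists>\<psi>. joint \<psi> A u}" if "finite A" "rat_linear u" for A u
    using that
  proof (induction A arbitrary: u rule: finite_induct)
    case empty
    then show ?case by (intro fn_vs.span_base) (simp add: joint_def)
  next
    case (insert x A)
    have "{u. \<exists>\<psi>. joint \<psi> A u} \<subseteq> fn_vs.span {u. \<exists>\<psi>. joint \<psi> (insert x A) u}"
      using step insert.hyps by blast
    then have "fn_vs.span {u. \<exists>\<psi>. joint \<psi> A u} \<subseteq> fn_vs.span {u. \<exists>\<psi>. joint \<psi> (insert x A) u}"
      by (rule fn_vs.span_minimal) (rule fn_vs.subspace_span)
    then show ?case using insert by blast
  qed
  obtain B :: "'a set" where B: "finite B" "rat_vs.span B = UNIV"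
    using K unfolding number_field_def by auto
  have "u \<in> fn_vs.span embeddings" if u: "joint \<psi> B u" for \<psi> u
  proof (cases "u = 0")
    case True then show ?thesis by (simp add: fn_vs.span_zero)
  next
    case False
    have ru: "rat_linear u" using u by (simp add: joint_def)
    \<comment> \<open>By linearity an eigenvector for the spanning set \<open>B\<close> is one for
      every element of the field.\<close>
    have "\<exists>c. \<forall>y. u (x * y) = c * u y" for x
    proof -
      have "x \<in> rat_vs.span B" using B by simp
      then show ?thesis
      proof (induction rule: rat_vs.span_induct_alt)
        case base
        then show ?case by (intro exI[of _ 0]) (simp add: rat_linear_0[OF ru])
      next
        case (step q b x)
        then obtain c where c: "\<And>y. u (x * y) = c * u y" by blast
        have "u ((of_rat q * b + x) * y) = (of_rat q * \<psi> b + c) * u y" for y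
        proof -
          have "u ((of_rat q * b + x) * y) = of_rat q * u (b * y) + u (x * y)"
            using ru unfolding rat_linear_def by (metis distrib_right mult.assoc)
          then show ?thesis using u step(1) c by (simp add: joint_def algebra_simps)
        qed
        then show ?case by blast
      qed
    qed
    then obtain c where c: "\<And>x y. u (x * y) = c x * u y" by metis
    have u1: "u 1 \<noteq> 0"
    proof
      assume "u 1 = 0"
      then have "u x = 0" for x using c[of x 1] by simp
      with False show False by (auto simp: fun_eq_iff)
    qed
    have ux: "u x = c x * u 1" for x using c[of x 1] by simp
    \<comment> \<open>Evaluating at 1 gives \<open>u x = c x * u 1\<close>; as \<open>u 1\<close> is
      nonzero, additivity of \<open>u\<close> and the eigenvector equation pass to
      \<open>c\<close>.\<close>
    have "field_hom c"
    proof
      show "c 0 = 0" using ux[of 0] rat_linear_0[OF ru] u1 by simp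
      show "c 1 = 1" using ux[of 1] u1 by simp
      fix x y
      have "c (x + y) * u 1 = (c x + c y) * u 1"
        using ru unfolding rat_linear_def by (metis distrib_right ux)
      then show "c (x + y) = c x + c y" using u1 by simp
      have "c (x * y) * u 1 = c x * c y * u 1" using c[of x y] ux by (metis mult.assoc)
      then show "c (x * y) = c x * c y" using u1 by simp
    qed
    then have "(\<lambda>x. u 1 * c x) \<in> fn_vs.span embeddings"
      by (intro fn_vs.span_scale fn_vs.span_base) (simp add: embeddings_def)
    moreover have "(\<lambda>x. u 1 * c x) = u" by (rule ext) (metis ux mult.commute)
    ultimately show ?thesis by simp
  qed
  then have "{u. \<exists>\<psi>. joint \<psi> B u} \<subseteq> fn_vs.span embeddings" by blast
  then have "fn_vs.span {u. \<exists>\<psi>. joint \<psi> B u} \<subseteq> fn_vs.span embeddings"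
    by (rule fn_vs.span_minimal) (rule fn_vs.subspace_span)
  then show ?thesis using main[OF B(1) w] by blast
qed

text \<open>Dedekind's argument: the relation at \<open>y * x\<close> minus \<open>\<tau> y\<close>
  times the relation at \<open>x\<close> no longer involves \<open>\<tau>\<close>, and some
  \<open>y\<close> separates \<open>\<tau>\<close> from any other embedding.\<close>

lemma embeddings_independent_aux:
  fixes c :: "('a::field_char_0 \<Rightarrow> complex) \<Rightarrow> complex"
  assumes "finite F" "F \<subseteq> embeddings" "\<And>x. (\<Sum>\<sigma>\<in>F. c \<sigma> * \<sigma> x) = 0"
  shows "\<forall>\<sigma>\<in>F. c \<sigma> = 0"
  using assms
proof (induction F arbitrary: c rule: finite_induct)
  case empty then show ?case by simp
next
  case (insert \<tau> F)
  have hom: "\<sigma> (x * y) = \<sigma> x * \<sigma> y" if "\<sigma> \<in> insert \<tau> F" for \<sigma> x y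
  proof -
    interpret field_hom \<sigma> using that insert.prems by (auto simp: embeddings_def)
    show ?thesis by (rule hom_mult)
  qed
  have rel: "c \<tau> * \<tau> x + (\<Sum>\<sigma>\<in>F. c \<sigma> * \<sigma> x) = 0" for x
    using insert.prems(2)[of x] insert.hyps by simp
  have "c \<sigma> * (\<sigma> y - \<tau> y) = 0" if "\<sigma> \<in> F" for \<sigma> y
  proof -
    have "(\<Sum>\<sigma>\<in>F. c \<sigma> * (\<sigma> y - \<tau> y) * \<sigma> x) = 0" for x
    proof -
      have "(\<Sum>\<sigma>\<in>F. c \<sigma> * (\<sigma> y - \<tau> y) * \<sigma> x) = (\<Sum>\<sigma>\<in>F. c \<sigma> * \<sigma> (y * x)) - \<tau> y * (\<Sum>\<sigma>\<in>F. c \<sigma> * \<sigma> x)"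
        unfolding sum_distrib_left sum_subtractf[symmetric]
        by (rule sum.cong) (auto simp: hom algebra_simps)
      also have "\<dots> = (c \<tau> * \<tau> (y * x) + (\<Sum>\<sigma>\<in>F. c \<sigma> * \<sigma> (y * x)))
          - \<tau> y * (c \<tau> * \<tau> x + (\<Sum>\<sigma>\<in>F. c \<sigma> * \<sigma> x))"
        by (simp add: hom algebra_simps)
      finally show ?thesis using rel by simp
    qed
    then show ?thesis using insert.IH[of "\<lambda>\<sigma>. c \<sigma> * (\<sigma> y - \<tau> y)"] insert.prems that by auto
  qed
  then have F0: "\<forall>\<sigma>\<in>F. c \<sigma> = 0" using insert.hyps(2) by (metis ext mult_eq_0_iff right_minus_eq)
  then have "c \<tau> * \<tau> 1 = 0" using rel[of 1] by simp
  moreover have "\<tau> 1 = 1"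
  proof -
    interpret field_hom \<tau> using insert.prems by (auto simp: embeddings_def)
    show ?thesis by simp
  qed
  ultimately show ?case using F0 by simp
qed

lemma embeddings_independent: "\<not> fn_vs.dependent (embeddings :: ('a::field_char_0 \<Rightarrow> complex) set)"
proof
  assume "fn_vs.dependent (embeddings :: ('a \<Rightarrow> complex) set)"
  then obtain t u and v :: "'a \<Rightarrow> complex" where t: "finite t" "t \<subseteq> embeddings" "(\<Sum>v\<in>t. (\<lambda>x. u v * v x)) = 0" "v \<in> t" "u v \<noteq> 0"
    unfolding fn_vs.dependent_explicit by blast
  have "(\<Sum>\<sigma>\<in>t. u \<sigma> * \<sigma> x) = 0" for x
    using fun_cong[OF t(3), of x] by (simp add: sum_fun_apply)
  then show False using embeddings_independent_aux[OF t(1,2)] t(4,5) by blast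
qed

text \<open>The dual basis of a rational basis and the embeddings are two bases of the complex vector
  space of \<open>\<rat>\<close>-linear maps into \<open>\<complex>\<close>.\<close>

lemma embeddings_finite_card:
  assumes K: "number_field TYPE('a::field_char_0)"
  shows "finite (embeddings :: ('a \<Rightarrow> complex) set)"
    and "card (embeddings :: ('a \<Rightarrow> complex) set) = number_field_degree TYPE('a)"
proof -
  obtain B :: "'a set" where B: "finite B" "\<not> rat_vs.dependent B" "rat_vs.span B = UNIV"
    "card B = number_field_degree TYPE('a)"
    using number_field_basis[OF K] by blast
  define \<phi> :: "'a \<Rightarrow> 'a \<Rightarrow> complex" where "\<phi> b x = of_rat (rat_vs.representation B x b)" for b x
  have rl: "rat_linear (\<phi> b)" for b
    using B by (auto simp: rat_linear_def \<phi>_def rat_vs.representation_add rat_vs.representation_scale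
        of_rat_add of_rat_mult)
  have delta: "\<phi> b c = (if b = c then 1 else 0)" if "c \<in> B" for b c
    using rat_vs.representation_basis[OF B(2) that] by (auto simp: \<phi>_def)
  have inj: "inj_on \<phi> B"
    by (rule inj_onI) (metis delta zero_neq_one)
  have ind: "\<not> fn_vs.dependent (\<phi> ` B)"
  proof
    assume "fn_vs.dependent (\<phi> ` B)"
    then obtain u v where u: "v \<in> \<phi> ` B" "u v \<noteq> 0" "(\<Sum>v\<in>\<phi> ` B. (\<lambda>x. u v * v x)) = 0"
      using fn_vs.dependent_finite[of "\<phi> ` B"] B(1) by auto
    then obtain c where c: "c \<in> B" "v = \<phi> c" by blast
    have "0 = (\<Sum>b\<in>B. u (\<phi> b) * \<phi> b c)"
      using fun_cong[OF u(3), of c] by (simp add: sum_fun_apply sum.reindex[OF inj])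
    also have "\<dots> = (\<Sum>b\<in>B. if b = c then u (\<phi> b) else 0)"
      using delta[OF c(1)] by (intro sum.cong) auto
    also have "\<dots> = u v" using c B(1) by (simp add: sum.delta)
    finally show False using u by simp
  qed
  have sub: "embeddings \<subseteq> fn_vs.span (\<phi> ` B)"
  proof
    fix \<sigma> :: "'a \<Rightarrow> complex" assume "\<sigma> \<in> embeddings"
    then have rs: "rat_linear \<sigma>" by (simp add: embeddings_def field_hom_rat_linear)
    have "\<sigma> = (\<Sum>b\<in>B. (\<lambda>x. \<sigma> b * \<phi> b x))"
    proof
      fix x
      have "x = (\<Sum>b\<in>B. of_rat (rat_vs.representation B x b) * b)"
        using rat_vs.sum_representation_eq[OF B(2) _ B(1) order_refl, of x] B(3) by simp
      then have "\<sigma> x = \<sigma> (\<Sum>b\<in>B. of_rat (rat_vs.representation B x b) * b)" by simp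
      also have "\<dots> = (\<Sum>b\<in>B. of_rat (rat_vs.representation B x b) * \<sigma> b)"
        unfolding rat_linear_sum[OF rs] using rs by (simp add: rat_linear_def)
      finally show "\<sigma> x = (\<Sum>b\<in>B. (\<lambda>x. \<sigma> b * \<phi> b x)) x"
        by (simp add: sum_fun_apply \<phi>_def mult.commute)
    qed
    also have "\<dots> \<in> fn_vs.span (\<phi> ` B)"
      by (intro fn_vs.span_sum fn_vs.span_scale fn_vs.span_base) auto
    finally show "\<sigma> \<in> fn_vs.span (\<phi> ` B)" .
  qed
  have 1: "finite (embeddings :: ('a \<Rightarrow> complex) set) \<and> card (embeddings :: ('a \<Rightarrow> complex) set) \<le> card (\<phi> ` B)"
    using B(1) by (intro fn_vs.independent_span_bound[OF _ embeddings_independent sub]) auto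
  have "\<phi> ` B \<subseteq> fn_vs.span embeddings" using rat_linear_in_span_embeddings[OF K rl] by blast
  then have "card (\<phi> ` B) \<le> card (embeddings :: ('a \<Rightarrow> complex) set)"
    using fn_vs.independent_span_bound[OF _ ind] 1 by blast
  then show "finite (embeddings :: ('a \<Rightarrow> complex) set)"
    "card (embeddings :: ('a \<Rightarrow> complex) set) = number_field_degree TYPE('a)"
    using 1 card_image[OF inj] B(4) by auto
qed

section \<open>The discriminant\<close>

hide_const (open) Matrix.mat Matrix.row Matrix.col Matrix.vec Determinant.det
no_notation Matrix.vec_index (infixl \<open>$\<close> 100)
no_notation fps_nth (infixl \<open>$\<close> 75)

text \<open>The discriminant is defined with matrices indexed by numbers, while volumes and
  orthogonal maps live on spaces indexed by a finite type. The bijection \<open>h\<close> conjugates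
  permutations of one index set into permutations of the other and preserves signs.\<close>

lemma det_jnf_eq_det:
  fixes f :: "nat \<Rightarrow> nat \<Rightarrow> 'c::comm_ring_1" and h :: "'n::finite \<Rightarrow> nat"
  assumes h: "bij_betw h UNIV {0..<n}"
  shows "Determinant.det (Matrix.mat n n (\<lambda>(i, j). f i j)) = det (\<chi> i j. f (h i) (h j))"
proof -
  define h' where "h' = inv_into UNIV h"
  define T where "T p = (\<lambda>x. if x \<in> {0..<n} then h (p (h' x)) else x)" for p
  have inj: "inj h" and h'h: "h' (h x) = x" for x
    using h by (auto simp: h'_def bij_betw_def)
  have hh': "h (h' k) = k" if "k \<in> {0..<n}" for k
    using that h by (auto simp: h'_def bij_betw_def f_inv_into_f)
  have loc: "permutes_bij_finite p UNIV {0..<n} h h'" if "p permutes UNIV" for p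
    using that h h'h by unfold_locales auto
  have T: "T p permutes {0..<n}" "sign (T p) = sign p" if "p permutes UNIV" for p
    using permutes_bij.permutes_p'[OF permutes_bij_finite.axioms(1)[OF loc[OF that]]]
      permutes_bij_finite.sign_p'[OF loc[OF that]] by (simp_all add: T_def[abs_def])
  have "bij_betw T {p. p permutes UNIV} {p. p permutes {0..<n}}"
    unfolding bij_betw_def
  proof
    show "inj_on T {p. p permutes UNIV}"
    proof (rule inj_onI, rule ext)
      fix p q x assume "T p = T q"
      then have "T p (h x) = T q (h x)" by simp
      moreover have "h x \<in> {0..<n}" using h by (auto simp: bij_betw_def)
      ultimately show "p x = q x" using inj by (simp add: T_def h'h inj_eq)
    qed
    \<comment> \<open>Surjectivity is by counting: both sets of permutations have n!
      elements.\<close>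
    then have "card (T ` {p. p permutes UNIV}) = fact CARD('n)"
      by (simp add: card_image card_permutations)
    moreover have "CARD('n) = n" using bij_betw_same_card[OF h] by simp
    ultimately have "card (T ` {p. p permutes UNIV}) = card {p. p permutes {0..<n}}"
      by (simp add: card_permutations)
    then show "T ` {p. p permutes UNIV} = {p. p permutes {0..<n}}"
      using T by (intro card_subset_eq) (auto simp: finite_permutations)
  qed
  then have "(\<Sum>p | p permutes {0..<n}. of_int (sign p) * (\<Prod>i = 0..<n. f i (p i))) =
     (\<Sum>p | p permutes UNIV. of_int (sign (T p)) * (\<Prod>i = 0..<n. f i (T p i)))"
    by (rule sum.reindex_bij_betw[symmetric])
  also have "\<dots> = (\<Sum>p | p permutes UNIV. of_int (sign p) * (\<Prod>i\<in>UNIV. f (h i) (h (p i))))"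
  proof (rule sum.cong[OF refl])
    fix p :: "'n \<Rightarrow> 'n" assume "p \<in> {p. p permutes UNIV}"
    then have p: "p permutes UNIV" by simp
    have "(\<Prod>i = 0..<n. f i (T p i)) = (\<Prod>i\<in>UNIV. f (h i) (T p (h i)))"
      using h by (rule prod.reindex_bij_betw[symmetric])
    also have "\<dots> = (\<Prod>i\<in>UNIV. f (h i) (h (p i)))"
      using h by (intro prod.cong) (auto simp: T_def h'h bij_betw_def)
    finally show "of_int (sign (T p)) * (\<Prod>i = 0..<n. f i (T p i)) =
      of_int (sign p) * (\<Prod>i\<in>UNIV. f (h i) (h (p i)))" using T[OF p] by simp
  qed
  also have "\<dots> = det (\<chi> i j. f (h i) (h j))" by (simp add: Determinants.det_def)
  finally have "(\<Sum>p | p permutes {0..<n}. of_int (sign p) * (\<Prod>i = 0..<n. f i (p i))) = det (\<chi> i j. f (h i) (h j))" .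
  moreover have "Determinant.det (Matrix.mat n n (\<lambda>(i, j). f i j)) =
      (\<Sum>p | p permutes {0..<n}. of_int (sign p) * (\<Prod>i = 0..<n. f i (p i)))"
    unfolding Determinant.det_def dim_row_mat dim_col_mat if_P[OF refl]
  proof (intro sum.cong refl arg_cong2[where f = "(*)"] prod.cong)
    fix p i assume "p \<in> {p. p permutes {0..<n}}" "i \<in> {0..<n}"
    then have "i < n" "p i < n" using permutes_in_image[of p "{0..<n}" i] by auto
    then show "Matrix.mat n n (\<lambda>(i, j). f i j) $$ (i, p i) = f i (p i)" by simp
  qed
  ultimately show ?thesis by simp
qed

lemma number_field_degree_pos:
  assumes "number_field TYPE('a::field_char_0)"
  shows "number_field_degree TYPE('a) > 0"
proof -
  obtain B :: "'a set" where B: "finite B" "rat_vs.span B = UNIV" "card B = number_field_degree TYPE('a)"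
    and "\<not> rat_vs.dependent B"
    by (rule number_field_basis[OF assms])
  have "B \<noteq> {}"
  proof
    assume "B = {}"
    then have "(1::'a) \<in> {0}" using B by (metis UNIV_I rat_vs.span_empty)
    then show False by simp
  qed
  then show ?thesis using B by (metis card_gt_0_iff)
qed

text \<open>Indexing vectors by the embeddings themselves gives a finite type of cardinality \<open>d\<close>, as the
  Cartesian spaces of HOL-Analysis require; off number fields the type is a dummy singleton.\<close>

typedef (overloaded) 'a emb =
  "{\<sigma> :: 'a::field_char_0 \<Rightarrow> complex. if number_field TYPE('a) then \<sigma> \<in> embeddings else \<sigma> = (\<lambda>_. 0)}"
proof (cases "number_field TYPE('a)")
  case True
  then have "card (embeddings :: ('a \<Rightarrow> complex) set) > 0"
    using embeddings_finite_card number_field_degree_pos by metis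
  then have "(embeddings :: ('a \<Rightarrow> complex) set) \<noteq> {}" by auto
  then show ?thesis using True by auto
qed auto

instance emb :: (field_char_0) finite
proof
  have "finite {\<sigma> :: 'a \<Rightarrow> complex. if number_field TYPE('a) then \<sigma> \<in> embeddings else \<sigma> = (\<lambda>_. 0)}"
    using embeddings_finite_card(1)[where 'a = 'a] by (cases "number_field TYPE('a)") auto
  then have "finite (range (Rep_emb :: 'a emb \<Rightarrow> _))"
    unfolding type_definition.Rep_range[OF type_definition_emb] .
  then show "finite (UNIV :: 'a emb set)"
    by (rule finite_imageD) (meson Rep_emb_inject injI)
qed

text \<open>The transformation rule for Lebesgue measure under linear maps needs a well-ordered index type.\<close>

instantiation emb :: (field_char_0) wellorder
begin

definition emb_index :: "'a emb \<Rightarrow> nat" where "emb_index = (SOME f. inj f)"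
definition less_eq_emb :: "'a emb \<Rightarrow> 'a emb \<Rightarrow> bool" where "\<sigma> \<le> \<tau> \<longleftrightarrow> emb_index \<sigma> \<le> emb_index \<tau>"
definition less_emb :: "'a emb \<Rightarrow> 'a emb \<Rightarrow> bool" where "\<sigma> < \<tau> \<longleftrightarrow> emb_index \<sigma> < emb_index \<tau>"

instance
proof
  have "\<exists>f :: 'a emb \<Rightarrow> nat. inj f" using finite_imp_inj_to_nat_seg[of "UNIV :: 'a emb set"] by blast
  then have "inj (emb_index :: 'a emb \<Rightarrow> nat)" unfolding emb_index_def by (rule someI_ex)
  then show "\<sigma> \<le> \<tau> \<Longrightarrow> \<tau> \<le> \<sigma> \<Longrightarrow> \<sigma> = \<tau>" for \<sigma> \<tau> :: "'a emb"
    by (auto simp: less_eq_emb_def inj_eq)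
  show "P a" if step: "\<And>x. (\<And>y. y < x \<Longrightarrow> P y) \<Longrightarrow> P x" for P and a :: "'a emb"
  proof (induction a rule: measure_induct_rule[of emb_index])
    case (less x)
    show ?case by (rule step, rule less.IH) (simp add: less_emb_def)
  qed
qed (auto simp: less_eq_emb_def less_emb_def)

end

section \<open>Matrices of conjugates, traces and integral bases\<close>

definition emb_matrix :: "('a::field_char_0 emb \<Rightarrow> 'a) \<Rightarrow> complex ^ 'a emb ^ 'a emb" where
  "emb_matrix b = (\<chi> \<sigma> j. Rep_emb \<sigma> (b j))"

definition emb_cnj :: "'a::field_char_0 emb \<Rightarrow> 'a emb" where
  "emb_cnj \<sigma> = Abs_emb (cnj \<circ> Rep_emb \<sigma>)"

text \<open>A spanning condition only: in a number field the index type has d elements, so a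
  spanning family is automatically independent. The same holds for
  \<open>rat_spanning\<close>.\<close>

definition int_basis :: "('a::field_char_0 emb \<Rightarrow> 'a) \<Rightarrow> bool" where
  "int_basis b \<longleftrightarrow> (\<forall>j. algebraic_int (b j)) \<and>
     (\<forall>x. algebraic_int x \<longrightarrow> (\<exists>c. x = (\<Sum>j\<in>UNIV. of_int (c j) * b j)))"

definition rat_spanning :: "('a::field_char_0 emb \<Rightarrow> 'a) \<Rightarrow> bool" where
  "rat_spanning b \<longleftrightarrow> (\<forall>x. \<exists>c. x = (\<Sum>j\<in>UNIV. of_rat (c j) * b j))"

lemma field_hom_algebraic_int:
  fixes \<sigma> :: "'a::field_char_0 \<Rightarrow> complex"
  assumes "field_hom \<sigma>" "algebraic_int x"
  shows "algebraic_int (\<sigma> x)"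
proof -
  interpret field_hom \<sigma> by fact
  obtain p where p: "poly (map_poly of_int p) x = 0" "lead_coeff p = 1"
    using assms(2) algebraic_int_altdef_ipoly by blast
  have "poly (map_poly of_int p) (\<sigma> x) = \<sigma> (poly (map_poly of_int p) x)"
    by (simp add: poly_altdef coeff_map_poly hom_distribs)
  then show ?thesis using p unfolding algebraic_int_altdef_ipoly by auto
qed

lemma cmod_of_rat: "cmod (of_rat q) = \<bar>of_rat q\<bar>"
  by (cases q) (simp add: of_rat_rat norm_divide)

lemma det_in_Rats:
  fixes A :: "complex ^ 'n::finite ^ 'n"
  assumes "\<And>i j. A $ i $ j \<in> \<rat>" shows "det A \<in> \<rat>"
  unfolding det_def using assms by (intro Rats_sum Rats_mult Rats_prod) auto

lemma det_in_Ints: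
  fixes A :: "complex ^ 'n::finite ^ 'n"
  assumes "\<And>i j. A $ i $ j \<in> \<int>" shows "det A \<in> \<int>"
  unfolding det_def using assms by (intro Ints_sum Ints_mult Ints_prod) auto

context
  assumes K: "number_field TYPE('a::field_char_0)"
begin

lemma Rep_emb_embeddings: "Rep_emb (\<sigma> :: 'a emb) \<in> embeddings"
  using Rep_emb[of \<sigma>] K by auto

lemma Rep_emb_hom: "field_hom (Rep_emb (\<sigma> :: 'a emb))"
  using Rep_emb_embeddings by (auto simp: embeddings_def)



lemma Rep_emb_simps:
  fixes \<sigma> :: "'a emb"
  shows "Rep_emb \<sigma> (x + y) = Rep_emb \<sigma> x + Rep_emb \<sigma> y"
    "Rep_emb \<sigma> (x - y) = Rep_emb \<sigma> x - Rep_emb \<sigma> y"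
    "Rep_emb \<sigma> (x * y) = Rep_emb \<sigma> x * Rep_emb \<sigma> y"
    "Rep_emb \<sigma> 0 = 0" "Rep_emb \<sigma> 1 = 1" "Rep_emb \<sigma> (x ^ n) = Rep_emb \<sigma> x ^ n"
    "Rep_emb \<sigma> (of_rat q) = of_rat q" "Rep_emb \<sigma> (of_int k) = of_int k"
    "Rep_emb \<sigma> (of_nat m) = of_nat m"
    "Rep_emb \<sigma> (sum f A) = (\<Sum>i\<in>A. Rep_emb \<sigma> (f i))"
    "Rep_emb \<sigma> (inverse x) = inverse (Rep_emb \<sigma> x)"
proof -
  interpret field_hom "Rep_emb \<sigma>" by (rule Rep_emb_hom)
  show "Rep_emb \<sigma> (x + y) = Rep_emb \<sigma> x + Rep_emb \<sigma> y"
    "Rep_emb \<sigma> (x - y) = Rep_emb \<sigma> x - Rep_emb \<sigma> y"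
    "Rep_emb \<sigma> (x * y) = Rep_emb \<sigma> x * Rep_emb \<sigma> y"
    "Rep_emb \<sigma> 0 = 0" "Rep_emb \<sigma> 1 = 1" "Rep_emb \<sigma> (x ^ n) = Rep_emb \<sigma> x ^ n"
    "Rep_emb \<sigma> (of_int k) = of_int k"
    "Rep_emb \<sigma> (of_nat m) = of_nat m"
    "Rep_emb \<sigma> (sum f A) = (\<Sum>i\<in>A. Rep_emb \<sigma> (f i))"
    "Rep_emb \<sigma> (inverse x) = inverse (Rep_emb \<sigma> x)"
    by (simp_all add: hom_distribs)
  show "Rep_emb \<sigma> (of_rat q) = of_rat q" by (rule field_hom_of_rat[OF Rep_emb_hom])
qed

lemma Rep_emb_eq_0_iff: "Rep_emb (\<sigma> :: 'a emb) x = 0 \<longleftrightarrow> x = 0"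
proof
  assume 0: "Rep_emb \<sigma> x = 0"
  show "x = 0"
  proof (rule ccontr)
    assume "x \<noteq> 0"
    then have "Rep_emb \<sigma> (x * inverse x) = 1" by (simp add: Rep_emb_simps)
    then show False using 0 by (simp only: Rep_emb_simps) simp
  qed
qed (simp add: Rep_emb_simps)



lemma range_Rep_emb: "range (Rep_emb :: 'a emb \<Rightarrow> _) = embeddings"
proof -
  have "range (Rep_emb :: 'a emb \<Rightarrow> _) = {\<sigma>. if number_field TYPE('a) then \<sigma> \<in> embeddings else \<sigma> = (\<lambda>_. 0)}"
    by (rule type_definition.Rep_range[OF type_definition_emb])
  then show ?thesis using K by auto
qed

lemma inj_Rep_emb: "inj (Rep_emb :: 'a emb \<Rightarrow> _)"
  by (meson Rep_emb_inject injI)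

lemma card_emb: "CARD('a emb) = number_field_degree TYPE('a)"
  using embeddings_finite_card(2)[OF K] card_image[OF inj_Rep_emb] range_Rep_emb by simp

lemma Rep_emb_cnj: "Rep_emb (emb_cnj (\<sigma> :: 'a emb)) = cnj \<circ> Rep_emb \<sigma>"
  unfolding emb_cnj_def using K embedding_cnj[OF Rep_emb_embeddings] by (intro Abs_emb_inverse) auto

lemma bij_emb_cnj: "bij (emb_cnj :: 'a emb \<Rightarrow> 'a emb)"
proof (rule involuntory_imp_bij)
  fix \<sigma> :: "'a emb"
  have "Rep_emb (emb_cnj (emb_cnj \<sigma>)) = Rep_emb \<sigma>" by (auto simp: Rep_emb_cnj fun_eq_iff)
  then show "emb_cnj (emb_cnj \<sigma>) = \<sigma>" by (simp add: Rep_emb_inject)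
qed

lemma sum_emb_cnj: "(\<Sum>\<sigma>\<in>UNIV. f (emb_cnj (\<sigma> :: 'a emb))) = (\<Sum>\<sigma>\<in>UNIV. f \<sigma>)"
  by (rule sum.reindex_bij_betw[OF bij_emb_cnj])

lemma emb_independent:
  assumes "\<And>x. (\<Sum>\<sigma>\<in>UNIV. v \<sigma> * Rep_emb (\<sigma> :: 'a emb) x) = 0"
  shows "v \<sigma> = 0"
proof -
  define c where "c \<tau> = v (Abs_emb \<tau>)" for \<tau> :: "'a \<Rightarrow> complex"
  have "(\<Sum>\<tau>\<in>embeddings. c \<tau> * \<tau> x) = 0" for x
  proof -
    have "(\<Sum>\<tau>\<in>embeddings. c \<tau> * \<tau> x) = (\<Sum>\<sigma>\<in>UNIV. c (Rep_emb (\<sigma> :: 'a emb)) * Rep_emb \<sigma> x)"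
      unfolding range_Rep_emb[symmetric] by (simp add: sum.reindex[OF inj_Rep_emb])
    then show ?thesis using assms by (simp add: c_def Rep_emb_inverse)
  qed
  then have "c (Rep_emb \<sigma>) = 0"
    using embeddings_independent_aux[OF embeddings_finite_card(1)[OF K] order_refl] Rep_emb_embeddings by blast
  then show ?thesis by (simp add: c_def Rep_emb_inverse)
qed

text \<open>A vector in the kernel of the transpose is a linear relation between the embeddings on
  the family \<open>b\<close>, hence on all of K, and embeddings are independent.\<close>

lemma det_emb_matrix_nonzero:
  fixes b :: "'a emb \<Rightarrow> 'a"
  assumes "rat_spanning b"
  shows "det (emb_matrix b) \<noteq> 0"
proof -
  have "x = 0" if "transpose (emb_matrix b) *v x = 0" for x
  proof -
    have b0: "(\<Sum>\<sigma>\<in>UNIV. x $ \<sigma> * Rep_emb \<sigma> (b j)) = 0" for j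
      using arg_cong[OF that, of "\<lambda>v. v $ j"]
      by (simp add: matrix_vector_mult_def transpose_def emb_matrix_def mult.commute)
    have "(\<Sum>\<sigma>\<in>UNIV. x $ \<sigma> * Rep_emb \<sigma> y) = 0" for y
    proof -
      obtain c where c: "y = (\<Sum>j\<in>UNIV. of_rat (c j) * b j)" using assms by (auto simp: rat_spanning_def)
      have "(\<Sum>\<sigma>\<in>UNIV. x $ \<sigma> * Rep_emb \<sigma> y) = (\<Sum>\<sigma>\<in>UNIV. \<Sum>j\<in>UNIV. of_rat (c j) * (x $ \<sigma> * Rep_emb \<sigma> (b j)))"
        by (simp add: c Rep_emb_simps sum_distrib_left mult.left_commute)
      also have "\<dots> = (\<Sum>j\<in>UNIV. of_rat (c j) * (\<Sum>\<sigma>\<in>UNIV. x $ \<sigma> * Rep_emb \<sigma> (b j)))"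
        by (subst sum.swap) (simp add: sum_distrib_left)
      finally show ?thesis using b0 by simp
    qed
    then show "x = 0" using emb_independent by (simp add: vec_eq_iff)
  qed
  then have "invertible (transpose (emb_matrix b))"
    using invertible_left_inverse matrix_left_invertible_ker by blast
  then show ?thesis by (simp add: invertible_det_nz)
qed

lemma emb_matrix_mult_coeffs:
  fixes b :: "'a emb \<Rightarrow> 'a"
  assumes "x = (\<Sum>j\<in>UNIV. of_rat (c j) * b j)"
  shows "emb_matrix b *v (\<chi> j. of_rat (c j)) = (\<chi> \<sigma>. Rep_emb \<sigma> x)"
  by (simp add: assms vec_eq_iff emb_matrix_def matrix_vector_mult_def Rep_emb_simps mult.commute)

lemma rat_coeffs_unique:
  fixes b :: "'a emb \<Rightarrow> 'a"
  assumes "det (emb_matrix b) \<noteq> 0" "(\<Sum>j\<in>UNIV. of_rat (c j) * b j) = (\<Sum>j\<in>UNIV. of_rat (c' j) * b j)"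
  shows "c j = c' j"
proof -
  have "emb_matrix b *v (\<chi> j. of_rat (c j)) = emb_matrix b *v (\<chi> j. of_rat (c' j))"
    using emb_matrix_mult_coeffs[OF refl, where c = c and b = b]
      emb_matrix_mult_coeffs[OF refl, where c = c' and b = b] assms(2) by simp
  moreover have "inj ((*v) (emb_matrix b))"
    using assms(1) invertible_det_nz[of "emb_matrix b"] invertible_left_inverse matrix_left_invertible_injective by blast
  ultimately have "(\<chi> j. of_rat (c j)) = (\<chi> j. complex_of_rat (c' j))" by (simp add: inj_eq)
  then show ?thesis by (simp add: vec_eq_iff)
qed

lemma inj_if_det:
  fixes b :: "'a emb \<Rightarrow> 'a"
  assumes "det (emb_matrix b) \<noteq> 0"
  shows "inj b"
proof (rule injI)
  fix i k assume "b i = b k"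
  then have "(\<Sum>j\<in>UNIV. of_rat (if j = i then 1 else 0) * b j) = (\<Sum>j\<in>UNIV. of_rat (if j = k then 1 else 0) * b j)"
    by (simp add: if_distrib[of of_rat] if_distrib[of "\<lambda>x. x * _"] cong: if_cong)
  from rat_coeffs_unique[OF assms this, of i] show "i = k" by (simp split: if_splits)
qed

lemma rat_span_UNIV_if_card:
  fixes B :: "'a set"
  assumes "\<not> rat_vs.dependent B" "finite B" "card B = number_field_degree TYPE('a)"
  shows "rat_vs.span B = UNIV"
proof (rule ccontr)
  assume "rat_vs.span B \<noteq> UNIV"
  then obtain x where x: "x \<notin> rat_vs.span B" by auto
  obtain E :: "'a set" where E: "finite E" "rat_vs.span E = UNIV" "card E = number_field_degree TYPE('a)"
    and "\<not> rat_vs.dependent E"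
    by (rule number_field_basis[OF K])
  have "\<not> rat_vs.dependent (insert x B)" using assms(1) x by (simp add: rat_vs.independent_insert)
  then have "card (insert x B) \<le> card E"
    using rat_vs.independent_span_bound[OF E(1)] E(2) by auto
  moreover have "x \<notin> B" using x rat_vs.span_base[of x B] by blast
  ultimately show False using assms(2,3) E(3) by simp
qed

lemma rat_spanning_if_bij_span:
  fixes f :: "'a emb \<Rightarrow> 'a"
  assumes "bij_betw f UNIV B" "rat_vs.span B = UNIV"
  shows "rat_spanning f"
  unfolding rat_spanning_def
proof
  fix x :: 'a
  have "finite B" using bij_betw_finite[OF assms(1)] by simp
  then obtain u where "x = (\<Sum>v\<in>B. of_rat (u v) * v)" using rat_vs.span_finite[of B] assms(2) by auto
  also have "\<dots> = (\<Sum>j\<in>UNIV. of_rat (u (f j)) * f j)"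
    by (rule sum.reindex_bij_betw[OF assms(1), symmetric])
  finally show "\<exists>c. x = (\<Sum>j\<in>UNIV. of_rat (c j) * f j)" by (intro exI[of _ "\<lambda>j. u (f j)"])
qed

text \<open>This determinant criterion is how spanning families are recognised, both in the exchange
  argument for integral bases and in the Vandermonde argument for powers of a primitive
  element.\<close>

lemma rat_spanning_if_det:
  fixes b :: "'a emb \<Rightarrow> 'a"
  assumes "det (emb_matrix b) \<noteq> 0"
  shows "rat_spanning b"
proof -
  have inj: "inj b" by (rule inj_if_det[OF assms])
  have ind: "\<not> rat_vs.dependent (range b)"
  proof
    assume "rat_vs.dependent (range b)"
    then obtain u i where u: "(\<Sum>v\<in>range b. of_rat (u v) * v) = 0" "u (b i) \<noteq> 0"
      using rat_vs.dependent_finite[of "range b"] by auto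
    have "(\<Sum>j\<in>UNIV. of_rat (u (b j)) * b j) = (\<Sum>j\<in>UNIV. of_rat 0 * b j)"
      using u(1) by (simp add: sum.reindex[OF inj])
    from rat_coeffs_unique[OF assms this, of i] u(2) show False by simp
  qed
  have "rat_vs.span (range b) = UNIV"
    using card_image[OF inj] by (intro rat_span_UNIV_if_card ind) (simp_all add: card_emb)
  then show ?thesis using inj by (intro rat_spanning_if_bij_span[of b "range b"]) (simp_all add: bij_betw_def)
qed

lemma multiple_algebraic_int:
  fixes x :: 'a
  obtains m :: int where "m > 0" "algebraic_int (of_int m * x)"
proof -
  obtain p :: "rat poly" where p: "p \<noteq> 0" "poly (map_poly of_rat p) x = 0"
    using number_field_annihilator[OF K] by blast
  then have "algebraic x"
    unfolding algebraic_altdef by (intro exI[of _ "map_poly of_rat p"]) (auto simp: coeff_map_poly map_poly_eq_0_iff)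
  then obtain q where "q \<noteq> 0" "poly (map_poly of_int q) x = 0" by (rule algebraicE')
  then show ?thesis using algebraic_imp_multiple_algebraic_int that by blast
qed

lemma int_basis_rat_spanning:
  fixes b :: "'a emb \<Rightarrow> 'a"
  assumes "int_basis b" shows "rat_spanning b"
  unfolding rat_spanning_def
proof
  fix x :: 'a
  obtain m where m: "m > 0" "algebraic_int (of_int m * x)" using multiple_algebraic_int by blast
  then obtain c where c: "of_int m * x = (\<Sum>j\<in>UNIV. of_int (c j) * b j)"
    using assms unfolding int_basis_def by blast
  have "x = inverse (of_int m) * (of_int m * x)" using m(1) by simp
  also have "\<dots> = (\<Sum>j\<in>UNIV. of_rat (of_int (c j) / of_int m) * b j)"
    unfolding c sum_distrib_left by (rule sum.cong) (simp_all add: of_rat_divide field_simps)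
  finally show "\<exists>c. x = (\<Sum>j\<in>UNIV. of_rat (c j) * b j)"
    by (intro exI[of _ "\<lambda>j. of_int (c j) / of_int m"])
qed

lemma algebraic_int_rat_spanning_exists:
  obtains b :: "'a emb \<Rightarrow> 'a" where "rat_spanning b" "\<forall>j. algebraic_int (b j)"
proof -
  obtain B :: "'a set" where B: "finite B" "rat_vs.span B = UNIV" "card B = number_field_degree TYPE('a)"
    and "\<not> rat_vs.dependent B"
    by (rule number_field_basis[OF K])
  obtain f where f: "bij_betw f (UNIV :: 'a emb set) B"
    using finite_same_card_bij[of "UNIV :: 'a emb set" B] B card_emb by auto
  have "\<forall>x :: 'a. \<exists>m > 0. algebraic_int (of_int m * x)"
    by (rule allI, rule multiple_algebraic_int) blast
  then obtain m where m: "\<And>x :: 'a. m x > 0" "\<And>x :: 'a. algebraic_int (of_int (m x) * x)"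
    by metis
  define b where "b j = of_int (m (f j)) * f j" for j
  have "rat_spanning b"
    unfolding rat_spanning_def
  proof
    fix x :: 'a
    obtain u where "x = (\<Sum>v\<in>B. of_rat (u v) * v)"
      using rat_vs.span_finite[OF B(1)] B(2) by auto
    also have "\<dots> = (\<Sum>j\<in>UNIV. of_rat (u (f j)) * f j)"
      by (rule sum.reindex_bij_betw[OF f, symmetric])
    also have "\<dots> = (\<Sum>j\<in>UNIV. of_rat (u (f j) / of_int (m (f j))) * b j)"
      using m(1) by (intro sum.cong) (auto simp: b_def of_rat_divide less_le)
    finally show "\<exists>c. x = (\<Sum>j\<in>UNIV. of_rat (c j) * b j)"
      by (intro exI[of _ "\<lambda>j. u (f j) / of_int (m (f j))"])
  qed
  then show ?thesis using that m(2) by (simp add: b_def)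
qed

text \<open>The matrix \<open>emb_matrix b\<close> conjugates the rational matrix of multiplication
  by \<open>x\<close> into the diagonal matrix of the conjugates of \<open>x\<close>, so sum and
  product of the conjugates are its trace and determinant.\<close>

lemma trace_norm_rational:
  fixes x :: 'a
  shows "(\<Sum>\<sigma>\<in>UNIV. Rep_emb (\<sigma> :: 'a emb) x) \<in> \<rat>" and "(\<Prod>\<sigma>\<in>UNIV. Rep_emb (\<sigma> :: 'a emb) x) \<in> \<rat>"
proof -
  obtain b :: "'a emb \<Rightarrow> 'a" where b: "rat_spanning b" and "\<forall>j. algebraic_int (b j)"
    by (rule algebraic_int_rat_spanning_exists)
  let ?S = "emb_matrix b"
  have "\<forall>j. \<exists>c. x * b j = (\<Sum>i\<in>UNIV. of_rat (c i) * b i)" using b by (auto simp: rat_spanning_def)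
  then obtain m where m: "\<And>j. x * b j = (\<Sum>i\<in>UNIV. of_rat (m j i) * b i)" by metis
  define M :: "complex ^ 'a emb ^ 'a emb" where "M = (\<chi> i j. of_rat (m j i))"
  define D :: "complex ^ 'a emb ^ 'a emb" where "D = (\<chi> \<sigma> \<tau>. if \<sigma> = \<tau> then Rep_emb \<sigma> x else 0)"
  obtain S' where S': "?S ** S' = mat 1" "S' ** ?S = mat 1"
    using det_emb_matrix_nonzero[OF b] by (auto simp: invertible_def simp flip: invertible_det_nz)
  have DS: "D ** ?S = ?S ** M"
  proof -
    have "(D ** ?S) $ \<sigma> $ j = (?S ** M) $ \<sigma> $ j" for \<sigma> j
    proof -
      have "(D ** ?S) $ \<sigma> $ j = Rep_emb \<sigma> (x * b j)"
        by (simp add: D_def emb_matrix_def matrix_matrix_mult_def Rep_emb_simps if_distrib[of "\<lambda>x. x * _"] cong: if_cong)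
      also have "\<dots> = (?S ** M) $ \<sigma> $ j"
        unfolding m by (simp add: M_def emb_matrix_def matrix_matrix_mult_def Rep_emb_simps mult.commute)
      finally show ?thesis .
    qed
    then show ?thesis by (simp add: vec_eq_iff)
  qed
  have D: "D = ?S ** (M ** S')"
    by (metis DS S'(1) matrix_mul_assoc matrix_mul_rid)
  have "trace D = trace M"
    by (metis D S'(2) matrix_mul_assoc matrix_mul_rid trace_mul_sym)
  moreover have "trace M \<in> \<rat>" unfolding trace_def M_def by (intro Rats_sum) simp
  ultimately show "(\<Sum>\<sigma>\<in>UNIV. Rep_emb (\<sigma> :: 'a emb) x) \<in> \<rat>" by (simp add: trace_def D_def)
  have "det D = det M"
  proof -
    have "det ?S * det S' = 1" using S'(1) by (metis det_I det_mul)
    then show ?thesis unfolding D det_mul by (simp add: mult.left_commute)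
  qed
  moreover have "det D = (\<Prod>\<sigma>\<in>UNIV. Rep_emb \<sigma> x)"
    by (subst det_diagonal) (auto simp: D_def)
  moreover have "det M \<in> \<rat>" by (rule det_in_Rats) (simp add: M_def)
  ultimately show "(\<Prod>\<sigma>\<in>UNIV. Rep_emb (\<sigma> :: 'a emb) x) \<in> \<rat>" by simp
qed

text \<open>The squared determinant is the determinant of the trace form, whose entries are the
  traces of \<open>b i * b j\<close>: rational and integral, hence integers.\<close>

lemma disc_in_Ints:
  fixes b :: "'a emb \<Rightarrow> 'a"
  assumes "\<And>j. algebraic_int (b j)"
  shows "(det (emb_matrix b))\<^sup>2 \<in> \<int>"
proof -
  have "(det (emb_matrix b))\<^sup>2 = det (transpose (emb_matrix b) ** emb_matrix b)"
    by (simp add: det_mul power2_eq_square)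
  also have "\<dots> \<in> \<int>"
  proof (rule det_in_Ints)
    fix i j
    have eq: "(transpose (emb_matrix b) ** emb_matrix b) $ i $ j = (\<Sum>\<sigma>\<in>UNIV. Rep_emb \<sigma> (b i * b j))"
      by (simp add: transpose_def matrix_matrix_mult_def emb_matrix_def Rep_emb_simps)
    have "algebraic_int (\<Sum>\<sigma>\<in>UNIV. Rep_emb (\<sigma> :: 'a emb) (b i * b j))"
      by (intro algebraic_int_sum field_hom_algebraic_int[OF Rep_emb_hom] algebraic_int_mult assms)
    then show "(transpose (emb_matrix b) ** emb_matrix b) $ i $ j \<in> \<int>"
      unfolding eq by (intro rational_algebraic_int_is_int trace_norm_rational)
  qed
  finally show ?thesis .
qed

text \<open>Among integral families with nonzero determinant take one of least discriminant in
  absolute value, which is a natural number. A fractional coordinate \<open>q k\<close> of an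
  integral \<open>x\<close> would allow \<open>b k\<close> to be exchanged for an integer that
  shrinks the determinant.\<close>

lemma int_basis_exists:
  obtains b :: "'a emb \<Rightarrow> 'a" where "int_basis b"
proof -
  define P where "P b \<longleftrightarrow> (\<forall>j. algebraic_int (b j)) \<and> det (emb_matrix b) \<noteq> 0" for b :: "'a emb \<Rightarrow> 'a"
  define \<mu> where "\<mu> b = nat (floor (cmod ((det (emb_matrix b))\<^sup>2)))" for b :: "'a emb \<Rightarrow> 'a"
  obtain b0 :: "'a emb \<Rightarrow> 'a" where "rat_spanning b0" "\<forall>j. algebraic_int (b0 j)"
    by (rule algebraic_int_rat_spanning_exists)
  then have "P b0" using det_emb_matrix_nonzero by (simp add: P_def)
  then obtain b where b: "P b" and min: "\<And>b'. P b' \<Longrightarrow> \<mu> b \<le> \<mu> b'"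
    using ex_has_least_nat[of P b0 \<mu>] by blast
  have \<mu>: "real (\<mu> b) = (cmod (det (emb_matrix b)))\<^sup>2" if "P b" for b
  proof -
    have "(det (emb_matrix b))\<^sup>2 \<in> \<int>" using that by (intro disc_in_Ints) (simp add: P_def)
    then obtain k where k: "(det (emb_matrix b))\<^sup>2 = of_int k" by (rule Ints_cases)
    have "cmod ((det (emb_matrix b))\<^sup>2) = \<bar>real_of_int k\<bar>" unfolding k by simp
    then have "cmod ((det (emb_matrix b))\<^sup>2) = real_of_int \<bar>k\<bar>" by simp
    then have "real (\<mu> b) = cmod ((det (emb_matrix b))\<^sup>2)" unfolding \<mu>_def by simp
    then show ?thesis by (simp add: norm_power)
  qed
  have "\<exists>c. x = (\<Sum>j\<in>UNIV. of_int (c j) * b j)" if x: "algebraic_int x" for x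
  proof -
    have "rat_spanning b" using b rat_spanning_if_det by (simp add: P_def)
    then obtain q where q: "x = (\<Sum>j\<in>UNIV. of_rat (q j) * b j)" by (auto simp: rat_spanning_def)
    have "q k \<in> \<int>" for k
    proof (rule ccontr)
      assume qk: "q k \<notin> \<int>"
      define y where "y = x - of_int \<lfloor>q k\<rfloor> * b k"
      define b' where "b' = b(k := y)"
      have y: "y = (\<Sum>j\<in>UNIV. of_rat ((q(k := frac (q k))) j) * b j)"
      proof -
        have "(\<Sum>j\<in>UNIV. of_rat (q j) * b j) - (\<Sum>j\<in>UNIV. of_rat ((q(k := frac (q k))) j) * b j)
          = (\<Sum>j\<in>UNIV. if j = k then of_int \<lfloor>q k\<rfloor> * b k else 0)"
          unfolding sum_subtractf[symmetric]
          by (rule sum.cong) (auto simp: frac_def of_rat_diff algebra_simps)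
        then have "x - (\<Sum>j\<in>UNIV. of_rat ((q(k := frac (q k))) j) * b j) = of_int \<lfloor>q k\<rfloor> * b k"
          unfolding q[symmetric] by simp
        then have "y = x - (x - (\<Sum>j\<in>UNIV. of_rat ((q(k := frac (q k))) j) * b j))"
          by (simp only: y_def)
        then show ?thesis by simp
      qed
      \<comment> \<open>By Cramer's rule, replacing column \<open>k\<close> by the conjugates of
        \<open>y\<close> multiplies the determinant by the \<open>k\<close>-th coordinate of
        \<open>y\<close>, which is the fractional part of \<open>q k\<close>.\<close>
      have "det (emb_matrix b') = det (\<chi> i j. if j = k then (emb_matrix b *v (\<chi> j. of_rat ((q(k := frac (q k))) j))) $ i else emb_matrix b $ i $ j)"
        unfolding emb_matrix_mult_coeffs[OF y]
        by (rule arg_cong[where f = det]) (auto simp: vec_eq_iff emb_matrix_def b'_def)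
      also have "\<dots> = of_rat (frac (q k)) * det (emb_matrix b)"
        unfolding cramer_lemma by simp
      finally have det': "det (emb_matrix b') = of_rat (frac (q k)) * det (emb_matrix b)" .
      have fr: "0 < frac (q k)" "frac (q k) < 1" using qk by (auto simp: frac_gt_0_iff frac_lt_1)
      have "algebraic_int y"
        unfolding y_def using x b by (intro algebraic_int_diff algebraic_int_mult algebraic_int_of_int) (auto simp: P_def)
      then have P': "P b'" using b fr det' by (auto simp: P_def b'_def)
      have "real (\<mu> b') = (real_of_rat (frac (q k)))\<^sup>2 * real (\<mu> b)"
        unfolding \<mu>[OF P'] \<mu>[OF b] det'
        by (simp add: norm_mult power_mult_distrib cmod_of_rat)
      moreover have "real (\<mu> b) > 0" unfolding \<mu>[OF b] using b by (simp add: P_def)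
      moreover have "(real_of_rat (frac (q k)))\<^sup>2 < 1"
        using fr by (simp add: abs_square_less_1)
      ultimately have "real (\<mu> b') < real (\<mu> b)" by simp
      then show False using min[OF P'] by simp
    qed
    then have "\<forall>k. \<exists>m. q k = of_int m" by (auto elim: Ints_cases)
    then obtain c where "\<And>k. q k = of_int (c k)" by metis
    then show ?thesis using q by (intro exI[of _ c]) simp
  qed
  then show ?thesis using that b by (auto simp: int_basis_def P_def)
qed

lemma int_basis_disc_divides:
  fixes b b' :: "'a emb \<Rightarrow> 'a"
  assumes "int_basis b" "int_basis b'"
  obtains k :: int where "det (emb_matrix b') = det (emb_matrix b) * of_int k"
proof -
  have "\<forall>j. \<exists>c. b' j = (\<Sum>i\<in>UNIV. of_int (c i) * b i)"
    using assms by (auto simp: int_basis_def)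
  then obtain u where u: "\<And>j. b' j = (\<Sum>i\<in>UNIV. of_int (u j i) * b i)" by metis
  define U :: "complex ^ 'a emb ^ 'a emb" where "U = (\<chi> i j. of_int (u j i))"
  have "emb_matrix b' = emb_matrix b ** U"
    by (simp add: vec_eq_iff U_def emb_matrix_def matrix_matrix_mult_def u Rep_emb_simps mult.commute)
  moreover have "det U \<in> \<int>" by (rule det_in_Ints) (simp add: U_def)
  ultimately show ?thesis using that by (auto simp: det_mul elim: Ints_cases)
qed

text \<open>Both transition matrices are integral and their determinants are inverse to each other,
  so they are 1 or -1 and disappear on squaring.\<close>

lemma int_basis_disc_unique:
  fixes b b' :: "'a emb \<Rightarrow> 'a"
  assumes "int_basis b" "int_basis b'"
  shows "(det (emb_matrix b'))\<^sup>2 = (det (emb_matrix b))\<^sup>2"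
proof -
  obtain k where k: "det (emb_matrix b') = det (emb_matrix b) * of_int k"
    using int_basis_disc_divides[OF assms] .
  obtain l where l: "det (emb_matrix b) = det (emb_matrix b') * of_int l"
    using int_basis_disc_divides[OF assms(2,1)] .
  have nz: "det (emb_matrix b) \<noteq> 0" using assms int_basis_rat_spanning det_emb_matrix_nonzero by blast
  have "det (emb_matrix b) = det (emb_matrix b) * of_int (k * l)" by (metis k l mult.assoc of_int_mult)
  then have "of_int (k * l) = (1::complex)" using nz by simp
  then have "k * l = 1" by (metis of_int_eq_1_iff)
  then have "k\<^sup>2 = 1" by (auto simp: zmult_eq_1_iff)
  then show ?thesis using k by (simp add: power_mult_distrib flip: of_int_power)
qed

end

section \<open>Agreement with the discriminant defined by lists\<close>

lemma common_denominator:
  fixes u :: "'b \<Rightarrow> rat"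
  assumes "finite A"
  obtains N :: int and k where "N > 0" "\<And>v. v \<in> A \<Longrightarrow> of_int N * u v = of_int (k v)"
proof -
  have "\<exists>N::int. N > 0 \<and> (\<forall>v\<in>A. of_int N * u v \<in> \<int>)"
    using assms
  proof (induction A rule: finite_induct)
    case empty show ?case by (intro exI[of _ 1]) simp
  next
    case (insert a A)
    then obtain N :: int where N: "N > 0" "\<forall>v\<in>A. of_int N * u v \<in> \<int>" by blast
    obtain p q where pq: "q > 0" "u a = of_int p / of_int q"
      by (metis quotient_of_div quotient_of_denom_pos surj_pair)
    have "of_int (N * q) * u v \<in> \<int>" if v: "v \<in> insert a A" for v
    proof (cases "v = a")
      case True
      then have "of_int (N * q) * u v = of_int (N * p)" using pq by simp
      then show ?thesis by (metis Ints_of_int)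
    next
      case False
      then have "of_int (N * q) * u v = of_int q * (of_int N * u v)" by simp
      then show ?thesis using N v False by (metis Ints_mult Ints_of_int insertE)
    qed
    then show ?case using N pq by (intro exI[of _ "N * q"]) auto
  qed
  then obtain N :: int where N: "N > 0" "\<forall>v\<in>A. of_int N * u v \<in> \<int>" by blast
  then have "\<forall>v\<in>A. \<exists>m. of_int N * u v = of_int m" by (metis Ints_cases)
  then obtain k where "\<forall>v\<in>A. of_int N * u v = of_int (k v)" by metis
  then show ?thesis using that N by blast
qed

context
  assumes K: "number_field TYPE('a::field_char_0)"
begin

text \<open>Clearing denominators turns a rational relation into an integral one and moves any field
  element into the ring of integers, so an integral basis is also a basis of K over the
  rationals.\<close>

lemma length_integral_basis:
  fixes bs :: "'a list"
  assumes "integral_basis bs"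
  shows "length bs = number_field_degree TYPE('a)"
proof -
  have dist: "distinct bs" and ind: "\<not> int_mod.dependent (set bs)"
    and sp: "int_mod.span (set bs) = {x. algebraic_int x}"
    using assms by (auto simp: integral_basis_def ring_of_integers_def)
  have "\<not> rat_vs.dependent (set bs)"
  proof
    assume "rat_vs.dependent (set bs)"
    then obtain u v where u: "v \<in> set bs" "u v \<noteq> 0" "(\<Sum>v\<in>set bs. of_rat (u v) * v) = 0"
      using rat_vs.dependent_finite[of "set bs"] by auto
    obtain N k where N: "N > 0" "\<And>v. v \<in> set bs \<Longrightarrow> of_int N * u v = of_int (k v)"
      using common_denominator[of "set bs" u] by auto
    have "(\<Sum>v\<in>set bs. of_int (k v) * v) = (\<Sum>v\<in>set bs. of_rat (of_int N * u v) * v)"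
      using N(2) by (intro sum.cong) auto
    also have "\<dots> = of_int N * (\<Sum>v\<in>set bs. of_rat (u v) * v)"
      by (simp add: of_rat_mult sum_distrib_left mult.assoc)
    finally have "(\<Sum>v\<in>set bs. of_int (k v) * v) = 0" using u(3) by simp
    moreover have "k v \<noteq> 0" using N(1) N(2)[OF u(1)] u(2) by auto
    ultimately show False using ind int_mod.dependent_finite[of "set bs"] u(1) by auto
  qed
  moreover have "UNIV \<subseteq> rat_vs.span (set bs)"
  proof
    fix x :: 'a
    obtain m where m: "m > 0" "algebraic_int (of_int m * x)" by (rule multiple_algebraic_int[OF K])
    then obtain c where c: "of_int m * x = (\<Sum>v\<in>set bs. of_int (c v) * v)"
      using sp int_mod.span_finite[of "set bs"] by auto
    have "x = (\<Sum>v\<in>set bs. of_rat (of_int (c v) / of_int m) * v)"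
    proof -
      have "x = inverse (of_int m) * (of_int m * x)" using m(1) by simp
      also have "\<dots> = (\<Sum>v\<in>set bs. of_rat (of_int (c v) / of_int m) * v)"
        unfolding c sum_distrib_left by (rule sum.cong) (simp_all add: of_rat_divide field_simps)
      finally show ?thesis .
    qed
    also have "\<dots> \<in> rat_vs.span (set bs)"
      by (intro rat_vs.span_sum rat_vs.span_scale rat_vs.span_base) auto
    finally show "x \<in> rat_vs.span (set bs)" .
  qed
  ultimately have "card (set bs) = rat_vs.dim (UNIV :: 'a set)"
    by (intro rat_vs.basis_card_eq_dim) auto
  then show ?thesis using dist by (simp add: distinct_card number_field_degree_def)
qed

lemma emb_enumeration:
  assumes "distinct \<sigma>s" "set \<sigma>s = (embeddings :: ('a \<Rightarrow> complex) set)"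
  obtains h :: "'a emb \<Rightarrow> nat" where "bij_betw h UNIV {0..<length \<sigma>s}" "\<And>e. \<sigma>s ! h e = Rep_emb e"
proof -
  have b1: "bij_betw ((!) \<sigma>s) {0..<length \<sigma>s} embeddings"
    using assms by (metis atLeast0LessThan bij_betw_nth)
  have b2: "bij_betw (Rep_emb :: 'a emb \<Rightarrow> _) UNIV embeddings"
    using inj_Rep_emb[OF K] range_Rep_emb[OF K] by (simp add: bij_betw_def)
  have "bij_betw (inv_into {0..<length \<sigma>s} ((!) \<sigma>s) \<circ> Rep_emb) (UNIV :: 'a emb set) {0..<length \<sigma>s}"
    by (rule bij_betw_trans[OF b2 bij_betw_inv_into[OF b1]])
  moreover have "\<sigma>s ! (inv_into {0..<length \<sigma>s} ((!) \<sigma>s) \<circ> Rep_emb) e = Rep_emb e" for e :: "'a emb"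
    using b1 Rep_emb_embeddings[OF K, of e] by (simp add: bij_betw_inv_into_right)
  ultimately show ?thesis using that by blast
qed

text \<open>Rows and columns are renumbered by the same bijection \<open>h\<close>, so the two
  determinants agree including the sign.\<close>

lemma integral_basis_imp_int_basis:
  fixes bs :: "'a list"
  assumes bs: "integral_basis bs" and \<sigma>s: "distinct \<sigma>s" "set \<sigma>s = (embeddings :: ('a \<Rightarrow> complex) set)"
  obtains b :: "'a emb \<Rightarrow> 'a" where "int_basis b"
    "Determinant.det (Matrix.mat (length \<sigma>s) (length bs) (\<lambda>(i, j). (\<sigma>s ! i) (bs ! j))) = det (emb_matrix b)"
proof -
  obtain h :: "'a emb \<Rightarrow> nat" where h: "bij_betw h UNIV {0..<length \<sigma>s}" "\<And>e. \<sigma>s ! h e = Rep_emb e"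
    using emb_enumeration[OF \<sigma>s] by blast
  have len: "length bs = length \<sigma>s"
    using length_integral_basis[OF bs] embeddings_finite_card(2)[OF K] \<sigma>s by (metis distinct_card)
  define b where "b e = bs ! h e" for e
  have dist: "distinct bs" and sp: "int_mod.span (set bs) = {x. algebraic_int x}"
    using bs by (auto simp: integral_basis_def ring_of_integers_def)
  have bij: "bij_betw b UNIV (set bs)"
  proof -
    have "bij_betw ((!) bs) {0..<length \<sigma>s} (set bs)"
      using dist len by (metis atLeast0LessThan bij_betw_nth)
    from bij_betw_trans[OF h(1) this] show ?thesis by (simp add: b_def[abs_def] comp_def)
  qed
  have "int_basis b"
    unfolding int_basis_def
  proof (intro conjI allI impI)
    fix j
    have "b j \<in> set bs" using bij by (auto simp: bij_betw_def)
    then have "b j \<in> int_mod.span (set bs)" by (rule int_mod.span_base)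
    then show "algebraic_int (b j)" by (simp add: sp)
  next
    fix x :: 'a assume "algebraic_int x"
    then obtain u where "x = (\<Sum>v\<in>set bs. of_int (u v) * v)"
      using sp int_mod.span_finite[of "set bs"] by auto
    also have "\<dots> = (\<Sum>j\<in>UNIV. of_int (u (b j)) * b j)"
      by (rule sum.reindex_bij_betw[OF bij, symmetric])
    finally show "\<exists>c. x = (\<Sum>j\<in>UNIV. of_int (c j) * b j)" by (intro exI[of _ "\<lambda>j. u (b j)"])
  qed
  moreover have "Determinant.det (Matrix.mat (length \<sigma>s) (length bs) (\<lambda>(i, j). (\<sigma>s ! i) (bs ! j))) = det (emb_matrix b)"
    unfolding len det_jnf_eq_det[OF h(1), of "\<lambda>i j. (\<sigma>s ! i) (bs ! j)"]
    by (simp add: emb_matrix_def b_def h(2))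
  ultimately show ?thesis using that by blast
qed

lemma integral_basis_list_exists:
  obtains bs :: "'a list" where "integral_basis bs"
proof -
  obtain b :: "'a emb \<Rightarrow> 'a" where b: "int_basis b" by (rule int_basis_exists[OF K])
  have det: "det (emb_matrix b) \<noteq> 0"
    using det_emb_matrix_nonzero[OF K] int_basis_rat_spanning[OF K] b by blast
  obtain bs where bs: "set bs = range b" "distinct bs" using finite_distinct_list[of "range b"] by auto
  have inj: "inj b" by (rule inj_if_det[OF K det])
  have "\<not> int_mod.dependent (set bs)"
  proof
    assume "int_mod.dependent (set bs)"
    then obtain u i where u: "(\<Sum>v\<in>range b. of_int (u v) * v) = 0" "u (b i) \<noteq> 0"
      using int_mod.dependent_finite[of "range b"] bs by auto
    have "(\<Sum>j\<in>UNIV. of_rat (of_int (u (b j))) * b j) = (\<Sum>j\<in>UNIV. of_rat 0 * b j)"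
      using u(1) by (simp add: sum.reindex[OF inj])
    from rat_coeffs_unique[OF K det this, of i] u(2) show False by simp
  qed
  moreover have "int_mod.span (set bs) = {x. algebraic_int x}"
  proof (intro equalityI subsetI)
    fix x :: 'a assume "x \<in> int_mod.span (set bs)"
    then obtain u where "x = (\<Sum>v\<in>range b. of_int (u v) * v)"
      using int_mod.span_finite[of "range b"] bs by auto
    moreover have "algebraic_int (\<Sum>v\<in>range b. of_int (u v) * v)"
      using b by (intro algebraic_int_sum algebraic_int_mult[OF algebraic_int_of_int]) (auto simp: int_basis_def)
    ultimately show "x \<in> {x. algebraic_int x}" by simp
  next
    fix x :: 'a assume "x \<in> {x. algebraic_int x}"
    then obtain c where c: "x = (\<Sum>j\<in>UNIV. of_int (c j) * b j)"
      using b unfolding int_basis_def by blast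
    show "x \<in> int_mod.span (set bs)"
      unfolding c bs by (intro int_mod.span_sum int_mod.span_scale int_mod.span_base) auto
  qed
  ultimately have "integral_basis bs" using bs by (simp add: integral_basis_def ring_of_integers_def)
  then show ?thesis using that by blast
qed

text \<open>All admissible lists give the same squared determinant and at least one such list
  exists; these two facts justify the description operator in \<open>discriminant\<close>.\<close>

lemma discriminant_eq_det:
  fixes b :: "'a emb \<Rightarrow> 'a"
  assumes b: "int_basis b"
  shows "of_int (discriminant TYPE('a)) = (det (emb_matrix b))\<^sup>2"
proof -
  have "(det (emb_matrix b))\<^sup>2 \<in> \<int>" using b by (intro disc_in_Ints[OF K]) (auto simp: int_basis_def)
  then obtain D where D: "(det (emb_matrix b))\<^sup>2 = of_int D" by (rule Ints_cases)
  obtain bs :: "'a list" where bs: "integral_basis bs" by (rule integral_basis_list_exists)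
  obtain \<sigma>s where \<sigma>s: "set \<sigma>s = (embeddings :: ('a \<Rightarrow> complex) set)" "distinct \<sigma>s"
    using finite_distinct_list[OF embeddings_finite_card(1)[OF K]] by blast
  have eq: "(Determinant.det (Matrix.mat (length \<sigma>s) (length bs) (\<lambda>(i, j). (\<sigma>s ! i) (bs ! j))))\<^sup>2 = of_int D"
    if h: "integral_basis bs" "distinct \<sigma>s" "set \<sigma>s = embeddings" for bs :: "'a list" and \<sigma>s
  proof -
    obtain b' :: "'a emb \<Rightarrow> 'a" where b': "int_basis b'"
      "Determinant.det (Matrix.mat (length \<sigma>s) (length bs) (\<lambda>(i, j). (\<sigma>s ! i) (bs ! j))) = det (emb_matrix b')"
      using integral_basis_imp_int_basis[OF h] by blast
    then show ?thesis using int_basis_disc_unique[OF K b b'(1)] D by simp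
  qed
  have "discriminant TYPE('a) = D"
    unfolding discriminant_def
  proof (rule the_equality)
    show "\<exists>(bs :: 'a list) \<sigma>s. integral_basis bs \<and> distinct \<sigma>s \<and> set \<sigma>s = embeddings \<and>
      complex_of_int D = (Determinant.det (Matrix.mat (length \<sigma>s) (length bs) (\<lambda>(i, j). (\<sigma>s ! i) (bs ! j))))\<^sup>2"
      using bs \<sigma>s eq[OF bs \<sigma>s(2,1)] by (intro exI[of _ bs] exI[of _ \<sigma>s]) simp
  next
    fix D' assume "\<exists>(bs :: 'a list) \<sigma>s. integral_basis bs \<and> distinct \<sigma>s \<and> set \<sigma>s = embeddings \<and>
      complex_of_int D' = (Determinant.det (Matrix.mat (length \<sigma>s) (length bs) (\<lambda>(i, j). (\<sigma>s ! i) (bs ! j))))\<^sup>2"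
    then obtain bs :: "'a list" and \<sigma>s where *: "integral_basis bs" "distinct \<sigma>s" "set \<sigma>s = embeddings"
      "complex_of_int D' = (Determinant.det (Matrix.mat (length \<sigma>s) (length bs) (\<lambda>(i, j). (\<sigma>s ! i) (bs ! j))))\<^sup>2"
      by blast
    then have "complex_of_int D' = of_int D" using eq[OF *(1-3)] by simp
    then show "D' = D" by simp
  qed
  then show ?thesis using D by simp
qed

end

section \<open>Short algebraic integers\<close>

lemma finite_vec_components:
  assumes "finite A" shows "finite {v :: 'b ^ 'n::finite. \<forall>i. v $ i \<in> A}"
proof -
  have "{v :: 'b ^ 'n. \<forall>i. v $ i \<in> A} \<subseteq> vec_lambda ` (PiE UNIV (\<lambda>_. A))"
  proof
    fix v :: "'b ^ 'n" assume "v \<in> {v. \<forall>i. v $ i \<in> A}"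
    then have "v = vec_lambda (\<lambda>i. v $ i)" "(\<lambda>i. v $ i) \<in> PiE UNIV (\<lambda>_. A)" by auto
    then show "v \<in> vec_lambda ` (PiE UNIV (\<lambda>_. A))" by blast
  qed
  moreover have "finite (vec_lambda ` (PiE UNIV (\<lambda>_. A)) :: ('b ^ 'n) set)"
    using assms by (intro finite_imageI finite_PiE) auto
  ultimately show ?thesis by (rule finite_subset)
qed

text \<open>Cut \<open>S\<close> along the integer unit cubes and translate all pieces into one
  cube. If no two points of \<open>S\<close> differed by an integer vector, the translates would
  stay disjoint and \<open>S\<close> would have volume at most 1.\<close>

lemma blichfeldt:
  fixes S :: "(real ^ 'n) set"
  assumes S: "S \<in> lmeasurable" "bounded S" "measure lebesgue S > 1"
  obtains x y where "x \<in> S" "y \<in> S" "x \<noteq> y" "\<And>i. x $ i - y $ i \<in> \<int>"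
proof (rule ccontr)
  assume no: "\<not> thesis"
  note obt = that
  have inj: "x = y" if "x \<in> S" "y \<in> S" "\<And>i. x $ i - y $ i \<in> \<int>" for x y
    using obt[OF that(1,2) _ that(3)] no by blast
  define fl :: "real ^ 'n \<Rightarrow> real ^ 'n" where "fl x = (\<chi> i. of_int \<lfloor>x $ i\<rfloor>)" for x
  define F where "F = fl ` S"
  define C :: "real ^ 'n \<Rightarrow> (real ^ 'n) set" where "C k = {x. \<forall>i. k $ i \<le> x $ i \<and> x $ i < k $ i + 1}" for k
  define P where "P k = S \<inter> C k" for k
  define T where "T k = (\<lambda>x. x - k) ` P k" for k
  obtain r where r: "\<And>x. x \<in> S \<Longrightarrow> norm x \<le> r" using S(2) bounded_iff by blast
  have "F \<subseteq> {v. \<forall>i. v $ i \<in> of_int ` {- \<lceil>r\<rceil> - 1..\<lceil>r\<rceil>}}"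
  proof
    fix v assume "v \<in> F"
    then obtain x where x: "x \<in> S" "v = fl x" by (auto simp: F_def)
    have "\<lfloor>x $ i\<rfloor> \<in> {- \<lceil>r\<rceil> - 1..\<lceil>r\<rceil>}" for i
    proof -
      have "\<bar>x $ i\<bar> \<le> r" using r[OF x(1)] component_le_norm_cart[of x i] by linarith
      then have "- of_int \<lceil>r\<rceil> - 1 \<le> x $ i" "x $ i < of_int \<lceil>r\<rceil> + 1"
        using le_of_int_ceiling[of r] by linarith+
      then show ?thesis by (simp add: le_floor_iff floor_le_iff)
    qed
    then show "v \<in> {v. \<forall>i. v $ i \<in> of_int ` {- \<lceil>r\<rceil> - 1..\<lceil>r\<rceil>}}" by (auto simp: x fl_def)
  qed
  then have fF: "finite F" by (rule finite_subset) (simp add: finite_vec_components)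
  have Fint: "k $ i \<in> \<int>" if "k \<in> F" for k i using that by (auto simp: F_def fl_def)
  have Cfl: "x \<in> C (fl x)" for x by (simp add: C_def fl_def)
  have Cuniq: "k = fl x" if xk: "x \<in> C k" "k \<in> F" for x k
  proof -
    have "k $ i = of_int \<lfloor>x $ i\<rfloor>" for i
    proof -
      obtain m where m: "k $ i = of_int m" using Fint[OF xk(2)] Ints_cases by blast
      have "\<lfloor>x $ i\<rfloor> = m" using xk(1) by (simp add: C_def floor_eq_iff flip: m)
      then show ?thesis using m by simp
    qed
    then show ?thesis by (simp add: vec_eq_iff fl_def)
  qed
  have Cb: "C k \<in> sets borel" for k
  proof -
    have "C k = (\<Inter>i\<in>UNIV. {x. k $ i \<le> x $ i} \<inter> {x. x $ i < k $ i + 1})" by (auto simp: C_def)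
    moreover have "{x :: real ^ 'n. k $ i \<le> x $ i} \<in> sets borel" for i
      by (intro borel_closed closed_Collect_le continuous_intros)
    moreover have "{x :: real ^ 'n. x $ i < k $ i + 1} \<in> sets borel" for i
      by (intro borel_open open_Collect_less continuous_intros)
    ultimately show ?thesis by (auto intro!: sets.finite_INT)
  qed
  have P: "P k \<in> lmeasurable" for k
    unfolding P_def using S(1) Cb[of k] by (intro fmeasurable_Int_fmeasurable) auto
  have T: "T k \<in> lmeasurable" for k unfolding T_def by (intro measurable_translation_subtract P)
  have Seq: "S = (\<Union>k\<in>F. P k)" using Cfl by (auto simp: P_def F_def)
  have "measure lebesgue S = (\<Sum>k\<in>F. measure lebesgue (P k))"
    unfolding Seq
  proof (rule measure_negligible_finite_Union_image[OF fF P])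
    show "pairwise (\<lambda>k l. negligible (P k \<inter> P l)) F"
    proof (rule pairwiseI)
      fix k l assume "k \<in> F" "l \<in> F" "k \<noteq> l"
      then have "P k \<inter> P l = {}" using Cuniq by (auto simp: P_def)
      then show "negligible (P k \<inter> P l)" by simp
    qed
  qed
  also have "\<dots> = (\<Sum>k\<in>F. measure lebesgue (T k))" by (simp add: T_def measure_translation_subtract)
  also have "\<dots> = measure lebesgue (\<Union>k\<in>F. T k)"
  proof (rule measure_negligible_finite_Union_image[OF fF T, symmetric])
    show "pairwise (\<lambda>k l. negligible (T k \<inter> T l)) F"
    proof (rule pairwiseI)
      fix k l assume kl: "k \<in> F" "l \<in> F" "k \<noteq> l"
      have "T k \<inter> T l = {}"
      proof (rule ccontr)
        assume "T k \<inter> T l \<noteq> {}"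
        then obtain x y where xy: "x \<in> P k" "y \<in> P l" "x - k = y - l" by (auto simp: T_def)
        have "x $ i - y $ i \<in> \<int>" for i
        proof -
          have "x $ i - y $ i = k $ i - l $ i" using arg_cong[OF xy(3), of "\<lambda>v. v $ i"] by simp
          then show ?thesis using Fint kl by simp
        qed
        then have "x = y" using xy inj by (auto simp: P_def)
        then show False using xy kl by simp
      qed
      then show "negligible (T k \<inter> T l)" by simp
    qed
  qed
  also have "\<dots> \<le> measure lebesgue (cbox 0 (\<chi> i. 1) :: (real ^ 'n) set)"
  proof (rule measure_mono_fmeasurable)
    show "(\<Union>k\<in>F. T k) \<subseteq> cbox 0 (\<chi> i. 1)"
      by (auto simp: T_def P_def C_def mem_box_cart algebra_simps) (meson less_imp_le)
    show "(\<Union>k\<in>F. T k) \<in> sets lebesgue" using fF T by (intro sets.finite_UN) auto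
  qed auto
  also have "\<dots> = 1" by (simp add: content_cbox_if_cart interval_ne_empty_cart)
  finally show False using S(3) by simp
qed

text \<open>Blichfeldt's theorem is applied to the preimage under \<open>A\<close> of a box with
  sides \<open>h i\<close>; its volume is the product of the sides divided by |det A|, hence above
  1.\<close>

lemma minkowski_linear_forms:
  fixes A :: "real ^ 'n::{finite,wellorder} ^ 'n::{finite,wellorder}"
  assumes "det A \<noteq> 0" "\<And>i. h i > 0" "\<bar>det A\<bar> < (\<Prod>i\<in>UNIV. h i)"
  obtains k where "k \<noteq> 0" "\<And>i. k $ i \<in> \<int>" "\<And>i. \<bar>(A *v k) $ i\<bar> \<le> h i"
proof -
  obtain A' where A': "A ** A' = mat 1" "A' ** A = mat 1"
    using assms(1) by (auto simp: invertible_def simp flip: invertible_det_nz)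
  \<comment> \<open>The box is one-sided: differences of its points already fill the symmetric box
    of half-sides \<open>h i\<close>, so no factor 2 per dimension is lost.\<close>
  let ?B = "cbox 0 (\<chi> i. h i) :: ((real, 'n) vec) set"
  define S where "S = (\<lambda>y. A' *v y) ` ?B"
  have lin: "linear (\<lambda>y. A' *v y)" by (rule matrix_vector_mul_linear)
  have "det A * det A' = 1" using A'(1) by (metis det_I det_mul)
  then have dA': "\<bar>det A'\<bar> = 1 / \<bar>det A\<bar>" using assms(1) by (simp add: field_simps flip: abs_mult)
  have "measure lebesgue ?B = (\<Prod>i\<in>UNIV. h i)"
  proof -
    have "?B \<noteq> {}" using assms(2) by (auto simp: interval_ne_empty_cart intro: less_imp_le)
    then show ?thesis by (simp add: content_cbox_cart)
  qed
  then have "measure lebesgue S = (\<Prod>i\<in>UNIV. h i) / \<bar>det A\<bar>"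
    unfolding S_def using measure_linear_image[OF lin, of ?B] dA' by simp
  then have "measure lebesgue S > 1" using assms(1,3) by (simp add: less_divide_eq)
  moreover have "S \<in> lmeasurable" unfolding S_def by (rule measurable_linear_image[OF lin]) simp
  moreover have "bounded S" unfolding S_def using lin
    by (intro bounded_linear_image bounded_cbox) (simp add: linear_linear)
  ultimately obtain x y where xy: "x \<in> S" "y \<in> S" "x \<noteq> y" "\<And>i. x $ i - y $ i \<in> \<int>"
    using blichfeldt by metis
  obtain u v where uv: "u \<in> ?B" "v \<in> ?B" "x = A' *v u" "y = A' *v v" using xy by (auto simp: S_def)
  have "A *v (x - y) = u - v"
    unfolding uv using A'(1) by (simp add: matrix_vector_mult_diff_distrib matrix_vector_mul_assoc)
  moreover have "\<bar>(u - v) $ i\<bar> \<le> h i" for i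
    using uv(1,2) by (simp add: mem_box_cart) (smt (verit))
  ultimately show ?thesis using that[of "x - y"] xy by simp
qed

text \<open>The box is long along \<open>w\<close> only, so that a lattice point in it that is orthogonal to \<open>w\<close> would be
  shorter than any nonzero lattice point can be.\<close>

lemma lattice_vector_off_hyperplane:
  fixes A :: "real ^ 'n::{finite,wellorder} ^ 'n::{finite,wellorder}" and w :: "real ^ 'n::{finite,wellorder}"
  assumes det: "det A \<noteq> 0" and w: "w \<noteq> 0" and n: "CARD('n::{finite,wellorder}) \<ge> 2"
    and short: "\<And>k. k \<noteq> 0 \<Longrightarrow> (\<And>i. k $ i \<in> \<int>) \<Longrightarrow> (norm (A *v k))\<^sup>2 \<ge> real CARD('n)"
  obtains k where "\<And>i. k $ i \<in> \<int>" "w \<bullet> (A *v k) \<noteq> 0" "(norm (A *v k))\<^sup>2 \<le> (det A)\<^sup>2 + real CARD('n)"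
proof -
  define n where "n = real CARD('n)"
  have n2: "n \<ge> 2" using n by (simp add: n_def)
  \<comment> \<open>This \<open>s\<close> exceeds 1, giving the box strictly enough volume, while
    \<open>(n - 1) * s\<^sup>2 = n - 1/2\<close> stays below the least possible squared length
    n.\<close>
  define s where "s = sqrt ((n - 1/2) / (n - 1))"
  have s2: "s\<^sup>2 = (n - 1/2) / (n - 1)" using n2 by (simp add: s_def)
  have ns: "(n - 1) * s\<^sup>2 = n - 1/2" using n2 by (simp add: s2)
  have s1: "s > 1" using n2 by (simp add: s_def field_simps)
  define w' where "w' = w /\<^sub>R norm w"
  have w'1: "norm w' = 1" using w by (simp add: w'_def)
  obtain j :: 'n where True by blast
  \<comment> \<open>A rotation carries the unit normal to a coordinate axis; afterwards the
    \<open>j\<close>-th coordinate of \<open>B *v k\<close> measures the distance of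
    \<open>A *v k\<close> from the hyperplane.\<close>
  obtain f :: "(real, 'n) vec \<Rightarrow> (real, 'n) vec" where f: "orthogonal_transformation f" "f w' = axis j 1"
    using orthogonal_transformation_exists_1[OF w'1, of "axis j 1"] by (auto simp: norm_axis_1)
  have lin: "linear f" using f(1) by (simp add: orthogonal_transformation_def)
  define B where "B = matrix f ** A"
  have Bk: "B *v k = f (A *v k)" for k
    using lin by (simp add: B_def matrix_vector_mul_assoc[symmetric] matrix_works linear_matrix_vector_mul_eq)
  have normB: "norm (B *v k) = norm (A *v k)" for k
    unfolding Bk using f(1) by (simp add: orthogonal_transformation_norm)
  have Bj: "(B *v k) $ j = w' \<bullet> (A *v k)" for k
  proof -
    have "w' \<bullet> (A *v k) = f w' \<bullet> f (A *v k)" using f(1) by (simp add: orthogonal_transformation_def)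
    then show ?thesis unfolding Bk f(2) by (simp add: inner_axis')
  qed
  have detB: "\<bar>det B\<bar> = \<bar>det A\<bar>" using f(1) by (simp add: B_def det_mul abs_mult)
  define h where "h i = (if i = j then \<bar>det A\<bar> else s)" for i
  have "(\<Prod>i\<in>UNIV. h i) = \<bar>det A\<bar> * s ^ (CARD('n) - 1)"
  proof -
    have "(\<Prod>i\<in>UNIV. h i) = h j * (\<Prod>i\<in>UNIV - {j}. h i)" by (rule prod.remove) auto
    also have "(\<Prod>i\<in>UNIV - {j}. h i) = (\<Prod>i\<in>UNIV - {j}. s)" by (rule prod.cong) (auto simp: h_def)
    finally show ?thesis by (simp add: h_def)
  qed
  moreover have "s ^ (CARD('n) - 1) > 1" using s1 n by (intro one_less_power) auto
  ultimately have "\<bar>det B\<bar> < (\<Prod>i\<in>UNIV. h i)" using det detB by simp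
  moreover have "det B \<noteq> 0" using det detB by auto
  moreover have "h i > 0" for i using det s1 by (simp add: h_def)
  ultimately obtain k where k: "k \<noteq> 0" "\<And>i. k $ i \<in> \<int>" "\<And>i. \<bar>(B *v k) $ i\<bar> \<le> h i"
    using minkowski_linear_forms[of B h] by metis
  have nsq: "(norm (A *v k))\<^sup>2 = ((B *v k) $ j)\<^sup>2 + (\<Sum>i\<in>UNIV - {j}. ((B *v k) $ i)\<^sup>2)"
  proof -
    have "(norm (A *v k))\<^sup>2 = (\<Sum>i\<in>UNIV. ((B *v k) $ i)\<^sup>2)"
      unfolding normB[symmetric] by (simp add: norm_vec_def L2_set_def sum_nonneg)
    also have "\<dots> = ((B *v k) $ j)\<^sup>2 + (\<Sum>i\<in>UNIV - {j}. ((B *v k) $ i)\<^sup>2)"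
      by (rule sum.remove) auto
    finally show ?thesis .
  qed
  have "(\<Sum>i\<in>UNIV - {j}. ((B *v k) $ i)\<^sup>2) \<le> (\<Sum>i\<in>UNIV - {j}. s\<^sup>2)"
  proof (rule sum_mono)
    fix i assume "i \<in> UNIV - {j}"
    then have "\<bar>(B *v k) $ i\<bar> \<le> s" using k(3)[of i] by (simp add: h_def)
    then show "((B *v k) $ i)\<^sup>2 \<le> s\<^sup>2" using abs_le_square_iff[of "(B *v k) $ i" s] s1 by simp
  qed
  also have "\<dots> = n - 1/2" using ns n by (simp add: n_def of_nat_diff)
  finally have rest: "(\<Sum>i\<in>UNIV - {j}. ((B *v k) $ i)\<^sup>2) \<le> n - 1/2" .
  have "(B *v k) $ j \<noteq> 0"
  proof
    assume "(B *v k) $ j = 0"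
    then have "(norm (A *v k))\<^sup>2 \<le> n - 1/2" using nsq rest by simp
    then show False using short[OF k(1,2)] by (simp add: n_def)
  qed
  then have "w \<bullet> (A *v k) \<noteq> 0" by (auto simp: Bj w'_def)
  moreover have "((B *v k) $ j)\<^sup>2 \<le> (det A)\<^sup>2"
    using k(3)[of j] abs_le_square_iff[of "(B *v k) $ j" "det A"] by (simp add: h_def)
  then have "(norm (A *v k))\<^sup>2 \<le> (det A)\<^sup>2 + real CARD('n)"
    unfolding nsq using rest by (simp add: n_def)
  ultimately show ?thesis using that k(2) by blast
qed

text \<open>Taking \<open>Re + Im\<close> of every embedding, rather than \<open>\<surd>2 Re\<close> and \<open>\<surd>2 Im\<close> of one embedding from each
  complex pair, gives the Minkowski embedding up to an isometry without any choices.\<close>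

definition hartley :: "'a::field_char_0 \<Rightarrow> real ^ 'a emb" where
  "hartley x = (\<chi> \<sigma>. Re (Rep_emb \<sigma> x) + Im (Rep_emb \<sigma> x))"

lemma of_real_det: "complex_of_real (det A) = det (\<chi> i j. of_real (A $ i $ j))"
  for A :: "real ^ 'n::finite ^ 'n"
  by (simp add: det_def)

lemma cnj_det: "cnj (det A) = det (\<chi> i j. cnj (A $ i $ j))"
  for A :: "complex ^ 'n::finite ^ 'n"
  by (simp add: det_def)

context
  assumes K: "number_field TYPE('a::field_char_0)"
begin

lemma hartley_add: "hartley (x + y :: 'a) = hartley x + hartley y"
  by (simp add: hartley_def vec_eq_iff Rep_emb_simps[OF K])

lemma hartley_sum: "hartley (sum f A :: 'a) = (\<Sum>i\<in>A. hartley (f i))"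
  by (simp add: hartley_def vec_eq_iff Rep_emb_simps[OF K] sum.distrib)

lemma hartley_of_rat: "hartley (of_rat q * x :: 'a) = of_rat q *\<^sub>R hartley x"
proof -
  have "complex_of_rat q = of_real (of_rat q)" by (cases q) (simp add: of_rat_rat)
  then show ?thesis by (simp add: hartley_def vec_eq_iff Rep_emb_simps[OF K] algebra_simps)
qed

text \<open>For complex z and w, (Re z + Im z)(Re w + Im w) = Re(cnj z * w) + Im(z * w). The last
  term changes sign under conjugating the embedding and cancels in the sum; so does the imaginary
  part of the Hermitian sum.\<close>

lemma hartley_inner:
  "complex_of_real (hartley (x::'a) \<bullet> hartley y) = (\<Sum>\<sigma>\<in>UNIV. cnj (Rep_emb (\<sigma> :: 'a emb) x) * Rep_emb \<sigma> y)"
proof -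
  have odd: "(\<Sum>\<sigma>\<in>UNIV. f (\<sigma> :: 'a emb)) = 0" if "\<And>\<sigma>. f (emb_cnj \<sigma>) = - f \<sigma>" for f :: "'a emb \<Rightarrow> real"
  proof -
    have "(\<Sum>\<sigma>\<in>UNIV. f \<sigma>) = (\<Sum>\<sigma>\<in>UNIV. f (emb_cnj \<sigma>))" by (rule sum_emb_cnj[OF K, symmetric])
    also have "\<dots> = - (\<Sum>\<sigma>\<in>UNIV. f \<sigma>)" by (simp add: that sum_negf)
    finally show ?thesis by simp
  qed
  let ?z = "\<lambda>\<sigma> :: 'a emb. Rep_emb \<sigma> x" and ?w = "\<lambda>\<sigma> :: 'a emb. Rep_emb \<sigma> y"
  have "hartley x \<bullet> hartley y = (\<Sum>\<sigma>\<in>UNIV. Re (cnj (?z \<sigma>) * ?w \<sigma>) + Im (?z \<sigma> * ?w \<sigma>))"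
    by (simp add: hartley_def inner_vec_def algebra_simps)
  also have "\<dots> = (\<Sum>\<sigma>\<in>UNIV. Re (cnj (?z \<sigma>) * ?w \<sigma>))"
    unfolding sum.distrib by (subst odd[of "\<lambda>\<sigma>. Im (?z \<sigma> * ?w \<sigma>)"]) (simp_all add: Rep_emb_cnj[OF K])
  finally have "hartley x \<bullet> hartley y = Re (\<Sum>\<sigma>\<in>UNIV. cnj (?z \<sigma>) * ?w \<sigma>)" by (simp only: Re_sum)
  moreover have "Im (\<Sum>\<sigma>\<in>UNIV. cnj (?z \<sigma>) * ?w \<sigma>) = 0"
    unfolding Im_sum by (rule odd) (simp add: Rep_emb_cnj[OF K])
  ultimately show ?thesis by (simp add: complex_eq_iff)
qed

lemma hartley_norm: "(norm (hartley (x::'a)))\<^sup>2 = (\<Sum>\<sigma>\<in>UNIV. (cmod (Rep_emb (\<sigma> :: 'a emb) x))\<^sup>2)"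
proof -
  have "complex_of_real ((norm (hartley x))\<^sup>2) = (\<Sum>\<sigma>\<in>UNIV. cnj (Rep_emb (\<sigma> :: 'a emb) x) * Rep_emb \<sigma> x)"
    unfolding power2_norm_eq_inner by (rule hartley_inner)
  also have "\<dots> = complex_of_real (\<Sum>\<sigma>\<in>UNIV. (cmod (Rep_emb (\<sigma> :: 'a emb) x))\<^sup>2)"
    unfolding of_real_sum complex_norm_square by (simp add: mult.commute)
  finally show ?thesis by (simp only: of_real_eq_iff)
qed

text \<open>The real and the complex matrix have the same Gram matrix, so their determinants have
  equal absolute value.\<close>

lemma hartley_det:
  fixes b :: "'a emb \<Rightarrow> 'a"
  shows "(det (\<chi> \<sigma> j. hartley (b j) $ \<sigma>))\<^sup>2 = (cmod (det (emb_matrix b)))\<^sup>2"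
proof -
  define H where "H = (\<chi> \<sigma> j. hartley (b j) $ \<sigma>)"
  define G :: "complex ^ 'a emb ^ 'a emb" where "G = (\<chi> i j. cnj (emb_matrix b $ i $ j))"
  have "complex_of_real ((det H)\<^sup>2) = complex_of_real (det (transpose H ** H))"
    by (simp add: det_mul power2_eq_square)
  also have "\<dots> = det (\<chi> i j. complex_of_real ((transpose H ** H) $ i $ j))" by (rule of_real_det)
  also have "(\<chi> i j. complex_of_real ((transpose H ** H) $ i $ j)) = transpose G ** emb_matrix b"
  proof -
    have "(transpose H ** H) $ i $ j = hartley (b i) \<bullet> hartley (b j)" for i j
      by (simp add: H_def transpose_def matrix_matrix_mult_def inner_vec_def)
    moreover have "(transpose G ** emb_matrix b) $ i $ j = complex_of_real (hartley (b i) \<bullet> hartley (b j))" for i j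
      unfolding hartley_inner by (simp add: G_def emb_matrix_def transpose_def matrix_matrix_mult_def)
    ultimately show ?thesis by (simp add: vec_eq_iff)
  qed
  also have "det (transpose G ** emb_matrix b) = cnj (det (emb_matrix b)) * det (emb_matrix b)"
    unfolding det_mul det_transpose G_def cnj_det ..
  also have "\<dots> = complex_of_real ((cmod (det (emb_matrix b)))\<^sup>2)"
    unfolding complex_norm_square by (rule mult.commute)
  finally show ?thesis unfolding H_def by (simp only: of_real_eq_iff)
qed

lemma norm_nonzero_algebraic_int_ge:
  fixes x :: 'a
  assumes x: "algebraic_int x" "x \<noteq> 0"
  shows "(\<Sum>\<sigma>\<in>UNIV. (cmod (Rep_emb (\<sigma> :: 'a emb) x))\<^sup>2) \<ge> real (number_field_degree TYPE('a))"
proof -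
  have "algebraic_int (\<Prod>\<sigma>\<in>UNIV. Rep_emb (\<sigma> :: 'a emb) x)"
    by (intro algebraic_int_prod field_hom_algebraic_int[OF Rep_emb_hom[OF K]] x)
  then have "(\<Prod>\<sigma>\<in>UNIV. Rep_emb (\<sigma> :: 'a emb) x) \<in> \<int>"
    by (intro rational_algebraic_int_is_int trace_norm_rational[OF K])
  then obtain k where k: "(\<Prod>\<sigma>\<in>UNIV. Rep_emb (\<sigma> :: 'a emb) x) = of_int k" by (rule Ints_cases)
  have "(\<Prod>\<sigma>\<in>UNIV. Rep_emb (\<sigma> :: 'a emb) x) \<noteq> 0" using x Rep_emb_eq_0_iff[OF K] by simp
  then have "k \<noteq> 0" using k by auto
  then have "\<bar>real_of_int k\<bar> \<ge> 1" by linarith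
  then have "1 \<le> (cmod (\<Prod>\<sigma>\<in>UNIV. Rep_emb (\<sigma> :: 'a emb) x))\<^sup>2"
    unfolding k using abs_le_square_iff[of 1 "real_of_int k"] by simp
  also have "\<dots> = (\<Prod>\<sigma>\<in>UNIV. (cmod (Rep_emb (\<sigma> :: 'a emb) x))\<^sup>2)"
    by (simp add: prod_norm[symmetric] prod_power_distrib)
  finally have "1 \<le> (\<Prod>\<sigma>\<in>UNIV. (cmod (Rep_emb (\<sigma> :: 'a emb) x))\<^sup>2) powr (1 / real CARD('a emb))"
    by (simp add: ge_one_powr_ge_zero)
  also have "\<dots> \<le> (\<Sum>\<sigma>\<in>UNIV. (cmod (Rep_emb (\<sigma> :: 'a emb) x))\<^sup>2 / real CARD('a emb))"
    by (rule arith_geom_mean) auto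
  also have "\<dots> = (\<Sum>\<sigma>\<in>UNIV. (cmod (Rep_emb (\<sigma> :: 'a emb) x))\<^sup>2) / real CARD('a emb)"
    by (simp add: sum_divide_distrib)
  finally show ?thesis using number_field_degree_pos[OF K] by (simp add: card_emb[OF K] le_divide_eq)
qed

lemma short_rat_basis:
  assumes d: "number_field_degree TYPE('a) \<ge> 2"
  obtains \<omega> :: "'a emb \<Rightarrow> 'a" where "rat_spanning \<omega>" "\<forall>j. algebraic_int (\<omega> j)"
    "\<forall>j \<sigma>. (cmod (Rep_emb \<sigma> (\<omega> j)))\<^sup>2 \<le> \<bar>real_of_int (discriminant TYPE('a))\<bar> + real (number_field_degree TYPE('a))"
proof -
  obtain b :: "'a emb \<Rightarrow> 'a" where b: "int_basis b" by (rule int_basis_exists[OF K])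
  define H where "H = (\<chi> \<sigma> j. hartley (b j) $ \<sigma>)"
  have det2: "(det H)\<^sup>2 = \<bar>real_of_int (discriminant TYPE('a))\<bar>"
  proof -
    have "cmod (of_int (discriminant TYPE('a))) = cmod ((det (emb_matrix b))\<^sup>2)"
      by (simp only: discriminant_eq_det[OF K b])
    then show ?thesis unfolding H_def hartley_det by (simp add: norm_power)
  qed
  have detH: "det H \<noteq> 0"
    using hartley_det[of b] det_emb_matrix_nonzero[OF K int_basis_rat_spanning[OF K b]] by (auto simp: H_def)
  have Hk: "H *v k = hartley (\<Sum>j\<in>UNIV. of_int (c j) * b j)" if "\<And>j. k $ j = of_int (c j)" for k c
  proof -
    have "hartley (\<Sum>j\<in>UNIV. of_int (c j) * b j) = (\<Sum>j\<in>UNIV. real_of_int (c j) *\<^sub>R hartley (b j))"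
      unfolding hartley_sum using hartley_of_rat[of "of_int _"] by simp
    then show ?thesis by (simp add: H_def vec_eq_iff matrix_vector_mult_def that mult.commute)
  qed
  have alg: "algebraic_int (\<Sum>j\<in>UNIV. of_int (c j) * b j)" for c
    using b by (intro algebraic_int_sum algebraic_int_mult[OF algebraic_int_of_int]) (auto simp: int_basis_def)
  let ?d = "real (number_field_degree TYPE('a))"
  have short: "(norm (H *v k))\<^sup>2 \<ge> real CARD('a emb)" if k: "k \<noteq> 0" "\<And>i. k $ i \<in> \<int>" for k
  proof -
    have "\<forall>i. \<exists>c. k $ i = of_int c" using k(2) by (auto elim: Ints_cases)
    then obtain c where c: "\<And>i. k $ i = of_int (c i)" by metis
    let ?x = "\<Sum>j\<in>UNIV. of_int (c j) * b j"
    have "H *v k \<noteq> 0" using detH k(1)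
      by (metis invertible_det_nz invertible_left_inverse matrix_left_invertible_ker)
    then have "?x \<noteq> 0" unfolding Hk[OF c] using hartley_of_rat[of 0 0] by auto
    then show ?thesis unfolding Hk[OF c] hartley_norm card_emb[OF K]
      by (rule norm_nonzero_algebraic_int_ge[OF alg])
  qed
  define T where "T = {x :: 'a. algebraic_int x \<and> (norm (hartley x))\<^sup>2 \<le> (det H)\<^sup>2 + ?d}"
  obtain B where B: "B \<subseteq> T" "\<not> rat_vs.dependent B" "T \<subseteq> rat_vs.span B"
    by (rule rat_vs.maximal_independent_subset)
  obtain E :: "'a set" where E: "finite E" "rat_vs.span E = UNIV" "card E = number_field_degree TYPE('a)"
    and "\<not> rat_vs.dependent E"
    by (rule number_field_basis[OF K])
  have fB: "finite B" "card B \<le> card E" using rat_vs.independent_span_bound[OF E(1) B(2)] E(2) by auto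
  have cB: "card B = card E"
  proof (rule ccontr)
    assume "card B \<noteq> card E"
    then have "card (hartley ` B) < CARD('a emb)"
      using fB E(3) card_image_le[OF fB(1), of hartley] card_emb[OF K] by simp
    then have "dim (hartley ` B) < DIM(real ^ 'a emb)"
      using dim_le_card[of "hartley ` B" "hartley ` B"] fB(1) by (simp add: span_superset)
    then obtain w where w: "w \<noteq> 0" "span (hartley ` B) \<subseteq> {x. w \<bullet> x = 0}"
      using lowdim_subset_hyperplane by blast
    obtain k where k: "\<And>i. k $ i \<in> \<int>" "w \<bullet> (H *v k) \<noteq> 0" "(norm (H *v k))\<^sup>2 \<le> (det H)\<^sup>2 + real CARD('a emb)"
      using lattice_vector_off_hyperplane[OF detH w(1) _ short] d card_emb[OF K] by metis
    have "\<forall>i. \<exists>c. k $ i = of_int c" using k(1) by (auto elim: Ints_cases)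
    then obtain c where c: "\<And>i. k $ i = of_int (c i)" by metis
    let ?x = "\<Sum>j\<in>UNIV. of_int (c j) * b j"
    have "?x \<in> T" using alg k(3) by (simp add: T_def Hk[OF c] card_emb[OF K])
    then have "?x \<in> rat_vs.span B" using B(3) by blast
    \<comment> \<open>\<open>hartley\<close> is rational linear, so the rational span of
      \<open>B\<close> stays in the real hyperplane that contains the images of
      \<open>B\<close>.\<close>
    then have "w \<bullet> hartley ?x = 0"
    proof (induction rule: rat_vs.span_induct_alt)
      case base
      then show ?case using hartley_of_rat[of 0 0] by simp
    next
      case (step q x y)
      then have "w \<bullet> hartley x = 0" using w(2) span_base[of "hartley x" "hartley ` B"] by blast
      then show ?case using step by (simp add: hartley_add hartley_of_rat inner_add_right)
    qed
    then show False using k(2) Hk[OF c] by simp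
  qed
  obtain f where f: "bij_betw f (UNIV :: 'a emb set) B"
    using finite_same_card_bij[of "UNIV :: 'a emb set" B] fB cB E(3) card_emb[OF K] by auto
  have "rat_vs.span B = UNIV" using B(2) fB(1) cB E(3) by (intro rat_span_UNIV_if_card[OF K]) simp_all
  then have "rat_spanning f" by (rule rat_spanning_if_bij_span[OF K f])
  moreover have fT: "f j \<in> T" for j using f B(1) by (auto simp: bij_betw_def)
  moreover have "(cmod (Rep_emb \<sigma> (f j)))\<^sup>2 \<le> \<bar>real_of_int (discriminant TYPE('a))\<bar> + ?d" for \<sigma> j
  proof -
    have "(cmod (Rep_emb \<sigma> (f j)))\<^sup>2 \<le> (\<Sum>\<sigma>\<in>UNIV. (cmod (Rep_emb (\<sigma> :: 'a emb) (f j)))\<^sup>2)"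
      by (rule member_le_sum) auto
    then show ?thesis using fT[of j] by (simp add: T_def hartley_norm det2)
  qed
  ultimately show ?thesis using that[of f] by (auto simp: T_def)
qed

lemma discriminant_nonzero: "discriminant TYPE('a) \<noteq> 0"
proof -
  obtain b :: "'a emb \<Rightarrow> 'a" where b: "int_basis b" by (rule int_basis_exists[OF K])
  then show ?thesis
    using discriminant_eq_det[OF K b] det_emb_matrix_nonzero[OF K int_basis_rat_spanning[OF K b]] by auto
qed

end

section \<open>Ideals of the ring of integers\<close>

text \<open>Ideals as plain subsets of the field: they are combined below with elements of K that
  are not integral.\<close>

definition int_ideal :: "'a::field_char_0 set \<Rightarrow> bool" where
  "int_ideal I \<longleftrightarrow> I \<subseteq> {x. algebraic_int x} \<and> 0 \<in> I \<and> (\<forall>x\<in>I. \<forall>y\<in>I. x + y \<in> I) \<and>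
     (\<forall>a. \<forall>x\<in>I. algebraic_int a \<longrightarrow> a * x \<in> I)"

lemma int_idealD:
  assumes "int_ideal I"
  shows "x \<in> I \<Longrightarrow> algebraic_int x" "0 \<in> I" "x \<in> I \<Longrightarrow> y \<in> I \<Longrightarrow> x + y \<in> I"
    "algebraic_int a \<Longrightarrow> x \<in> I \<Longrightarrow> a * x \<in> I" "algebraic_int a \<Longrightarrow> x \<in> I \<Longrightarrow> x * a \<in> I"
    "x \<in> I \<Longrightarrow> y \<in> I \<Longrightarrow> x - y \<in> I"
proof -
  show "x \<in> I \<Longrightarrow> algebraic_int x" "0 \<in> I" and add: "x \<in> I \<Longrightarrow> y \<in> I \<Longrightarrow> x + y \<in> I" for x y
    using assms by (auto simp: int_ideal_def)
  show m: "algebraic_int a \<Longrightarrow> x \<in> I \<Longrightarrow> a * x \<in> I" for a x using assms by (auto simp: int_ideal_def)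
  then show "algebraic_int a \<Longrightarrow> x \<in> I \<Longrightarrow> x * a \<in> I" by (simp add: mult.commute)
  assume "x \<in> I" "y \<in> I"
  then show "x - y \<in> I" using add[OF _ m[of "- 1" y], of x] by (simp add: algebraic_int_one)
qed

lemma int_ideal_sum:
  assumes "int_ideal I" "\<And>i. i \<in> A \<Longrightarrow> f i \<in> I" shows "sum f A \<in> I"
  using assms(2) by (induction A rule: infinite_finite_induct) (auto intro: int_idealD[OF assms(1)])

lemma int_ideal_span:
  fixes S :: "'a::field_char_0 set"
  assumes S: "S \<subseteq> {x. algebraic_int x}" and mult: "\<And>a x. algebraic_int a \<Longrightarrow> x \<in> S \<Longrightarrow> a * x \<in> S"
  shows "int_ideal (int_mod.span S)"
  unfolding int_ideal_def
proof (intro conjI ballI allI impI subsetI CollectI)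
  fix x assume "x \<in> int_mod.span S"
  then show "algebraic_int x"
  proof (induction rule: int_mod.span_induct_alt)
    case (step c x y)
    then show ?case using S by (intro algebraic_int_add algebraic_int_mult[OF algebraic_int_of_int]) auto
  qed simp
next
  fix a x :: 'a assume "x \<in> int_mod.span S" "algebraic_int a"
  then show "a * x \<in> int_mod.span S"
    using int_span_closed_under_mult[of x S a] int_mod.span_base[OF mult] by blast
qed (auto intro: int_mod.span_zero int_mod.span_add)

text \<open>The fractional ideal (O : I), which is the inverse of \<open>I\<close> once
  invertibility is known.\<close>

definition inverse_ideal :: "'a::field_char_0 set \<Rightarrow> 'a set" where
  "inverse_ideal I = {y. \<forall>x\<in>I. algebraic_int (x * y)}"

context
  assumes K: "number_field TYPE('a::field_char_0)"
begin

text \<open>For a nonzero \<open>x\<close> in \<open>I\<close>, some positive multiple m / x of its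
  inverse is integral, and multiplying it by \<open>x\<close> gives m.\<close>

lemma int_ideal_contains_integer:
  fixes I :: "'a set"
  assumes I: "int_ideal I" "I \<noteq> {0}"
  obtains m :: int where "m > 0" "of_int m \<in> I"
proof -
  obtain x where x: "x \<in> I" "x \<noteq> 0" using int_idealD(2)[OF I(1)] I(2) by blast
  obtain m where m: "m > 0" "algebraic_int (of_int m * inverse x)" by (rule multiple_algebraic_int[OF K])
  have "of_int m * inverse x * x \<in> I" using int_idealD(4)[OF I(1) m(2) x(1)] .
  moreover have "of_int m * inverse x * x = of_int m" using x(2) by simp
  ultimately have "of_int m \<in> I" by metis
  then show ?thesis by (rule that[OF m(1)])
qed

text \<open>Coordinates in an integral basis are reduced modulo \<open>m\<close>. Finiteness of O /
  m O is the substitute below for Noetherian arguments.\<close>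

lemma finite_residues:
  assumes "(m::int) > 0"
  obtains F :: "'a set" where "finite F"
    "\<forall>x. algebraic_int x \<longrightarrow> (\<exists>r\<in>F. \<exists>y. algebraic_int y \<and> x = r + of_int m * y)"
proof -
  obtain b :: "'a emb \<Rightarrow> 'a" where b: "int_basis b" by (rule int_basis_exists[OF K])
  define g where "g c = (\<Sum>j\<in>UNIV. of_int (c j) * b j)" for c
  define F where "F = g ` (PiE UNIV (\<lambda>_. {0..<m}))"
  have g: "algebraic_int (g c)" for c unfolding g_def
    using b by (intro algebraic_int_sum algebraic_int_mult[OF algebraic_int_of_int]) (auto simp: int_basis_def)
  have "finite F" unfolding F_def by (intro finite_imageI finite_PiE) auto
  moreover have "\<exists>r\<in>F. \<exists>y. algebraic_int y \<and> x = r + of_int m * y" if "algebraic_int x" for x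
  proof -
    have "\<exists>c. x = g c" using b that unfolding int_basis_def g_def by (elim conjE allE[of _ x]) blast
    then obtain c where c: "x = g c" by blast
    have "x = g (\<lambda>j. c j mod m) + of_int m * g (\<lambda>j. c j div m)"
    proof -
      have "g (\<lambda>j. c j mod m) + of_int m * g (\<lambda>j. c j div m) = (\<Sum>j\<in>UNIV. of_int (c j mod m + m * (c j div m)) * b j)"
        unfolding g_def sum_distrib_left sum.distrib[symmetric]
        by (simp only: of_int_add of_int_mult distrib_right mult.assoc)
      then show ?thesis unfolding mod_mult_div_eq by (simp only: c g_def)
    qed
    moreover have "g (\<lambda>j. c j mod m) \<in> F" unfolding F_def using assms by (intro imageI) auto
    ultimately show ?thesis using g by blast
  qed
  ultimately show ?thesis using that by blast
qed

text \<open>In the finite ring \<open>O / m O\<close> every \<open>r \<in> C\<close> satisfies \<open>r ^ i = r ^ j\<close> for some \<open>i < j\<close>. The product \<open>z\<close>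
  of the elements \<open>1 - r ^ (j - i)\<close> is \<open>1\<close> modulo \<open>C\<close>, hence nonzero, and is killed by a power of every
  \<open>r \<in> C\<close>; multiplying it by suitable powers gives a nonzero element annihilated by \<open>C\<close>.\<close>

lemma proper_ideal_multiplier:
  fixes C :: "'a set"
  assumes C: "int_ideal C" and one: "1 \<notin> C" and m: "(m::int) > 0" "of_int m \<in> C"
  obtains y where "\<not> algebraic_int y" "\<And>c. c \<in> C \<Longrightarrow> algebraic_int (y * c)"
proof -
  define M where "M = {of_int m * z | z :: 'a. algebraic_int z}"
  have MC: "M \<subseteq> C" using int_idealD(5)[OF C _ m(2)] by (auto simp: M_def)
  have M: "int_ideal M"
    unfolding int_ideal_def
  proof (intro conjI ballI allI impI)
    show "M \<subseteq> {x. algebraic_int x}" using MC int_idealD(1)[OF C] by blast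
    show "0 \<in> M" unfolding M_def by (intro CollectI exI[of _ 0]) simp
  next
    fix x y assume "x \<in> M" "y \<in> M"
    then obtain u v where "algebraic_int u" "x = of_int m * u" "algebraic_int v" "y = of_int m * v"
      by (auto simp: M_def)
    then show "x + y \<in> M" unfolding M_def
      by (intro CollectI exI[of _ "u + v"]) (simp add: algebraic_int_add distrib_left)
  next
    fix a x :: 'a assume "x \<in> M" "algebraic_int a"
    then obtain u where "algebraic_int u" "x = of_int m * u" by (auto simp: M_def)
    then show "a * x \<in> M" unfolding M_def using \<open>algebraic_int a\<close>
      by (intro CollectI exI[of _ "a * u"]) (simp add: algebraic_int_mult)
  qed
  obtain F :: "'a set" where F0: "finite F"
    "\<forall>x. algebraic_int x \<longrightarrow> (\<exists>r\<in>F. \<exists>y. algebraic_int y \<and> x = r + of_int m * y)"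
    by (rule finite_residues[OF m(1)])
  note F = F0(1) F0(2)[rule_format]
  have res: "\<exists>r\<in>F. x - r \<in> M" if "algebraic_int x" for x
    using F(2)[OF that] by (force simp: M_def)
  define R where "R = F \<inter> C"
  have fR: "finite R" using F by (simp add: R_def)
  have alg: "algebraic_int r" if "r \<in> C" for r using int_idealD(1)[OF C] that .
  have "\<exists>i k. k > 0 \<and> r ^ i * (1 - r ^ k) \<in> M" if r: "r \<in> C" for r
  proof -
    have "\<forall>n. \<exists>f. f \<in> F \<and> r ^ n - f \<in> M" using res algebraic_int_power[OF alg[OF r]] by blast
    then obtain f where f: "\<And>n. f n \<in> F" "\<And>n. r ^ n - f n \<in> M" by metis
    have "\<not> inj (f :: nat \<Rightarrow> 'a)"
    proof
      assume "inj f"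
      moreover have "finite (range f)" using f(1) by (intro finite_subset[OF _ F(1)]) auto
      ultimately show False using finite_imageD infinite_UNIV_nat by blast
    qed
    then obtain i j where ij: "i < j" "f i = f j" unfolding inj_def by (metis linorder_neqE_nat)
    have "(r ^ i - f i) - (r ^ j - f j) \<in> M" using int_idealD(6)[OF M f(2) f(2)] .
    moreover have "(r ^ i - f i) - (r ^ j - f j) = r ^ i * (1 - r ^ (j - i))"
      using ij by (simp add: right_diff_distrib flip: power_add)
    ultimately show ?thesis using ij by (intro exI[of _ i] exI[of _ "j - i"]) auto
  qed
  then have "\<forall>r. \<exists>i k. r \<in> C \<longrightarrow> k > 0 \<and> r ^ i * (1 - r ^ k) \<in> M" by blast
  then obtain i k where ik: "\<And>r. r \<in> C \<Longrightarrow> k r > 0" "\<And>r. r \<in> C \<Longrightarrow> r ^ i r * (1 - r ^ k r) \<in> M"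
    by metis
  define u where "u r = 1 - r ^ k r" for r
  have u: "algebraic_int (u r)" "1 - u r \<in> C" if "r \<in> C" for r
  proof -
    show "algebraic_int (u r)" unfolding u_def
      by (intro algebraic_int_diff algebraic_int_one algebraic_int_power alg that)
    have "r ^ k r = r ^ (k r - 1) * r" using ik(1)[OF that] by (simp flip: power_Suc2)
    then have "r ^ k r \<in> C"
      using int_idealD(4)[OF C algebraic_int_power[OF alg[OF that]] that, of "k r - 1"] by simp
    then show "1 - u r \<in> C" by (simp add: u_def)
  qed
  define z where "z = prod u R"
  have zA: "algebraic_int (prod u A) \<and> 1 - prod u A \<in> C" if "finite A" "A \<subseteq> C" for A
    using that
  proof (induction A rule: finite_induct)
    case empty then show ?case using int_idealD(2)[OF C] by (simp add: algebraic_int_one)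
  next
    case (insert r A)
    have "1 - u r * prod u A = (1 - u r) + u r * (1 - prod u A)" by (simp add: algebra_simps)
    also have "\<dots> \<in> C" using insert u by (intro int_idealD(3,4)[OF C]) auto
    finally show ?case using insert u by (auto intro: algebraic_int_mult)
  qed
  have RC: "R \<subseteq> C" by (auto simp: R_def)
  have z: "algebraic_int z" "1 - z \<in> C" using zA[OF fR RC] by (auto simp: z_def)
  have zM: "z \<notin> M"
  proof
    assume "z \<in> M"
    then have "z + (1 - z) \<in> C" using MC z(2) int_idealD(3)[OF C] by blast
    then show False using one by simp
  qed
  have zr: "z * r ^ i r \<in> M" if r: "r \<in> R" for r
  proof -
    have "z * r ^ i r = prod u (R - {r}) * (r ^ i r * u r)"
      unfolding z_def using prod.remove[OF fR r, of u] by (simp add: mult_ac)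
    also have "\<dots> \<in> M"
    proof (rule int_idealD(4)[OF M])
      show "algebraic_int (prod u (R - {r}))" using zA[of "R - {r}"] fR RC by blast
      show "r ^ i r * u r \<in> M" using ik(2) RC r by (auto simp: u_def)
    qed
    finally show ?thesis .
  qed
  have "\<exists>a. algebraic_int a \<and> z * a \<notin> M \<and> (\<forall>r\<in>A. z * a * r \<in> M)" if "finite A" "A \<subseteq> R" for A
    using that
  proof (induction A rule: finite_induct)
    case empty then show ?case using zM by (intro exI[of _ 1]) (simp add: algebraic_int_one)
  next
    case (insert r A)
    then obtain a where a: "algebraic_int a" "z * a \<notin> M" "\<And>r. r \<in> A \<Longrightarrow> z * a * r \<in> M" by blast
    have r: "r \<in> R" "algebraic_int r" using insert.prems alg RC by auto
    have ex: "z * a * r ^ i r \<in> M"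
      using int_idealD(4)[OF M a(1) zr[OF r(1)]] by (simp add: mult_ac)
    \<comment> \<open>The least power is positive since \<open>z * a\<close> is outside
      \<open>M\<close>. One power less stays outside \<open>M\<close> but is sent into
      \<open>M\<close> by \<open>r\<close>; the elements treated before keep their property because
      \<open>M\<close> is an ideal.\<close>
    define n where "n = (LEAST n. z * a * r ^ n \<in> M)"
    have n: "z * a * r ^ n \<in> M" unfolding n_def by (rule LeastI) (rule ex)
    have "n \<noteq> 0" using n a(2) by (intro notI) simp
    then have n1: "z * a * r ^ (n - 1) \<notin> M" using not_less_Least[of "n - 1" "\<lambda>n. z * a * r ^ n \<in> M"]
      by (simp add: n_def)
    show ?case
    proof (intro exI[of _ "a * r ^ (n - 1)"] conjI ballI)
      show "algebraic_int (a * r ^ (n - 1))" by (intro algebraic_int_mult a algebraic_int_power r)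
      show "z * (a * r ^ (n - 1)) \<notin> M" using n1 by (simp add: mult.assoc)
      fix t assume t: "t \<in> insert r A"
      show "z * (a * r ^ (n - 1)) * t \<in> M"
      proof (cases "t = r")
        case True
        have "r ^ n = r ^ (n - 1) * r" using \<open>n \<noteq> 0\<close> by (simp flip: power_Suc2)
        then show ?thesis using n True by (simp add: mult.assoc)
      next
        case False
        then have "z * a * t \<in> M" using t a(3) by blast
        from int_idealD(5)[OF M algebraic_int_power[OF r(2)] this, of "n - 1"] show ?thesis
          by (simp add: mult_ac)
      qed
    qed
  qed
  from this[OF fR order_refl] obtain a where a: "algebraic_int a" "z * a \<notin> M" "\<And>r. r \<in> R \<Longrightarrow> z * a * r \<in> M"
    by blast
  define w where "w = z * a"
  have wa: "algebraic_int w" unfolding w_def by (intro algebraic_int_mult z a)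
  have wc: "w * c \<in> M" if c: "c \<in> C" for c
  proof -
    obtain r where r: "r \<in> F" "c - r \<in> M" using res[OF alg[OF c]] by blast
    have "c - (c - r) \<in> C" using int_idealD(6)[OF C c] MC r(2) by blast
    then have "r \<in> R" using r by (simp add: R_def)
    then have "w * r + w * (c - r) \<in> M"
      using a(3) int_idealD(4)[OF M wa r(2)] int_idealD(3)[OF M] by (simp add: w_def)
    then show ?thesis by (simp add: algebra_simps)
  qed
  \<comment> \<open>\<open>w\<close> multiplies \<open>C\<close> into m O without lying in m O
    itself, so its quotient by m is the required multiplier.\<close>
  define y where "y = w / of_int m"
  have m0: "(of_int m :: 'a) \<noteq> 0" using m(1) by simp
  have "\<not> algebraic_int y"
  proof
    assume "algebraic_int y"
    moreover have "w = of_int m * y" using m0 by (simp add: y_def)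
    ultimately have "w \<in> M" unfolding M_def by blast
    then show False using a(2) by (simp add: w_def)
  qed
  moreover have "algebraic_int (y * c)" if c: "c \<in> C" for c
  proof -
    obtain t where t: "algebraic_int t" "w * c = of_int m * t" using wc[OF c] by (auto simp: M_def)
    have "y * c = t" using t(2) m0 by (simp add: y_def field_simps)
    then show ?thesis using t(1) by simp
  qed
  ultimately show ?thesis using that by blast
qed

text \<open>\<open>D\<close> is finitely generated over the integers: it contains some m > 0, so m
  times an integral basis together with the residues modulo m that lie in \<open>D\<close> generate
  it. The determinant trick then applies to \<open>y\<close>.\<close>

lemma algebraic_int_if_stabilizes:
  fixes D :: "'a set"
  assumes D: "int_ideal D" "D \<noteq> {0}" and y: "\<And>x. x \<in> D \<Longrightarrow> y * x \<in> D"
  shows "algebraic_int y"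
proof -
  obtain m :: int where m: "m > 0" "of_int m \<in> D" by (rule int_ideal_contains_integer[OF D])
  obtain b :: "'a emb \<Rightarrow> 'a" where b: "int_basis b" by (rule int_basis_exists[OF K])
  obtain F :: "'a set" where F0: "finite F"
    "\<forall>x. algebraic_int x \<longrightarrow> (\<exists>r\<in>F. \<exists>y. algebraic_int y \<and> x = r + of_int m * y)"
    by (rule finite_residues[OF m(1)])
  note F = F0(1) F0(2)[rule_format]
  define B where "B = insert (of_int m) (range (\<lambda>j. of_int m * b j) \<union> (F \<inter> D))"
  have BD: "B \<subseteq> D" using m(2) b int_idealD(5)[OF D(1) _ m(2)] by (auto simp: B_def int_basis_def)
  have DB: "x \<in> int_mod.span B" if x: "x \<in> D" for x
  proof -
    obtain r t where rt: "r \<in> F" "algebraic_int t" "x = r + of_int m * t"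
      using F(2)[OF int_idealD(1)[OF D(1) x]] by blast
    have "x - of_int m * t \<in> D" using int_idealD(6)[OF D(1) x] int_idealD(5)[OF D(1) rt(2) m(2)] by blast
    then have "r \<in> B" using rt by (simp add: B_def)
    moreover obtain c where c: "t = (\<Sum>j\<in>UNIV. of_int (c j) * b j)"
      using b rt(2) unfolding int_basis_def by blast
    have "of_int m * t = (\<Sum>j\<in>UNIV. of_int (c j) * (of_int m * b j))"
      unfolding c by (simp add: sum_distrib_left mult_ac)
    moreover have "(\<Sum>j\<in>UNIV. of_int (c j) * (of_int m * b j)) \<in> int_mod.span B"
      by (intro int_mod.span_sum int_mod.span_scale int_mod.span_base) (auto simp: B_def)
    ultimately show ?thesis unfolding rt(3) by (intro int_mod.span_add) (auto intro: int_mod.span_base)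
  qed
  show ?thesis
  proof (rule algebraic_int_if_span_stable)
    show "finite B" using F by (simp add: B_def)
    show "of_int m \<in> B" "of_int m \<noteq> (0::'a)" using m by (auto simp: B_def)
    show "y * b \<in> int_mod.span B" if "b \<in> B" for b using DB[OF y] BD that by blast
  qed
qed

text \<open>This is the product of \<open>J\<close> with the inverse of \<open>I\<close>. It is
  integral because \<open>J\<close> lies in \<open>I\<close>, and it contains \<open>J\<close>
  because 1 lies in the inverse of \<open>I\<close>.\<close>

lemma product_ideal:
  fixes I J :: "'a set"
  assumes I: "int_ideal I" and J: "int_ideal J" "J \<subseteq> I" "J \<noteq> {0}"
  shows "int_ideal (int_mod.span {x * y | x y. x \<in> J \<and> y \<in> inverse_ideal I})" (is "int_ideal (int_mod.span ?S)")
    and "int_mod.span {x * y | x y. x \<in> J \<and> y \<in> inverse_ideal I} \<noteq> {0}"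
proof -
  have "1 \<in> inverse_ideal I" using int_idealD(1)[OF I] by (simp add: inverse_ideal_def)
  then have JS: "x \<in> ?S" if "x \<in> J" for x using that by force
  show "int_ideal (int_mod.span ?S)"
  proof (rule int_ideal_span)
    show "?S \<subseteq> {x. algebraic_int x}" using J(2) by (auto simp: inverse_ideal_def)
    fix a x :: 'a assume a: "algebraic_int a" and "x \<in> ?S"
    then obtain u v where "x = u * v" "u \<in> J" "v \<in> inverse_ideal I" by blast
    then show "a * x \<in> ?S" using int_idealD(4)[OF J(1) a]
      by (intro CollectI exI[of _ "a * u"] exI[of _ v]) auto
  qed
  obtain x where "x \<in> J" "x \<noteq> 0" using int_idealD(2)[OF J(1)] J(3) by blast
  then show "int_mod.span ?S \<noteq> {0}" using int_mod.span_base[OF JS] by blast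
qed

text \<open>If the product of \<open>I\<close> and its inverse were proper, a non-integral
  \<open>y\<close> would multiply it into O, so \<open>y\<close> would map the inverse of
  \<open>I\<close> to itself. Scaling by a nonzero \<open>a\<close> in \<open>I\<close> makes the
  inverse an integral ideal \<open>D\<close>; being stable under \<open>y\<close>, it forces
  \<open>y\<close> to be integral.\<close>

lemma int_ideal_invertible:
  fixes I :: "'a set"
  assumes I: "int_ideal I" "I \<noteq> {0}"
  shows "1 \<in> int_mod.span {x * y | x y. x \<in> I \<and> y \<in> inverse_ideal I}" (is "1 \<in> int_mod.span ?S")
proof (rule ccontr)
  assume one: "1 \<notin> int_mod.span ?S"
  have C: "int_ideal (int_mod.span ?S)" "int_mod.span ?S \<noteq> {0}"
    using product_ideal[OF I(1) I(1) order_refl I(2)] by auto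
  obtain m :: int where m: "m > 0" "of_int m \<in> int_mod.span ?S" by (rule int_ideal_contains_integer[OF C])
  obtain y where y: "\<not> algebraic_int y" "\<And>c. c \<in> int_mod.span ?S \<Longrightarrow> algebraic_int (y * c)"
    using proper_ideal_multiplier[OF C(1) one m] by blast
  obtain a where a: "a \<in> I" "a \<noteq> 0" using int_idealD(2)[OF I(1)] I(2) by blast
  define D where "D = (\<lambda>v. a * v) ` inverse_ideal I"
  have D: "int_ideal D"
    unfolding int_ideal_def
  proof (intro conjI ballI allI impI)
    show "D \<subseteq> {x. algebraic_int x}" using a by (auto simp: D_def inverse_ideal_def)
    show "0 \<in> D" unfolding D_def by (intro image_eqI[of _ _ 0]) (auto simp: inverse_ideal_def)
  next
    fix x y assume "x \<in> D" "y \<in> D"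
    then obtain u v where "u \<in> inverse_ideal I" "v \<in> inverse_ideal I" "x = a * u" "y = a * v" by (auto simp: D_def)
    then show "x + y \<in> D" unfolding D_def
      by (intro image_eqI[of _ _ "u + v"]) (auto simp: inverse_ideal_def distrib_left intro: algebraic_int_add)
  next
    fix c x :: 'a assume "x \<in> D" "algebraic_int c"
    then obtain u where u: "u \<in> inverse_ideal I" "x = a * u" by (auto simp: D_def)
    have "algebraic_int (t * (c * u))" if "t \<in> I" for t
      using u(1) that algebraic_int_mult[OF \<open>algebraic_int c\<close>, of "t * u"]
      by (simp add: inverse_ideal_def mult.left_commute)
    then show "c * x \<in> D" unfolding D_def u(2)
      by (intro image_eqI[of _ _ "c * u"]) (auto simp: inverse_ideal_def)
  qed
  have "a * 1 \<in> D" unfolding D_def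
    using int_idealD(1)[OF I(1)] by (intro imageI) (simp add: inverse_ideal_def)
  then have D0: "D \<noteq> {0}" using a(2) by auto
  have "y * x \<in> D" if "x \<in> D" for x
  proof -
    obtain v where v: "v \<in> inverse_ideal I" "x = a * v" using \<open>x \<in> D\<close> by (auto simp: D_def)
    have "algebraic_int (t * (y * v))" if "t \<in> I" for t
    proof -
      have "t * v \<in> int_mod.span ?S" using that v(1) by (intro int_mod.span_base) blast
      from y(2)[OF this] show ?thesis by (simp add: mult_ac)
    qed
    then show ?thesis unfolding D_def v(2)
      by (intro image_eqI[of _ _ "y * v"]) (auto simp: inverse_ideal_def mult_ac)
  qed
  then show False using algebraic_int_if_stabilizes[OF D D0] y(1) by blast
qed

text \<open>Maximality in the form that is used: every element outside \<open>M\<close> is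
  invertible modulo \<open>M\<close>.\<close>

definition max_int_ideal :: "'a set \<Rightarrow> bool" where
  "max_int_ideal M \<longleftrightarrow> int_ideal M \<and> 1 \<notin> M \<and>
     (\<forall>x. algebraic_int x \<longrightarrow> x \<notin> M \<longrightarrow> (\<exists>\<mu>\<in>M. \<exists>a. algebraic_int a \<and> 1 = \<mu> + x * a))"

text \<open>An ideal above \<open>P\<close> contains some m > 0 from \<open>P\<close>, so it is
  determined by its finitely many residues modulo m. A proper one with the most residues is maximal,
  with no appeal to Zorn's lemma.\<close>

lemma max_int_ideal_exists:
  fixes P :: "'a set"
  assumes P: "int_ideal P" "P \<noteq> {0}" "1 \<notin> P"
  obtains M where "max_int_ideal M" "P \<subseteq> M"
proof -
  obtain m :: int where m: "m > 0" "of_int m \<in> P" by (rule int_ideal_contains_integer[OF P(1,2)])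
  obtain F :: "'a set" where F0: "finite F"
    "\<forall>x. algebraic_int x \<longrightarrow> (\<exists>r\<in>F. \<exists>y. algebraic_int y \<and> x = r + of_int m * y)"
    by (rule finite_residues[OF m(1)])
  note F = F0(1) F0(2)[rule_format]
  define Q where "Q N \<longleftrightarrow> int_ideal N \<and> P \<subseteq> N \<and> 1 \<notin> N" for N
  have "Q P" using P by (simp add: Q_def)
  moreover have "\<forall>N. Q N \<longrightarrow> card (F \<inter> N) < Suc (card F)" using F(1) by (simp add: card_mono less_Suc_eq_le)
  ultimately obtain M where M: "Q M" "\<And>N. Q N \<Longrightarrow> card (F \<inter> N) \<le> card (F \<inter> M)"
    using ex_has_greatest_nat[of Q P "\<lambda>N. card (F \<inter> N)" "Suc (card F)"] by blast
  have iM: "int_ideal M" using M(1) by (simp add: Q_def)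
  have "\<exists>\<mu>\<in>M. \<exists>a. algebraic_int a \<and> 1 = \<mu> + x * a" if x: "algebraic_int x" "x \<notin> M" for x
  proof (rule ccontr)
    assume no: "\<not> ?thesis"
    define N where "N = {\<mu> + x * a | \<mu> a. \<mu> \<in> M \<and> algebraic_int a}"
    have inN: "\<mu> + x * a \<in> N" if "\<mu> \<in> M" "algebraic_int a" for \<mu> a using that by (auto simp: N_def)
    have iN: "int_ideal N"
      unfolding int_ideal_def
    proof (intro conjI ballI allI impI)
      show "N \<subseteq> {x. algebraic_int x}"
        using x(1) int_idealD(1)[OF iM] by (auto simp: N_def intro!: algebraic_int_add algebraic_int_mult)
      show "0 \<in> N" using inN[OF int_idealD(2)[OF iM], of 0] by simp
    next
      fix s t assume "s \<in> N" "t \<in> N"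
      then obtain \<mu> a \<nu> c where "s = \<mu> + x * a" "t = \<nu> + x * c" "\<mu> \<in> M" "\<nu> \<in> M" "algebraic_int a" "algebraic_int c"
        by (auto simp: N_def)
      then show "s + t \<in> N" using inN[OF int_idealD(3)[OF iM] algebraic_int_add, of \<mu> \<nu> a c]
        by (simp add: algebra_simps)
    next
      fix c s :: 'a assume "s \<in> N" and c: "algebraic_int c"
      then obtain \<mu> a where "s = \<mu> + x * a" "\<mu> \<in> M" "algebraic_int a" by (auto simp: N_def)
      then show "c * s \<in> N" using inN[OF int_idealD(4)[OF iM c] algebraic_int_mult[OF c], of \<mu> a]
        by (simp add: algebra_simps)
    qed
    have MN: "M \<subseteq> N" using inN[of _ 0] by auto
    have xN: "x \<in> N" using inN[OF int_idealD(2)[OF iM] algebraic_int_one] by simp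
    have "1 \<notin> N" using no by (auto simp: N_def)
    then have "Q N" using iN MN M(1) by (auto simp: Q_def)
    then have "card (F \<inter> N) \<le> card (F \<inter> M)" by (rule M(2))
    \<comment> \<open>Equal numbers of residues mean the same residues, so the residue of
      \<open>x\<close>, which lies in \<open>N\<close>, already lies in \<open>M\<close>; then so
      does \<open>x\<close>.\<close>
    then have eq: "F \<inter> M = F \<inter> N"
      using F(1) MN by (intro card_seteq) auto
    have mM: "of_int m \<in> M" using m(2) M(1) by (auto simp: Q_def)
    obtain r t where rt: "r \<in> F" "algebraic_int t" "x = r + of_int m * t" using F(2)[OF x(1)] by blast
    have mt: "of_int m * t \<in> M" using int_idealD(5)[OF iM rt(2) mM] .
    then have "x - of_int m * t \<in> N" using int_idealD(6)[OF iN xN] MN by blast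
    then have "r \<in> M" using rt eq by auto
    then show False using int_idealD(3)[OF iM _ mt] rt(3) x(2) by blast
  qed
  then show ?thesis using that[of M] M(1) by (auto simp: max_int_ideal_def Q_def)
qed

lemma max_int_ideal_prime:
  assumes M: "max_int_ideal M" and xy: "algebraic_int x" "algebraic_int y" "x * y \<in> M" "x \<notin> M"
  shows "y \<in> M"
proof -
  have iM: "int_ideal M" using M by (simp add: max_int_ideal_def)
  obtain \<mu> a where a: "\<mu> \<in> M" "algebraic_int a" "1 = \<mu> + x * a"
    using M xy by (auto simp: max_int_ideal_def)
  have "y = (\<mu> + x * a) * y" using a(3) by simp
  also have "\<dots> = \<mu> * y + (x * y) * a" by (simp add: algebra_simps)
  also have "\<dots> \<in> M"
    by (rule int_idealD(3)[OF iM int_idealD(5)[OF iM xy(2) a(1)] int_idealD(5)[OF iM a(2) xy(3)]])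
  finally show ?thesis .
qed

text \<open>The product \<open>P i\<close> of \<open>J i\<close> with the inverse of
  \<open>I\<close> is proper, since 1 in it would give I \<subseteq> J i, so it lies in a maximal
  ideal \<open>M i\<close>. It suffices that multiplying \<open>x\<close> by the inverse of
  \<open>I\<close> never lands inside any \<open>M i\<close>; such an \<open>x\<close> is assembled
  as in the Chinese remainder theorem.\<close>

lemma ideal_not_union_of_proper_subideals:
  fixes I :: "'a set" and J :: "'i \<Rightarrow> 'a set"
  assumes I: "int_ideal I" and T: "finite T"
    and J: "\<And>i. i \<in> T \<Longrightarrow> int_ideal (J i)" "\<And>i. i \<in> T \<Longrightarrow> J i \<noteq> {0}" "\<And>i. i \<in> T \<Longrightarrow> J i \<subset> I" and I0: "I \<noteq> {0}"
  obtains x where "x \<in> I" "\<And>i. i \<in> T \<Longrightarrow> x \<notin> J i"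
proof -
  define P where "P i = int_mod.span {x * y | x y. x \<in> J i \<and> y \<in> inverse_ideal I}" for i
  have P: "int_ideal (P i)" "P i \<noteq> {0}" "1 \<notin> P i" if i: "i \<in> T" for i
  proof -
    have JI: "J i \<subseteq> I" using J(3)[OF i] by blast
    show "int_ideal (P i)" "P i \<noteq> {0}"
      using product_ideal[OF I J(1)[OF i] JI J(2)[OF i]] by (auto simp: P_def)
    show "1 \<notin> P i"
    proof
      assume "1 \<in> P i"
      moreover have "p * a \<in> J i" if "p \<in> P i" "a \<in> I" for p a
        using that(1) unfolding P_def
      proof (induction rule: int_mod.span_induct_alt)
        case base then show ?case using int_idealD(2)[OF J(1)[OF i]] by simp
      next
        case (step c p q)
        then obtain x y where xy: "p = x * y" "x \<in> J i" "y \<in> inverse_ideal I" by blast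
        have "algebraic_int (of_int c * (a * y))"
          using xy(3) that(2) by (intro algebraic_int_mult[OF algebraic_int_of_int]) (simp add: inverse_ideal_def)
        then have "x * (of_int c * (a * y)) \<in> J i" by (rule int_idealD(5)[OF J(1)[OF i] _ xy(2)])
        then have "x * (of_int c * (a * y)) + q * a \<in> J i" using int_idealD(3)[OF J(1)[OF i]] step by blast
        then show ?case by (simp add: xy(1) algebra_simps)
      qed
      ultimately have "I \<subseteq> J i" by (metis mult_1 subsetI)
      then show False using J(3)[OF i] by blast
    qed
  qed
  have "\<forall>i. \<exists>M. i \<in> T \<longrightarrow> max_int_ideal M \<and> P i \<subseteq> M"
    using max_int_ideal_exists[OF P] by metis
  then obtain M where M: "\<And>i. i \<in> T \<Longrightarrow> max_int_ideal (M i)" "\<And>i. i \<in> T \<Longrightarrow> P i \<subseteq> M i" by metis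
  \<comment> \<open>Different indices may lead to the same maximal ideal; the construction runs over
    the set of ideals to keep them distinct.\<close>
  define \<M> where "\<M> = M ` T"
  have f\<M>: "finite \<M>" using T by (simp add: \<M>_def)
  have \<M>: "max_int_ideal N" "int_ideal N" "1 \<notin> N" if "N \<in> \<M>" for N
    using that M(1) by (auto simp: \<M>_def max_int_ideal_def)
  \<comment> \<open>Distinct maximal ideals are incomparable; multiplying such separating elements,
    and using primality of \<open>N\<close>, gives an element outside \<open>N\<close> and inside
    all the others.\<close>
  have sep: "\<exists>a. a \<in> N' \<and> a \<notin> N" if N: "N \<in> \<M>" "N' \<in> \<M>" "N' \<noteq> N" for N N'
  proof (rule ccontr)
    assume "\<not> ?thesis"
    then have sub: "N' \<subseteq> N" by blast
    then obtain x where x: "x \<in> N" "x \<notin> N'" using N by blast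
    then obtain \<mu> a where a: "\<mu> \<in> N'" "algebraic_int a" "1 = \<mu> + x * a"
      using \<M>(1)[OF N(2)] int_idealD(1)[OF \<M>(2)[OF N(1)] x(1)] unfolding max_int_ideal_def by blast
    have "\<mu> + x * a \<in> N" using a sub x int_idealD(3,5)[OF \<M>(2)[OF N(1)]] by blast
    then show False using a(3) \<M>(3)[OF N(1)] by simp
  qed
  have "\<exists>e. algebraic_int e \<and> e \<notin> N \<and> (\<forall>N'\<in>\<M> - {N}. e \<in> N')" if N: "N \<in> \<M>" for N
  proof -
    have "\<exists>e. algebraic_int e \<and> e \<notin> N \<and> (\<forall>N'\<in>A. e \<in> N')" if "finite A" "A \<subseteq> \<M> - {N}" for A
      using that
    proof (induction A rule: finite_induct)
      case empty then show ?case using \<M>(3)[OF N] algebraic_int_one by blast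
    next
      case (insert N' A)
      then obtain e where e: "algebraic_int e" "e \<notin> N" "\<forall>N'\<in>A. e \<in> N'" by blast
      obtain a where a: "a \<in> N'" "a \<notin> N" using sep[OF N, of N'] insert.prems by blast
      have aa: "algebraic_int a" using a(1) insert.prems int_idealD(1)[OF \<M>(2)] by blast
      have "e * a \<notin> N" using max_int_ideal_prime[OF \<M>(1)[OF N] e(1) aa] e(2) a(2) by blast
      moreover have "e * a \<in> N''" if "N'' \<in> insert N' A" for N''
      proof -
        have "int_ideal N''" using that insert.prems \<M>(2) by blast
        then show ?thesis using that e a aa int_idealD(4,5)[of N''] by blast
      qed
      ultimately show ?case using algebraic_int_mult[OF e(1) aa] by blast
    qed
    then show ?thesis using f\<M> by blast
  qed
  then have "\<forall>N. \<exists>e. N \<in> \<M> \<longrightarrow> algebraic_int e \<and> e \<notin> N \<and> (\<forall>N'\<in>\<M> - {N}. e \<in> N')" by blast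
  then obtain e where e: "\<And>N. N \<in> \<M> \<Longrightarrow> algebraic_int (e N)" "\<And>N. N \<in> \<M> \<Longrightarrow> e N \<notin> N"
    "\<And>N N'. N \<in> \<M> \<Longrightarrow> N' \<in> \<M> \<Longrightarrow> N' \<noteq> N \<Longrightarrow> e N \<in> N'"
    by (metis DiffI empty_iff insert_iff)
  have "\<exists>u v. u \<in> I \<and> v \<in> inverse_ideal I \<and> u * v \<notin> N" if N: "N \<in> \<M>" for N
  proof (rule ccontr)
    assume "\<not> ?thesis"
    then have "{x * y | x y. x \<in> I \<and> y \<in> inverse_ideal I} \<subseteq> N" by blast
    moreover have "int_mod.subspace N"
      unfolding int_mod.subspace_def using int_idealD[OF \<M>(2)[OF N]] algebraic_int_of_int by blast
    ultimately have "int_mod.span {x * y | x y. x \<in> I \<and> y \<in> inverse_ideal I} \<subseteq> N"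
      by (rule int_mod.span_minimal)
    then show False using int_ideal_invertible[OF I I0] \<M>(3)[OF N] by blast
  qed
  then have "\<forall>N. \<exists>u v. N \<in> \<M> \<longrightarrow> u \<in> I \<and> v \<in> inverse_ideal I \<and> u * v \<notin> N" by blast
  then obtain u v where u: "\<And>N. N \<in> \<M> \<Longrightarrow> u N \<in> I" and v: "\<And>N. N \<in> \<M> \<Longrightarrow> v N \<in> inverse_ideal I"
    and uv: "\<And>N. N \<in> \<M> \<Longrightarrow> u N * v N \<notin> N" by metis
  \<comment> \<open>Modulo \<open>N\<close> only the summand of \<open>N\<close> survives in
    \<open>x * v N\<close>, and it is a product of elements outside the prime ideal
    \<open>N\<close>.\<close>
  define x where "x = (\<Sum>N\<in>\<M>. e N * u N)"
  have xI: "x \<in> I" unfolding x_def by (intro int_ideal_sum[OF I] int_idealD(4)[OF I] e u)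
  have xv: "x * v N \<notin> N" if N: "N \<in> \<M>" for N
  proof
    assume xN: "x * v N \<in> N"
    have alg: "algebraic_int (u N' * v N)" if "N' \<in> \<M>" for N'
      using u[OF that] v[OF N] by (simp add: inverse_ideal_def)
    have "x * v N = e N * (u N * v N) + (\<Sum>N'\<in>\<M> - {N}. e N' * (u N' * v N))"
      unfolding x_def using sum.remove[OF f\<M> N, of "\<lambda>N. e N * u N"]
      by (simp add: algebra_simps sum_distrib_left)
    moreover have "(\<Sum>N'\<in>\<M> - {N}. e N' * (u N' * v N)) \<in> N"
      using e(3) N alg by (intro int_ideal_sum[OF \<M>(2)[OF N]] int_idealD(5)[OF \<M>(2)[OF N]]) auto
    ultimately have "e N * (u N * v N) \<in> N"
      using int_idealD(6)[OF \<M>(2)[OF N] xN, of "\<Sum>N'\<in>\<M> - {N}. e N' * (u N' * v N)"] by simp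
    then have "u N * v N \<in> N" using max_int_ideal_prime[OF \<M>(1)[OF N] e(1)[OF N] alg[OF N] _ e(2)[OF N]] by blast
    then show False using uv[OF N] by blast
  qed
  have "x \<notin> J i" if i: "i \<in> T" for i
  proof
    assume "x \<in> J i"
    have iM: "M i \<in> \<M>" using i by (simp add: \<M>_def)
    have "x * v (M i) \<in> P i" unfolding P_def
      using \<open>x \<in> J i\<close> v[OF iM] by (intro int_mod.span_base) blast
    then show False using M(2)[OF i] xv[OF iM] by blast
  qed
  then show ?thesis using that xI by blast
qed

end

section \<open>Places and heights\<close>

lemma absolute_valueD:
  assumes "absolute_value v"
  shows "v x \<ge> 0" "v x = 0 \<longleftrightarrow> x = 0" "v (x * y) = v x * v y" "v (x + y) \<le> v x + v y"
  using assms by (auto simp: absolute_value_def)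

lemma absolute_value_one:
  assumes "absolute_value v" shows "v 1 = 1"
  using absolute_valueD(3)[OF assms, of 1 1] absolute_valueD(2)[OF assms, of 1] by simp

lemma absolute_value_zero:
  assumes "absolute_value v" shows "v 0 = 0"
  using absolute_valueD(2)[OF assms, of 0] by simp

lemma absolute_value_power:
  assumes "absolute_value v" shows "v (x ^ n) = v x ^ n"
  by (induction n) (simp_all add: absolute_value_one[OF assms] absolute_valueD(3)[OF assms])

lemma absolute_value_sum:
  assumes "absolute_value v" shows "v (sum f A) \<le> (\<Sum>i\<in>A. v (f i))"
proof (induction A rule: infinite_finite_induct)
  case (insert i A)
  then show ?case using absolute_valueD(4)[OF assms, of "f i" "sum f A"] by simp
qed (auto simp: absolute_value_zero[OF assms])

lemma absolute_value_inverse: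
  assumes "absolute_value v" shows "v (inverse x) = inverse (v x)"
proof (cases "x = 0")
  case False
  then have "v x * v (inverse x) = 1"
    using absolute_valueD(3)[OF assms, of x "inverse x"] absolute_value_one[OF assms] by simp
  then show ?thesis by (metis inverse_unique)
qed (simp add: absolute_value_zero[OF assms])

lemma absolute_value_uminus:
  assumes "absolute_value v" shows "v (- x) = v x"
proof -
  have "v (- 1) * v (- 1) = 1" using absolute_valueD(3)[OF assms, of "-1" "-1"] absolute_value_one[OF assms] by simp
  then have "v (- 1) = 1" using absolute_valueD(1)[OF assms, of "-1"]
    by (metis abs_of_nonneg abs_mult_self_eq one_power2 power2_eq_square power2_eq_imp_eq zero_le_one)
  then show ?thesis using absolute_valueD(3)[OF assms, of "-1" x] by simp
qed

lemma absolute_value_diff_ge: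
  assumes "absolute_value v" shows "v (x + y) \<ge> v x - v y"
  using absolute_valueD(4)[OF assms, of "x + y" "- y"] absolute_value_uminus[OF assms, of y] by simp

lemma padic_abs_of_int_le_1:
  assumes "prime p" shows "padic_abs p (of_int k) \<le> 1"
proof (cases "k = 0")
  case False
  have "real p \<ge> 1" using prime_ge_1_nat[OF assms] by simp
  then have "real p powi (- int (multiplicity (int p) k)) \<le> 1"
    by (simp add: power_int_minus inverse_le_1_iff one_le_power)
  then show ?thesis using False by (simp add: padic_abs_def quotient_of_int)
qed (simp add: padic_abs_def)

text \<open>Weak approximation: multiplying \<open>y\<close> by \<open>x ^ n\<close> or by \<open>x ^ n / (1 + x ^ n)\<close> for large \<open>n\<close> handles one
  more absolute value.\<close>

lemma absolute_values_separate:
  assumes v: "absolute_value v" and x0: "v x0 > 1" and "finite W"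
    and "\<And>w. w \<in> W \<Longrightarrow> absolute_value w" "\<And>w. w \<in> W \<Longrightarrow> \<exists>y. v y > 1 \<and> w y < 1"
  shows "\<exists>x. v x > 1 \<and> (\<forall>w\<in>W. w x < 1)"
  using assms(3-)
proof (induction W rule: finite_induct)
  case empty
  then show ?case using x0 by blast
next
  case (insert w W)
  obtain x where x: "v x > 1" "\<And>u. u \<in> W \<Longrightarrow> u x < 1" using insert by auto
  obtain y where y: "v y > 1" "w y < 1" using insert.prems(2)[of w] by blast
  have w: "absolute_value w" using insert.prems(1) by simp
  have W: "absolute_value u" if "u \<in> W" for u using insert.prems(1) that by simp
  consider "w x < 1" | "w x = 1" | "w x > 1" by linarith
  then show ?case
  proof cases
    case 1 then show ?thesis using x by auto
  next
    case 2
    have "\<forall>\<^sub>F n in sequentially. u (x ^ n * y) < 1" if u: "u \<in> W" for u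
    proof -
      have "(\<lambda>n. u x ^ n * u y) \<longlonglongrightarrow> 0 * u y"
        using x(2)[OF u] absolute_valueD(1)[OF W[OF u], of x]
        by (intro tendsto_mult_right LIMSEQ_power_zero) simp
      then have "\<forall>\<^sub>F n in sequentially. u x ^ n * u y < 1" by (intro order_tendstoD(2)[where y = "0 * u y"]) auto
      then show ?thesis by (simp add: absolute_valueD(3)[OF W[OF u]] absolute_value_power[OF W[OF u]])
    qed
    then have "\<forall>\<^sub>F n in sequentially. \<forall>u\<in>W. u (x ^ n * y) < 1"
      using insert.hyps(1) by (simp add: eventually_ball_finite)
    then obtain n where n: "\<forall>u\<in>W. u (x ^ n * y) < 1" by (auto simp: eventually_sequentially)
    have "1 * v y \<le> v x ^ n * v y"
      using x(1) y(1) by (intro mult_right_mono one_le_power) auto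
    then have "1 < v x ^ n * v y" using y(1) by linarith
    then have "v (x ^ n * y) > 1"
      by (simp only: absolute_valueD(3)[OF v] absolute_value_power[OF v])
    moreover have "w (x ^ n * y) < 1"
      using 2 y(2) by (simp add: absolute_valueD(3)[OF w] absolute_value_power[OF w])
    ultimately show ?thesis using n by auto
  next
    case 3
    \<comment> \<open>The factor in front of \<open>y\<close> has value tending to 1 where
      \<open>x\<close> is larger than 1 and to 0 where it is smaller, so \<open>v\<close> and
      \<open>w\<close> keep their sizes of \<open>y\<close> while \<open>W\<close> is pushed to
      0.\<close>
    define z where "z n = x ^ n * inverse (1 + x ^ n) * y" for n
    have uz: "u (z n) = u x ^ n * inverse (u (1 + x ^ n)) * u y" if "absolute_value u" for u n
      using that by (simp add: z_def absolute_valueD(3) absolute_value_power absolute_value_inverse)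
    have big: "(\<lambda>n. c ^ n * inverse (c ^ n + e)) \<longlonglongrightarrow> 1" if "c > 1" for c e :: real
    proof -
      have "(\<lambda>n. inverse (1 + e * (1 / c) ^ n)) \<longlonglongrightarrow> inverse (1 + e * 0)"
        using that by (intro tendsto_inverse tendsto_add tendsto_mult tendsto_const LIMSEQ_power_zero) auto
      moreover have "inverse (1 + e * (1 / c) ^ n) = c ^ n * inverse (c ^ n + e)" for n
      proof -
        have c: "c ^ n \<noteq> 0" using that by simp
        then have "1 + e * (1 / c) ^ n = inverse (c ^ n) * (c ^ n + e)"
          by (simp add: power_one_over field_simps)
        then show ?thesis using c by (simp add: inverse_mult_distrib)
      qed
      ultimately show ?thesis by simp
    qed
    have "\<forall>\<^sub>F n in sequentially. v (z n) > 1"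
    proof -
      have "(\<lambda>n. v x ^ n * inverse (v x ^ n + 1) * v y) \<longlonglongrightarrow> 1 * v y"
        by (intro tendsto_mult_right big x(1))
      then have ev: "\<forall>\<^sub>F n in sequentially. v x ^ n * inverse (v x ^ n + 1) * v y > 1"
        using y(1) by (intro order_tendstoD(1)[where y = "1 * v y"]) auto
      \<comment> \<open>For \<open>n > 0\<close> the value of x^n exceeds 1, so
        \<open>v (1 + x ^ n)\<close> is positive and the triangle inequality may be
        inverted.\<close>
      have le: "v x ^ n * inverse (v x ^ n + 1) * v y \<le> v (z n)" if "n > 0" for n
      proof -
        have "v (1 + x ^ n) \<le> v x ^ n + 1"
          using absolute_valueD(4)[OF v, of 1 "x ^ n"] by (simp add: absolute_value_one[OF v] absolute_value_power[OF v])
        moreover have "v x ^ n > 1" using x(1) that by (simp add: one_less_power)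
        moreover have "v (1 + x ^ n) \<ge> v x ^ n - 1"
          using absolute_value_diff_ge[OF v, of "x ^ n" 1]
          by (simp add: add.commute absolute_value_one[OF v] absolute_value_power[OF v])
        ultimately have "inverse (v x ^ n + 1) \<le> inverse (v (1 + x ^ n))" by (intro le_imp_inverse_le) auto
        then show ?thesis unfolding uz[OF v] using x(1) y(1) by (intro mult_right_mono mult_left_mono) auto
      qed
      from ev eventually_gt_at_top[of 0] show ?thesis
      proof eventually_elim
        case (elim n)
        then show ?case using le[of n] by linarith
      qed
    qed
    moreover have "\<forall>\<^sub>F n in sequentially. w (z n) < 1"
    proof -
      have "(\<lambda>n. w x ^ n * inverse (w x ^ n + (- 1)) * w y) \<longlonglongrightarrow> 1 * w y"
        by (intro tendsto_mult_right big 3)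
      then have ev: "\<forall>\<^sub>F n in sequentially. w x ^ n * inverse (w x ^ n + (- 1)) * w y < 1"
        using y(2) by (intro order_tendstoD(2)[where y = "1 * w y"]) auto
      have le: "w (z n) \<le> w x ^ n * inverse (w x ^ n + (- 1)) * w y" if "n > 0" for n
      proof -
        have "w x ^ n > 1" using 3 that by (simp add: one_less_power)
        moreover have "w (1 + x ^ n) \<ge> w x ^ n - 1"
          using absolute_value_diff_ge[OF w, of "x ^ n" 1]
          by (simp add: add.commute absolute_value_one[OF w] absolute_value_power[OF w])
        ultimately have "inverse (w (1 + x ^ n)) \<le> inverse (w x ^ n + (- 1))" by (intro le_imp_inverse_le) auto
        then show ?thesis unfolding uz[OF w] using 3 absolute_valueD(1)[OF w, of y]
          by (intro mult_right_mono mult_left_mono) auto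
      qed
      from ev eventually_gt_at_top[of 0] show ?thesis
      proof eventually_elim
        case (elim n)
        then show ?case using le[of n] by linarith
      qed
    qed
    moreover have "\<forall>\<^sub>F n in sequentially. u (z n) < 1" if u: "u \<in> W" for u
    proof -
      note ua = W[OF u]
      have c: "0 \<le> u x" "u x < 1" using x(2)[OF u] absolute_valueD(1)[OF ua] by auto
      have "(\<lambda>n. u x ^ n * inverse (1 - u x ^ n) * u y) \<longlonglongrightarrow> 0 * inverse (1 - 0) * u y"
        using c by (intro tendsto_intros LIMSEQ_power_zero) auto
      then have ev: "\<forall>\<^sub>F n in sequentially. u x ^ n * inverse (1 - u x ^ n) * u y < 1"
        by (intro order_tendstoD(2)[where y = "0 * inverse (1 - 0) * u y"]) auto
      have le: "u (z n) \<le> u x ^ n * inverse (1 - u x ^ n) * u y" if "n > 0" for n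
      proof -
        have "u x ^ n < 1" using c that by (simp add: power_less_one_iff)
        moreover have "u (1 + x ^ n) \<ge> 1 - u x ^ n"
          using absolute_value_diff_ge[OF ua, of 1 "x ^ n"]
          by (simp add: absolute_value_one[OF ua] absolute_value_power[OF ua])
        ultimately have "inverse (u (1 + x ^ n)) \<le> inverse (1 - u x ^ n)" by (intro le_imp_inverse_le) auto
        then show ?thesis unfolding uz[OF ua] using c absolute_valueD(1)[OF ua, of y]
          by (intro mult_right_mono mult_left_mono) auto
      qed
      from ev eventually_gt_at_top[of 0] show ?thesis
      proof eventually_elim
        case (elim n)
        then show ?case using le[of n] by linarith
      qed
    qed
    then have "\<forall>\<^sub>F n in sequentially. \<forall>u\<in>W. u (z n) < 1"
      using insert.hyps(1) by (simp add: eventually_ball_finite)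
    ultimately have "\<forall>\<^sub>F n in sequentially. v (z n) > 1 \<and> w (z n) < 1 \<and> (\<forall>u\<in>W. u (z n) < 1)"
      by eventually_elim auto
    then show ?thesis by (auto simp: eventually_sequentially)
  qed
qed

context
  assumes K: "number_field TYPE('a::field_char_0)"
begin

lemma absolute_value_emb: "absolute_value (\<lambda>x. cmod (Rep_emb (\<sigma> :: 'a emb) x))"
  unfolding absolute_value_def
  by (auto simp: Rep_emb_simps[OF K] Rep_emb_eq_0_iff[OF K] norm_mult norm_triangle_ineq)

text \<open>With \<open>v\<close> at most 1 on rational integers, the values on an integral basis
  bound \<open>v\<close> on all of O. The powers of \<open>x\<close> stay in O, so their values
  could not grow.\<close>

lemma nonarchimedean_le_1:
  fixes x :: 'a
  assumes v: "absolute_value v" and int: "\<And>k. v (of_int k) \<le> 1" and x: "algebraic_int x"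
  shows "v x \<le> 1"
proof (rule ccontr)
  assume "\<not> v x \<le> 1"
  then have gt: "v x > 1" by simp
  obtain b :: "'a emb \<Rightarrow> 'a" where b: "int_basis b" by (rule int_basis_exists[OF K])
  define C where "C = (\<Sum>j\<in>UNIV. v (b j))"
  have "v y \<le> C" if y: "algebraic_int y" for y
  proof -
    have "\<exists>c. y = (\<Sum>j\<in>UNIV. of_int (c j) * b j)" using b y unfolding int_basis_def by (elim conjE allE[of _ y]) blast
    then obtain c where c: "y = (\<Sum>j\<in>UNIV. of_int (c j) * b j)" by blast
    have "v y \<le> (\<Sum>j\<in>UNIV. v (of_int (c j) * b j))" unfolding c by (rule absolute_value_sum[OF v])
    also have "\<dots> \<le> C" unfolding C_def absolute_valueD(3)[OF v]
      by (intro sum_mono mult_left_le_one_le absolute_valueD(1)[OF v] int)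
    finally show ?thesis .
  qed
  then have "v x ^ n \<le> C" for n using algebraic_int_power[OF x, of n] absolute_value_power[OF v, of x n] by metis
  then show False using real_arch_pow[OF gt, of C] by (meson not_less)
qed

text \<open>Rational coordinates are linear functions of the conjugates, through the inverse of the
  matrix of conjugates, and \<open>v\<close> is the usual absolute value on them.\<close>

lemma archimedean_bound:
  assumes v: "absolute_value v" and rat: "\<And>q. v (of_rat q) = \<bar>of_rat q\<bar>"
  obtains C where "\<And>x :: 'a. v x \<le> C * (\<Sum>\<sigma>\<in>UNIV. cmod (Rep_emb (\<sigma> :: 'a emb) x))"
proof -
  obtain b :: "'a emb \<Rightarrow> 'a" where b: "rat_spanning b" and "\<forall>j. algebraic_int (b j)"
    by (rule algebraic_int_rat_spanning_exists[OF K])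
  let ?S = "emb_matrix b"
  obtain S' where S': "S' ** ?S = mat 1"
    using det_emb_matrix_nonzero[OF K b] by (auto simp: invertible_def simp flip: invertible_det_nz)
  define A where "A j = (\<Sum>\<sigma>\<in>UNIV. cmod (S' $ j $ \<sigma>))" for j
  define N where "N x = (\<Sum>\<sigma>\<in>UNIV. cmod (Rep_emb (\<sigma> :: 'a emb) x))" for x
  have "v x \<le> (\<Sum>j\<in>UNIV. A j * v (b j)) * N x" for x
  proof -
    have "\<exists>c. x = (\<Sum>j\<in>UNIV. of_rat (c j) * b j)" using b unfolding rat_spanning_def by (rule spec)
    then obtain c where c: "x = (\<Sum>j\<in>UNIV. of_rat (c j) * b j)" by blast
    have cj: "\<bar>real_of_rat (c j)\<bar> \<le> A j * N x" for j
    proof -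
      have "S' *v (?S *v (\<chi> j. of_rat (c j))) = (\<chi> j. of_rat (c j))"
        using S' by (simp add: matrix_vector_mul_assoc)
      then have "(\<chi> j. of_rat (c j)) = S' *v (\<chi> \<sigma>. Rep_emb \<sigma> x)"
        unfolding emb_matrix_mult_coeffs[OF K c] by simp
      then have "complex_of_rat (c j) = (\<Sum>\<sigma>\<in>UNIV. S' $ j $ \<sigma> * Rep_emb \<sigma> x)"
        by (simp add: vec_eq_iff matrix_vector_mult_def)
      then have "\<bar>real_of_rat (c j)\<bar> = cmod (\<Sum>\<sigma>\<in>UNIV. S' $ j $ \<sigma> * Rep_emb \<sigma> x)"
        using cmod_of_rat[of "c j"] by simp
      also have "\<dots> \<le> (\<Sum>\<sigma>\<in>UNIV. cmod (S' $ j $ \<sigma>) * cmod (Rep_emb \<sigma> x))"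
        by (rule order_trans[OF norm_sum]) (simp add: norm_mult)
      also have "\<dots> \<le> (\<Sum>\<sigma>\<in>UNIV. cmod (S' $ j $ \<sigma>) * N x)"
      proof (intro sum_mono mult_left_mono)
        fix \<sigma> :: "'a emb"
        show "cmod (Rep_emb \<sigma> x) \<le> N x" unfolding N_def by (rule member_le_sum) auto
      qed auto
      finally show ?thesis by (simp add: A_def sum_distrib_right)
    qed
    have "v x \<le> (\<Sum>j\<in>UNIV. v (of_rat (c j) * b j))" unfolding c by (rule absolute_value_sum[OF v])
    also have "\<dots> = (\<Sum>j\<in>UNIV. \<bar>real_of_rat (c j)\<bar> * v (b j))" by (simp add: absolute_valueD(3)[OF v] rat)
    also have "\<dots> \<le> (\<Sum>j\<in>UNIV. A j * N x * v (b j))"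
      by (intro sum_mono mult_right_mono cj absolute_valueD(1)[OF v])
    finally show ?thesis by (simp add: sum_distrib_left sum_distrib_right mult_ac)
  qed
  then show ?thesis using that unfolding N_def by blast
qed

text \<open>If \<open>v\<close> differed from the absolute values of all embeddings, approximation
  would give an \<open>x\<close> with \<open>v x > 1\<close> and all conjugates below 1. Its powers
  contradict the bound of \<open>v\<close> by the conjugates.\<close>

lemma archimedean_place_is_embedding:
  fixes v :: "'a \<Rightarrow> real"
  assumes v: "absolute_value v" and rat: "\<And>q. v (of_rat q) = \<bar>of_rat q\<bar>"
  obtains \<sigma> :: "'a emb" where "v = (\<lambda>x. cmod (Rep_emb \<sigma> x))"
proof (rule ccontr)
  assume no: "\<not> thesis"
  note obt = that
  have ex: "\<exists>y. v y > 1 \<and> cmod (Rep_emb \<sigma> y) < 1" for \<sigma> :: "'a emb"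
  proof -
    let ?w = "\<lambda>x. cmod (Rep_emb \<sigma> x)"
    have w: "absolute_value ?w" by (rule absolute_value_emb)
    have "v \<noteq> ?w" using obt no by blast
    then obtain x where x: "v x \<noteq> ?w x" by auto
    \<comment> \<open>If the two values compare the other way round, the inverse of \<open>x\<close>
      will do.\<close>
    have "\<exists>x. ?w x < v x"
    proof (cases "?w x < v x")
      case False
      then have lt: "v x < ?w x" using x by simp
      have "x \<noteq> 0" using x absolute_valueD(2)[OF v, of 0] absolute_valueD(2)[OF w, of 0] by auto
      then have "0 < v x" using absolute_valueD(1,2)[OF v, of x] by linarith
      then have "inverse (?w x) < inverse (v x)" using lt by (intro less_imp_inverse_less)
      then show ?thesis using absolute_value_inverse[OF v, of x] absolute_value_inverse[OF w, of x] by metis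
    qed blast
    then obtain x where x: "?w x < v x" by blast
    \<comment> \<open>Both absolute values agree on rationals, so dividing by a rational between the
      two values puts them on opposite sides of 1.\<close>
    obtain q where q: "?w x < of_rat q" "of_rat q < v x" using of_rat_dense[OF x] by blast
    have q0: "real_of_rat q > 0" using q(1) absolute_valueD(1)[OF w, of x] by linarith
    have "v (x * of_rat (inverse q)) = v x / of_rat q"
      unfolding absolute_valueD(3)[OF v] rat using q0 by (simp add: of_rat_inverse divide_inverse)
    moreover have "?w (x * of_rat (inverse q)) = ?w x / of_rat q"
      using q0 by (simp add: Rep_emb_simps[OF K] norm_mult norm_inverse cmod_of_rat of_rat_inverse divide_inverse)
    ultimately show ?thesis using q q0 by (intro exI[of _ "x * of_rat (inverse q)"]) simp
  qed
  have "v (of_rat 2) = 2" unfolding rat by simp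
  then have "v (of_rat 2) > 1" by simp
  then obtain x where x: "v x > 1" "\<forall>w\<in>range (\<lambda>(\<sigma> :: 'a emb) x. cmod (Rep_emb \<sigma> x)). w x < 1"
    using absolute_values_separate[OF v, of "of_rat 2" "range (\<lambda>(\<sigma> :: 'a emb) x. cmod (Rep_emb \<sigma> x))"]
      ex absolute_value_emb by auto
  obtain C where C: "\<And>x :: 'a. v x \<le> C * (\<Sum>\<sigma>\<in>UNIV. cmod (Rep_emb (\<sigma> :: 'a emb) x))"
    using archimedean_bound[OF v rat] by blast
  have "v x ^ n \<le> \<bar>C\<bar> * real CARD('a emb)" for n
  proof -
    have "v x ^ n = v (x ^ n)" by (simp add: absolute_value_power[OF v])
    also have "\<dots> \<le> C * (\<Sum>\<sigma>\<in>UNIV. cmod (Rep_emb (\<sigma> :: 'a emb) (x ^ n)))" by (rule C)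
    also have "\<dots> \<le> \<bar>C\<bar> * (\<Sum>\<sigma>\<in>UNIV. cmod (Rep_emb (\<sigma> :: 'a emb) (x ^ n)))"
      by (intro mult_right_mono sum_nonneg) auto
    also have "\<dots> \<le> \<bar>C\<bar> * (\<Sum>\<sigma>\<in>(UNIV :: 'a emb set). 1)"
    proof (intro mult_left_mono sum_mono)
      fix \<sigma> :: "'a emb"
      have "cmod (Rep_emb \<sigma> x) < 1" using x(2) by simp
      then show "cmod (Rep_emb \<sigma> (x ^ n)) \<le> 1"
        by (simp add: Rep_emb_simps[OF K] norm_power power_le_one)
    qed simp
    finally show ?thesis by simp
  qed
  then show False using real_arch_pow[OF x(1), of "\<bar>C\<bar> * real CARD('a emb)"] by (meson not_less)
qed

end

section \<open>Completions and local degrees at archimedean places\<close>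

hide_const (open) Complete_Measure.completion

text \<open>A class of Cauchy sequences is determined by the limit of its image under \<sigma>. This
  identifies the completion with the set of limits of \<sigma>(K) in the complex numbers, and the
  completed rationals with the reals.\<close>

locale complex_embedding = field_hom \<sigma> for \<sigma> :: "'a::field_char_0 \<Rightarrow> complex"
begin

abbreviation val :: "'a \<Rightarrow> real" where "val x \<equiv> cmod (\<sigma> x)"

lemma carrier_cauchy_ring: "carrier (cauchy_ring val) = {x. convergent (\<lambda>n. \<sigma> (x n))}"
  unfolding cauchy_ring_def
  by (simp add: Cauchy_convergent_iff[symmetric] Cauchy_def dist_norm hom_minus)

lemma null_sequences_eq: "null_sequences val = {x. (\<lambda>n. \<sigma> (x n)) \<longlonglongrightarrow> 0}"
  by (simp add: null_sequences_def tendsto_norm_zero_iff)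

lemma ring_cauchy_ring: "cring (cauchy_ring val)"
proof (rule cringI)
  show "abelian_group (cauchy_ring val)"
  proof (rule abelian_groupI)
    fix x assume x: "x \<in> carrier (cauchy_ring val)"
    show "\<exists>y\<in>carrier (cauchy_ring val). y \<oplus>\<^bsub>cauchy_ring val\<^esub> x = \<zero>\<^bsub>cauchy_ring val\<^esub>"
    proof (rule bexI[of _ "\<lambda>n. - x n"])
      show "(\<lambda>n. - x n) \<in> carrier (cauchy_ring val)"
        using x unfolding carrier_cauchy_ring by (simp add: hom_uminus convergent_minus_iff[symmetric])
    qed (simp add: cauchy_ring_def)
  next
    fix x y assume "x \<in> carrier (cauchy_ring val)" "y \<in> carrier (cauchy_ring val)"
    then have "(\<lambda>n. x n + y n) \<in> carrier (cauchy_ring val)"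
      unfolding carrier_cauchy_ring by (simp add: hom_add convergent_add)
    then show "x \<oplus>\<^bsub>cauchy_ring val\<^esub> y \<in> carrier (cauchy_ring val)" by (simp add: cauchy_ring_def)
  next
    have "(\<lambda>n. 0) \<in> carrier (cauchy_ring val)"
      unfolding carrier_cauchy_ring by (simp add: convergent_const)
    then show "\<zero>\<^bsub>cauchy_ring val\<^esub> \<in> carrier (cauchy_ring val)" by (simp add: cauchy_ring_def)
  qed (auto simp: cauchy_ring_def add_ac)
next
  show "comm_monoid (cauchy_ring val)"
  proof (rule comm_monoidI)
    fix x y assume "x \<in> carrier (cauchy_ring val)" "y \<in> carrier (cauchy_ring val)"
    then have "(\<lambda>n. x n * y n) \<in> carrier (cauchy_ring val)"
      unfolding carrier_cauchy_ring by (simp add: hom_mult convergent_mult)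
    then show "x \<otimes>\<^bsub>cauchy_ring val\<^esub> y \<in> carrier (cauchy_ring val)" by (simp add: cauchy_ring_def)
  next
    have "(\<lambda>n. 1) \<in> carrier (cauchy_ring val)"
      unfolding carrier_cauchy_ring by (simp add: convergent_const)
    then show "\<one>\<^bsub>cauchy_ring val\<^esub> \<in> carrier (cauchy_ring val)" by (simp add: cauchy_ring_def)
  qed (auto simp: cauchy_ring_def mult_ac)
qed (auto simp: cauchy_ring_def algebra_simps)

lemma null_subset: "null_sequences val \<subseteq> carrier (cauchy_ring val)"
  unfolding null_sequences_eq carrier_cauchy_ring by (auto simp: convergent_def)

lemma ideal_null_sequences: "ideal (null_sequences val) (cauchy_ring val)"
proof (rule idealI)
  interpret R: cring "cauchy_ring val" by (rule ring_cauchy_ring)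
  show "ring (cauchy_ring val)" by (rule R.ring_axioms)
  show "subgroup (null_sequences val) (add_monoid (cauchy_ring val))"
  proof (rule R.add.subgroupI)
    show "null_sequences val \<subseteq> carrier (cauchy_ring val)" by (rule null_subset)
    have "(\<lambda>n. 0) \<in> null_sequences val" by (simp add: null_sequences_eq)
    then show "null_sequences val \<noteq> {}" by blast
  next
    fix x assume x: "x \<in> null_sequences val"
    have neg: "(\<lambda>n. - x n) \<in> null_sequences val"
      using x tendsto_minus[of "\<lambda>n. \<sigma> (x n)" 0 sequentially] unfolding null_sequences_eq by (simp add: hom_uminus)
    have "(\<lambda>n. - x n) \<oplus>\<^bsub>cauchy_ring val\<^esub> x = \<zero>\<^bsub>cauchy_ring val\<^esub>" by (simp add: cauchy_ring_def)
    then have "\<ominus>\<^bsub>cauchy_ring val\<^esub> x = (\<lambda>n. - x n)"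
      using R.minus_equality[of "\<lambda>n. - x n" x] x neg null_subset by auto
    then show "\<ominus>\<^bsub>cauchy_ring val\<^esub> x \<in> null_sequences val" using neg by simp
  next
    fix x y assume "x \<in> null_sequences val" "y \<in> null_sequences val"
    then show "x \<oplus>\<^bsub>cauchy_ring val\<^esub> y \<in> null_sequences val"
      using tendsto_add[of "\<lambda>n. \<sigma> (x n)" 0 sequentially "\<lambda>n. \<sigma> (y n)" 0]
      unfolding null_sequences_eq by (simp add: cauchy_ring_def hom_add)
  qed
  fix a x assume a: "a \<in> null_sequences val" and x: "x \<in> carrier (cauchy_ring val)"
  obtain l where l: "(\<lambda>n. \<sigma> (x n)) \<longlonglongrightarrow> l" using x by (auto simp: carrier_cauchy_ring convergent_def)
  have "(\<lambda>n. \<sigma> (x n * a n)) \<longlonglongrightarrow> 0"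
    using tendsto_mult[OF l, of "\<lambda>n. \<sigma> (a n)" 0] a unfolding null_sequences_eq by (simp add: hom_mult)
  then show "x \<otimes>\<^bsub>cauchy_ring val\<^esub> a \<in> null_sequences val" "a \<otimes>\<^bsub>cauchy_ring val\<^esub> x \<in> null_sequences val"
    unfolding null_sequences_eq by (simp_all add: cauchy_ring_def mult.commute)
qed

text \<open>The coset of null sequences with limit \<open>l\<close>, or the empty set when
  \<open>l\<close> is no limit of images. Hence the lemmas on it ask for a sequence converging to
  the point in question.\<close>

definition lim_class :: "complex \<Rightarrow> (nat \<Rightarrow> 'a) set" where
  "lim_class l = {x. (\<lambda>n. \<sigma> (x n)) \<longlonglongrightarrow> l}"

lemma null_coset:
  assumes "(\<lambda>n. \<sigma> (x n)) \<longlonglongrightarrow> l"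
  shows "null_sequences val +>\<^bsub>cauchy_ring val\<^esub> x = lim_class l"
proof (intro equalityI subsetI)
  fix y assume "y \<in> null_sequences val +>\<^bsub>cauchy_ring val\<^esub> x"
  then obtain h where h: "h \<in> null_sequences val" "y = (\<lambda>n. h n + x n)"
    by (auto simp: a_r_coset_def' cauchy_ring_def)
  then show "y \<in> lim_class l"
    using tendsto_add[OF _ assms, of "\<lambda>n. \<sigma> (h n)" 0] by (simp add: lim_class_def null_sequences_eq hom_add)
next
  fix y assume "y \<in> lim_class l"
  then have "(\<lambda>n. y n - x n) \<in> null_sequences val"
    using tendsto_diff[OF _ assms, of "\<lambda>n. \<sigma> (y n)" l] by (simp add: lim_class_def null_sequences_eq hom_minus)
  moreover have "y = (\<lambda>n. y n - x n) \<oplus>\<^bsub>cauchy_ring val\<^esub> x" by (simp add: cauchy_ring_def)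
  ultimately show "y \<in> null_sequences val +>\<^bsub>cauchy_ring val\<^esub> x"
    unfolding a_r_coset_def' by blast
qed

lemma carrier_completion: "carrier (completion val) = lim_class ` {l. \<exists>x. (\<lambda>n. \<sigma> (x n)) \<longlonglongrightarrow> l}"
proof -
  have "carrier (completion val) = (\<lambda>x. null_sequences val +>\<^bsub>cauchy_ring val\<^esub> x) ` {x. convergent (\<lambda>n. \<sigma> (x n))}"
    unfolding carrier_cauchy_ring[symmetric] by (auto simp: Defs.completion_def FactRing_def A_RCOSETS_def')
  also have "\<dots> = lim_class ` {l. \<exists>x. (\<lambda>n. \<sigma> (x n)) \<longlonglongrightarrow> l}"
    using null_coset by (force simp: convergent_def image_iff)
  finally show ?thesis .
qed

lemma rat_approx:
  fixes r :: real
  obtains q :: "nat \<Rightarrow> rat" where "(\<lambda>n. complex_of_rat (q n)) \<longlonglongrightarrow> of_real r"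
proof -
  have "\<exists>q. \<bar>real_of_rat q - r\<bar> < inverse (real (Suc n))" for n
  proof -
    obtain q where "r < of_rat q" "of_rat q < r + inverse (real (Suc n))"
      using of_rat_dense[of r "r + inverse (real (Suc n))"] by auto
    then show ?thesis by (intro exI[of _ q]) auto
  qed
  then obtain q where q: "\<And>n. \<bar>real_of_rat (q n) - r\<bar> < inverse (real (Suc n))" by metis
  have "(\<lambda>n. real_of_rat (q n)) \<longlonglongrightarrow> r"
    by (rule LIM_zero_cancel, rule Lim_null_comparison[OF _ LIMSEQ_inverse_real_of_nat])
      (use q in \<open>auto intro!: always_eventually intro: less_imp_le\<close>)
  then have "(\<lambda>n. complex_of_real (real_of_rat (q n))) \<longlonglongrightarrow> of_real r" by (rule tendsto_of_real)
  moreover have "complex_of_real (real_of_rat p) = of_rat p" for p by (cases p) (simp add: of_rat_rat)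
  ultimately show ?thesis using that by simp
qed

lemma hom_rat: "\<sigma> (of_rat q) = of_rat q"
  by (rule field_hom_of_rat) (rule field_hom_axioms)

lemma rat_completion_eq: "rat_completion val = lim_class ` \<real>"
proof (intro equalityI subsetI)
  fix C assume "C \<in> rat_completion val"
  then obtain x where x: "C = null_sequences val +>\<^bsub>cauchy_ring val\<^esub> x" "convergent (\<lambda>n. \<sigma> (x n))" "range x \<subseteq> \<rat>"
    unfolding rat_completion_def carrier_cauchy_ring by blast
  obtain l where l: "(\<lambda>n. \<sigma> (x n)) \<longlonglongrightarrow> l" using x(2) by (auto simp: convergent_def)
  have "\<sigma> (x n) \<in> \<real>" for n
  proof -
    obtain q where "x n = of_rat q" using x(3) by (auto simp: Rats_def)
    moreover have "complex_of_rat q \<in> \<real>" by (cases q) (simp add: of_rat_rat)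
    ultimately show ?thesis by (simp add: hom_rat)
  qed
  then have "l \<in> \<real>" using l closed_sequentially[OF closed_complex_Reals, of "\<lambda>n. \<sigma> (x n)" l] by blast
  then show "C \<in> lim_class ` \<real>" using x(1) null_coset[OF l] by blast
next
  fix C assume "C \<in> lim_class ` \<real>"
  then obtain r where r: "C = lim_class (of_real r)" by (auto elim: Reals_cases)
  obtain q where q: "(\<lambda>n. complex_of_rat (q n)) \<longlonglongrightarrow> of_real r" by (rule rat_approx)
  then have "(\<lambda>n. \<sigma> (of_rat (q n))) \<longlonglongrightarrow> of_real r" by (simp add: hom_rat)
  then have "C = null_sequences val +>\<^bsub>cauchy_ring val\<^esub> (\<lambda>n. of_rat (q n))" "(\<lambda>n. of_rat (q n)) \<in> carrier (cauchy_ring val)"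
    using null_coset[of "\<lambda>n. of_rat (q n)" "of_real r"] r unfolding carrier_cauchy_ring convergent_def
    by blast+
  then show "C \<in> rat_completion val"
    unfolding rat_completion_def by (intro CollectI exI[of _ "\<lambda>n. of_rat (q n)"]) auto
qed

lemma lim_class_ops:
  assumes x: "(\<lambda>n. \<sigma> (x n)) \<longlonglongrightarrow> a" and y: "(\<lambda>n. \<sigma> (y n)) \<longlonglongrightarrow> b"
  shows "lim_class a \<otimes>\<^bsub>completion val\<^esub> lim_class b = lim_class (a * b)"
    and "lim_class a \<oplus>\<^bsub>completion val\<^esub> lim_class b = lim_class (a + b)"
proof -
  interpret N: ideal "null_sequences val" "cauchy_ring val" by (rule ideal_null_sequences)
  have c: "x \<in> carrier (cauchy_ring val)" "y \<in> carrier (cauchy_ring val)"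
    using x y by (auto simp: carrier_cauchy_ring convergent_def)
  have "(\<lambda>n. \<sigma> ((x \<otimes>\<^bsub>cauchy_ring val\<^esub> y) n)) \<longlonglongrightarrow> a * b"
    using tendsto_mult[OF x y] by (simp add: cauchy_ring_def hom_mult)
  then show "lim_class a \<otimes>\<^bsub>completion val\<^esub> lim_class b = lim_class (a * b)"
    unfolding null_coset[OF x, symmetric] null_coset[OF y, symmetric]
    using N.rcoset_mult_add[OF c] null_coset by (simp add: Defs.completion_def FactRing_def)
  have "(\<lambda>n. \<sigma> ((x \<oplus>\<^bsub>cauchy_ring val\<^esub> y) n)) \<longlonglongrightarrow> a + b"
    using tendsto_add[OF x y] by (simp add: cauchy_ring_def hom_add)
  then show "lim_class a \<oplus>\<^bsub>completion val\<^esub> lim_class b = lim_class (a + b)"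
    unfolding null_coset[OF x, symmetric] null_coset[OF y, symmetric]
    using N.a_rcos_sum[OF c] null_coset by (simp add: Defs.completion_def FactRing_def)
qed

lemma lim_class_one: "\<one>\<^bsub>completion val\<^esub> = lim_class 1"
  using null_coset[of "\<lambda>n. 1" 1] by (simp add: Defs.completion_def FactRing_def cauchy_ring_def)

lemma lim_class_zero: "\<zero>\<^bsub>completion val\<^esub> = lim_class 0"
  by (simp add: Defs.completion_def FactRing_def lim_class_def null_sequences_eq)

lemma lim_class_eq_iff:
  assumes "(\<lambda>n. \<sigma> (x n)) \<longlonglongrightarrow> a"
  shows "lim_class a = lim_class b \<longleftrightarrow> a = b"
proof
  assume "lim_class a = lim_class b"
  then have "x \<in> lim_class b" using assms by (auto simp: lim_class_def)
  then show "a = b" using LIMSEQ_unique[OF assms] by (simp add: lim_class_def)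
qed simp

lemma ring_completion: "ring (completion val)"
  unfolding Defs.completion_def by (rule ideal.quotient_is_ring[OF ideal_null_sequences])

lemma real_is_limit: "\<exists>x. (\<lambda>n. \<sigma> (x n)) \<longlonglongrightarrow> of_real r"
proof -
  obtain q where q: "(\<lambda>n. complex_of_rat (q n)) \<longlonglongrightarrow> of_real r" by (rule rat_approx)
  then have "(\<lambda>n. \<sigma> (of_rat (q n))) \<longlonglongrightarrow> of_real r" by (simp add: hom_rat)
  then show ?thesis by (rule exI[of _ "\<lambda>n. of_rat (q n)"])
qed

lemma one_neq_zero_completion: "\<one>\<^bsub>completion val\<^esub> \<noteq> \<zero>\<^bsub>completion val\<^esub>"
proof -
  obtain x where "(\<lambda>n. \<sigma> (x n)) \<longlonglongrightarrow> of_real 1" using real_is_limit[of 1] by blast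
  then show ?thesis unfolding lim_class_one lim_class_zero using lim_class_eq_iff[of x 1 0] by simp
qed

text \<open>The isomorphism \<open>h\<close> from the reals has both the completion and the
  completed rationals as its image, so dimension one is transported from the reals over
  themselves.\<close>

lemma local_degree_real:
  assumes real: "\<And>x. \<sigma> x \<in> \<real>"
  shows "local_degree val = 1"
proof -
  let ?R = "ring_of_type_algebra :: real ring"
  have F: "field ?R" by (rule field_from_type_algebra)
  interpret R: field ?R by (rule F)
  interpret C: ring "completion val" by (rule ring_completion)
  define h where "h r = lim_class (complex_of_real r)" for r
  have L: "{l. \<exists>x. (\<lambda>n. \<sigma> (x n)) \<longlonglongrightarrow> l} = \<real>"
  proof (intro equalityI subsetI)
    fix l assume "l \<in> {l. \<exists>x. (\<lambda>n. \<sigma> (x n)) \<longlonglongrightarrow> l}"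
    then obtain x where "(\<lambda>n. \<sigma> (x n)) \<longlonglongrightarrow> l" by blast
    then show "l \<in> \<real>" using closed_sequentially[OF closed_complex_Reals, of "\<lambda>n. \<sigma> (x n)" l] real by blast
  next
    fix l :: complex assume "l \<in> \<real>"
    then show "l \<in> {l. \<exists>x. (\<lambda>n. \<sigma> (x n)) \<longlonglongrightarrow> l}" using real_is_limit by (auto elim!: Reals_cases)
  qed
  have img: "h ` UNIV = carrier (completion val)" "h ` UNIV = rat_completion val"
    unfolding carrier_completion L rat_completion_eq by (auto simp: h_def Reals_def)
  have hom: "h \<in> Ring.ring_hom ?R (completion val)"
  proof (rule ring_hom_memI)
    fix r s :: real
    obtain x y where xy: "(\<lambda>n. \<sigma> (x n)) \<longlonglongrightarrow> of_real r" "(\<lambda>n. \<sigma> (y n)) \<longlonglongrightarrow> of_real s"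
      using real_is_limit by blast
    show "h r \<in> carrier (completion val)" using img by blast
    show "h (r \<otimes>\<^bsub>?R\<^esub> s) = h r \<otimes>\<^bsub>completion val\<^esub> h s" "h (r \<oplus>\<^bsub>?R\<^esub> s) = h r \<oplus>\<^bsub>completion val\<^esub> h s"
      using lim_class_ops[OF xy] by (simp_all add: h_def ring_of_type_algebra_def)
  qed (simp add: h_def lim_class_one ring_of_type_algebra_def)
  interpret H: ring_hom_ring ?R "completion val" h
    by (rule ring_hom_ringI2[OF R.ring_axioms ring_completion hom])
  have sf: "subfield UNIV ?R" using R.carrier_is_subfield by (simp add: ring_of_type_algebra_def)
  have inj: "inj_on h UNIV"
    by (rule injI) (metis h_def lim_class_eq_iff of_real_eq_iff real_is_limit)
  have "R.dimension 1 UNIV UNIV" using R.dimension_one[OF sf] .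
  from H.inj_hom_dimension[OF sf one_neq_zero_completion inj this]
  have "C.dimension 1 (rat_completion val) (carrier (completion val))" using img by simp
  moreover have "subfield (rat_completion val) (completion val)"
    using H.img_is_subfield(2)[OF sf one_neq_zero_completion] img by simp
  ultimately have "(C.dim over rat_completion val) (carrier (completion val)) = 1" by (intro C.dimI)
  then show ?thesis by (simp add: local_degree_def over_def)
qed

text \<open>Here the completion is the image of all complex numbers and the base field is the image
  of the reals, so dimension two is transported.\<close>

lemma local_degree_complex:
  assumes "\<sigma> x0 \<notin> \<real>"
  shows "local_degree val = 2"
proof -
  let ?C = "ring_of_type_algebra :: complex ring" and ?R = "ring_of_type_algebra :: real ring"
  interpret R: field ?R by (rule field_from_type_algebra)
  interpret Z: field ?C by (rule field_from_type_algebra)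
  interpret C: ring "completion val" by (rule ring_completion)
  \<comment> \<open>The non-real value \<open>\<sigma> x0\<close> and 1 form a real basis of the
    complex numbers, and real coefficients are limits of rationals.\<close>
  have lim: "\<exists>x. (\<lambda>n. \<sigma> (x n)) \<longlonglongrightarrow> l" for l
  proof -
    have im: "Im (\<sigma> x0) \<noteq> 0" using assms by (simp add: complex_is_Real_iff)
    define s where "s = Im l / Im (\<sigma> x0)"
    define r where "r = Re l - s * Re (\<sigma> x0)"
    have l: "l = of_real r + of_real s * \<sigma> x0" using im by (simp add: complex_eq_iff r_def s_def)
    obtain x y where xy: "(\<lambda>n. \<sigma> (x n)) \<longlonglongrightarrow> of_real r" "(\<lambda>n. \<sigma> (y n)) \<longlonglongrightarrow> of_real s"
      using real_is_limit by blast
    have "(\<lambda>n. \<sigma> (x n + y n * x0)) \<longlonglongrightarrow> l"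
      unfolding l hom_add hom_mult by (intro tendsto_intros xy)
    then show ?thesis by (rule exI[of _ "\<lambda>n. x n + y n * x0"])
  qed
  have img: "lim_class ` UNIV = carrier (completion val)" unfolding carrier_completion using lim by simp
  have hom: "lim_class \<in> Ring.ring_hom ?C (completion val)"
  proof (rule ring_hom_memI)
    fix r s :: complex
    obtain x y where xy: "(\<lambda>n. \<sigma> (x n)) \<longlonglongrightarrow> r" "(\<lambda>n. \<sigma> (y n)) \<longlonglongrightarrow> s" using lim by metis
    show "lim_class r \<in> carrier (completion val)" using img by blast
    show "lim_class (r \<otimes>\<^bsub>?C\<^esub> s) = lim_class r \<otimes>\<^bsub>completion val\<^esub> lim_class s"
      "lim_class (r \<oplus>\<^bsub>?C\<^esub> s) = lim_class r \<oplus>\<^bsub>completion val\<^esub> lim_class s"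
      using lim_class_ops[OF xy] by (simp_all add: ring_of_type_algebra_def)
  qed (simp add: lim_class_one ring_of_type_algebra_def)
  interpret H: ring_hom_ring ?C "completion val" lim_class
    by (rule ring_hom_ringI2[OF Z.ring_axioms ring_completion hom])
  have hom': "complex_of_real \<in> Ring.ring_hom ?R ?C"
    by (rule ring_hom_memI) (simp_all add: ring_of_type_algebra_def)
  interpret H': ring_hom_ring ?R ?C complex_of_real
    by (rule ring_hom_ringI2[OF R.ring_axioms Z.ring_axioms hom'])
  have sf: "subfield \<real> ?C"
  proof -
    have "subfield UNIV ?R" using R.carrier_is_subfield by (simp add: ring_of_type_algebra_def)
    from H'.img_is_subfield(2)[OF this] show ?thesis by (simp add: ring_of_type_algebra_def Reals_def)
  qed
  \<comment> \<open>The complex numbers are built as the extension of the real line by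
    \<open>\<i>\<close>, which is not real, so the dimension grows from 1 to 2.\<close>
  have "Z.dimension (Suc 1) \<real> (Z.line_extension \<real> \<i> \<real>)"
    by (rule Z.Suc_dim) (use Z.dimension_one[OF sf] in \<open>auto simp: ring_of_type_algebra_def complex_is_Real_iff\<close>)
  moreover have "Z.line_extension \<real> \<i> \<real> = UNIV"
  proof (intro equalityI subsetI UNIV_I)
    fix z :: complex
    have "z = of_real (Im z) * \<i> + of_real (Re z)" by (simp add: complex_eq_iff)
    then show "z \<in> Z.line_extension \<real> \<i> \<real>"
      unfolding Z.line_extension_mem_iff by (force simp: ring_of_type_algebra_def)
  qed
  ultimately have "Z.dimension 2 \<real> UNIV" by (simp add: numeral_2_eq_2)
  moreover have inj: "inj_on lim_class UNIV"
    by (rule injI) (metis lim_class_eq_iff lim)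
  ultimately have "C.dimension 2 (rat_completion val) (carrier (completion val))"
    using H.inj_hom_dimension[OF sf one_neq_zero_completion] img rat_completion_eq by metis
  moreover have "subfield (rat_completion val) (completion val)"
    using H.img_is_subfield(2)[OF sf one_neq_zero_completion] rat_completion_eq by simp
  ultimately have "(C.dim over rat_completion val) (carrier (completion val)) = 2" by (intro C.dimI)
  then show ?thesis by (simp add: local_degree_def over_def)
qed

end

text \<open>Integrality confines the product to archimedean places. The local degree of such a place
  is at most the number of embeddings inducing it: one exists if they are real, and \<sigma> and its
  conjugate are two otherwise. These fibres are disjoint, so the local degrees have sum at most
  d.\<close>

lemma weil_height_algebraic_int_le:
  fixes \<alpha> :: "'a::field_char_0"
  assumes K: "number_field TYPE('a)" and \<alpha>: "algebraic_int \<alpha>"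
    and B: "B \<ge> 1" "\<And>\<sigma> :: 'a emb. cmod (Rep_emb \<sigma> \<alpha>) \<le> B"
  shows "weil_height \<alpha> \<le> B"
proof -
  define S where "S = {v. v \<in> places \<and> v \<alpha> > 1}"
  define w where "w \<sigma> = (\<lambda>x. cmod (Rep_emb (\<sigma> :: 'a emb) x))" for \<sigma>
  let ?d = "number_field_degree TYPE('a)"
  have arch: "\<exists>\<sigma>. v = w \<sigma>" if v: "v \<in> S" for v
  proof -
    have av: "absolute_value v" using v by (simp add: S_def places_def)
    consider "\<forall>q. v (of_rat q) = \<bar>of_rat q\<bar>" | p where "prime p" "\<forall>q. v (of_rat q) = padic_abs p q"
      using v by (auto simp: S_def places_def)
    then show ?thesis
    proof cases
      case 1
      obtain \<sigma> where "v = (\<lambda>x. cmod (Rep_emb \<sigma> x))"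
        using archimedean_place_is_embedding[OF K av] 1 by blast
      then show ?thesis by (auto simp: w_def)
    next
      case 2
      have "v (of_int k) \<le> 1" for k
        using 2(2)[rule_format, of "of_int k"] padic_abs_of_int_le_1[OF 2(1), of k] by simp
      from nonarchimedean_le_1[OF K av this \<alpha>] show ?thesis using v by (simp add: S_def)
    qed
  qed
  then have "S \<subseteq> range w" by auto
  then have fS: "finite S" by (rule finite_subset) simp
  define E where "E v = {\<sigma>. w \<sigma> = v}" for v
  have deg: "local_degree v \<le> card (E v)" if v: "v \<in> S" for v
  proof -
    obtain \<sigma> where \<sigma>: "v = w \<sigma>" using arch[OF v] by blast
    interpret complex_embedding "Rep_emb \<sigma>"
      unfolding complex_embedding_def by (rule Rep_emb_hom[OF K])
    have ld: "local_degree v = local_degree (\<lambda>x. cmod (Rep_emb \<sigma> x))" by (simp add: \<sigma> w_def)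
    show ?thesis
    proof (cases "\<forall>x. Rep_emb \<sigma> x \<in> \<real>")
      case True
      then have "local_degree v = 1" unfolding ld by (intro local_degree_real) blast
      moreover have "E v \<noteq> {}" using \<sigma> by (auto simp: E_def)
      ultimately show ?thesis by (simp add: Suc_le_eq card_gt_0_iff)
    next
      case False
      then obtain x where x: "Rep_emb \<sigma> x \<notin> \<real>" by blast
      then have "local_degree v = 2" unfolding ld by (rule local_degree_complex)
      moreover have "{\<sigma>, emb_cnj \<sigma>} \<subseteq> E v" by (auto simp: E_def \<sigma> w_def Rep_emb_cnj[OF K])
      moreover have "\<sigma> \<noteq> emb_cnj \<sigma>"
      proof
        assume "\<sigma> = emb_cnj \<sigma>"
        then have "Rep_emb \<sigma> x = cnj (Rep_emb \<sigma> x)" using Rep_emb_cnj[OF K, of \<sigma>] by (metis comp_apply)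
        then show False using x by (metis Reals_cnj_iff)
      qed
      ultimately show ?thesis using card_mono[of "E v" "{\<sigma>, emb_cnj \<sigma>}"] by simp
    qed
  qed
  have "(\<Sum>v\<in>S. local_degree v) \<le> (\<Sum>v\<in>S. card (E v))" by (rule sum_mono) (rule deg)
  also have "\<dots> = card (\<Union>v\<in>S. E v)"
    using fS by (intro card_UN_disjoint[symmetric]) (auto simp: E_def)
  also have "\<dots> \<le> CARD('a emb)" by (rule card_mono) auto
  finally have sum_le: "(\<Sum>v\<in>S. local_degree v) \<le> ?d" by (simp add: card_emb[OF K])
  have d0: "?d > 0" by (rule number_field_degree_pos[OF K])
  have "weil_height \<alpha> = (\<Prod>v\<in>S. max 1 (v \<alpha>) powr (real (local_degree v) / real ?d))"
    by (simp add: weil_height_def S_def)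
  also have "\<dots> \<le> (\<Prod>v\<in>S. B powr (real (local_degree v) / real ?d))"
  proof (intro prod_mono conjI powr_mono2)
    fix v assume "v \<in> S"
    then obtain \<sigma> where "v = w \<sigma>" using arch by blast
    then show "max 1 (v \<alpha>) \<le> B" using B by (simp add: w_def)
  qed auto
  also have "\<dots> = B powr (\<Sum>v\<in>S. real (local_degree v) / real ?d)"
    using B(1) fS by (simp add: powr_sum)
  \<comment> \<open>Places with \<open>v \<alpha> \<le> 1\<close> are absent from \<open>S\<close>,
    so the exponents may sum to less than 1; \<open>B \<ge> 1\<close> turns this into an upper
    bound.\<close>
  also have "\<dots> \<le> B powr 1"
  proof (rule powr_mono)
    have "(\<Sum>v\<in>S. real (local_degree v) / real ?d) = real (\<Sum>v\<in>S. local_degree v) / real ?d"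
      by (simp add: sum_divide_distrib)
    also have "\<dots> \<le> 1" using sum_le d0 by (simp del: of_nat_sum)
    finally show "(\<Sum>v\<in>S. real (local_degree v) / real ?d) \<le> 1" .
  qed (rule B(1))
  finally show ?thesis using B(1) by simp
qed

section \<open>Ideal norms\<close>

lemma cring_ring_of_integers: "cring (ring_of_integers :: 'a::field_char_0 ring)"
proof (rule cringI)
  show "abelian_group (ring_of_integers :: 'a ring)"
  proof (rule abelian_groupI)
    fix x :: 'a assume "x \<in> carrier ring_of_integers"
    then show "\<exists>y\<in>carrier ring_of_integers. y \<oplus>\<^bsub>ring_of_integers\<^esub> x = \<zero>\<^bsub>ring_of_integers\<^esub>"
      by (intro bexI[of _ "- x"]) (auto simp: ring_of_integers_def)
  qed (auto simp: ring_of_integers_def algebraic_int_add add_ac)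
  show "comm_monoid (ring_of_integers :: 'a ring)"
    by (rule comm_monoidI) (auto simp: ring_of_integers_def algebraic_int_mult algebraic_int_one mult_ac)
qed (auto simp: ring_of_integers_def algebra_simps)

lemma ideal_imp_int_ideal:
  fixes I :: "'a::field_char_0 set"
  assumes "ideal I ring_of_integers" shows "int_ideal I"
proof -
  interpret I: ideal I ring_of_integers by fact
  show ?thesis
    unfolding int_ideal_def
  proof (intro conjI ballI allI impI)
    show "I \<subseteq> {x. algebraic_int x}" using I.a_subset by (simp add: ring_of_integers_def)
    show "0 \<in> I" using additive_subgroup.zero_closed[OF ideal.axioms(1)[OF assms]]
      by (simp add: ring_of_integers_def)
    show "x + y \<in> I" if "x \<in> I" "y \<in> I" for x y
      using additive_subgroup.a_closed[OF ideal.axioms(1)[OF assms] that] by (simp add: ring_of_integers_def)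
    show "a * x \<in> I" if "x \<in> I" "algebraic_int a" for a x
      using I.I_l_closed[OF that(1), of a] that(2) by (simp add: ring_of_integers_def)
  qed
qed

lemma carrier_quotient_integers:
  "carrier (ring_of_integers Quot I) = (\<lambda>x. (\<lambda>h. h + x) ` I) ` {x :: 'a::field_char_0. algebraic_int x}"
  by (auto simp: FactRing_def A_RCOSETS_def' a_r_coset_def' ring_of_integers_def)

lemma coset_eq:
  fixes I :: "'a::field_char_0 set"
  assumes "int_ideal I" "x - y \<in> I"
  shows "(\<lambda>h. h + x) ` I = (\<lambda>h. h + y) ` I"
proof -
  have sub: "(\<lambda>h. h + x) ` I \<subseteq> (\<lambda>h. h + y) ` I" if "x - y \<in> I" for x y
  proof
    fix z assume "z \<in> (\<lambda>h. h + x) ` I"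
    then obtain h where "h \<in> I" "z = h + x" by blast
    then show "z \<in> (\<lambda>h. h + y) ` I"
      using int_idealD(3)[OF assms(1) _ that] by (intro image_eqI[of _ _ "h + (x - y)"]) auto
  qed
  have "y - x \<in> I" using int_idealD(6)[OF assms(1) int_idealD(2)[OF assms(1)] assms(2)] by simp
  then show ?thesis using sub assms(2) by blast
qed

lemma finite_quotient:
  fixes I :: "'a::field_char_0 set"
  assumes K: "number_field TYPE('a)" and I: "int_ideal I" "I \<noteq> {0}"
  shows "finite (carrier (ring_of_integers Quot I))"
proof -
  obtain m :: int where m: "m > 0" "of_int m \<in> I" by (rule int_ideal_contains_integer[OF K I])
  obtain F :: "'a set" where F: "finite F"
    "\<forall>x. algebraic_int x \<longrightarrow> (\<exists>r\<in>F. \<exists>y. algebraic_int y \<and> x = r + of_int m * y)"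
    by (rule finite_residues[OF K m(1)])
  have "carrier (ring_of_integers Quot I) \<subseteq> (\<lambda>x. (\<lambda>h. h + x) ` I) ` F"
  proof
    fix C assume "C \<in> carrier (ring_of_integers Quot I)"
    then obtain x where x: "algebraic_int x" "C = (\<lambda>h. h + x) ` I"
      unfolding carrier_quotient_integers by blast
    obtain r y where r: "r \<in> F" "algebraic_int y" "x = r + of_int m * y" using F(2) x(1) by blast
    have "x - r \<in> I" using int_idealD(5)[OF I(1) r(2) m(2)] r(3) by simp
    then show "C \<in> (\<lambda>x. (\<lambda>h. h + x) ` I) ` F" using r(1) coset_eq[OF I(1)] x(2) by blast
  qed
  then show ?thesis using F(1) finite_subset by blast
qed

lemma ideal_norm_pos:
  fixes I :: "'a::field_char_0 set"
  assumes "number_field TYPE('a)" "int_ideal I" "I \<noteq> {0}"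
  shows "ideal_norm I > 0"
proof -
  have "carrier (ring_of_integers Quot I) \<noteq> {}" unfolding carrier_quotient_integers by auto
  then show ?thesis using finite_quotient[OF assms] by (simp add: ideal_norm_def card_gt_0_iff)
qed

text \<open>The natural map from O / J onto O / I, written on cosets: a coset of \<open>J\<close>
  goes to the union of the cosets of \<open>I\<close> of its members, which all coincide.\<close>

lemma ideal_norm_mono:
  fixes I J :: "'a::field_char_0 set"
  assumes K: "number_field TYPE('a)" and I: "int_ideal I" and J: "int_ideal J" "J \<noteq> {0}" and JI: "J \<subseteq> I"
  shows "ideal_norm I \<le> ideal_norm J"
proof -
  have "carrier (ring_of_integers Quot I) \<subseteq> (\<lambda>C. \<Union>y\<in>C. (\<lambda>h. h + y) ` I) ` carrier (ring_of_integers Quot J)"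
  proof
    fix C assume "C \<in> carrier (ring_of_integers Quot I)"
    then obtain x where x: "algebraic_int x" "C = (\<lambda>h. h + x) ` I"
      unfolding carrier_quotient_integers by blast
    have "(\<lambda>h. h + y) ` I = C" if "y \<in> (\<lambda>h. h + x) ` J" for y
      using that JI by (auto simp: x(2) intro!: coset_eq[OF I])
    moreover have "(\<lambda>h. h + x) ` J \<noteq> {}" using int_idealD(2)[OF J(1)] by blast
    ultimately have "C = (\<Union>y\<in>(\<lambda>h. h + x) ` J. (\<lambda>h. h + y) ` I)" by blast
    then show "C \<in> (\<lambda>C. \<Union>y\<in>C. (\<lambda>h. h + y) ` I) ` carrier (ring_of_integers Quot J)"
      unfolding carrier_quotient_integers using x(1) by blast
  qed
  then have "card (carrier (ring_of_integers Quot I)) \<le>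
      card ((\<lambda>C. \<Union>y\<in>C. (\<lambda>h. h + y) ` I) ` carrier (ring_of_integers Quot J))"
    using finite_quotient[OF K J] by (intro card_mono) auto
  also have "\<dots> \<le> card (carrier (ring_of_integers Quot J))"
    by (rule card_image_le[OF finite_quotient[OF K J]])
  finally show ?thesis by (simp add: ideal_norm_def)
qed

text \<open>Lagrange's theorem in the additive group of O / I: its order kills the class of
  1.\<close>

lemma ideal_norm_mem:
  fixes I :: "'a::field_char_0 set"
  assumes K: "number_field TYPE('a)" and I: "ideal I ring_of_integers" "I \<noteq> {0}"
  shows "of_nat (ideal_norm I) \<in> I"
proof -
  interpret I: ideal I ring_of_integers by (rule I(1))
  have ii: "int_ideal I" by (rule ideal_imp_int_ideal[OF I(1)])
  let ?Q = "ring_of_integers Quot I"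
  interpret Q: ring ?Q by (rule I.quotient_is_ring)
  let ?c = "\<lambda>n :: nat. I +>\<^bsub>ring_of_integers\<^esub> of_nat n"
  have cO: "of_nat n \<in> carrier (ring_of_integers :: 'a ring)" for n
    by (simp add: ring_of_integers_def algebraic_int_of_nat)
  have c: "?c n \<in> carrier ?Q" for n
    using cO by (auto simp: FactRing_def A_RCOSETS_def')
  have pow: "?c 1 [^]\<^bsub>add_monoid ?Q\<^esub> n = ?c n" for n :: nat
  proof (induction n)
    case 0
    have "I +>\<^bsub>ring_of_integers\<^esub> 0 = I" by (simp add: a_r_coset_def' ring_of_integers_def)
    then show ?case by (simp add: FactRing_def)
  next
    case (Suc n)
    have "?c 1 [^]\<^bsub>add_monoid ?Q\<^esub> Suc n = ?c 1 [^]\<^bsub>add_monoid ?Q\<^esub> n \<otimes>\<^bsub>add_monoid ?Q\<^esub> ?c 1"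
      by (rule nat_pow_Suc)
    also have "\<dots> = ?c n \<oplus>\<^bsub>?Q\<^esub> ?c 1" unfolding Suc.IH by simp
    also have "\<dots> = I +>\<^bsub>ring_of_integers\<^esub> (of_nat n \<oplus>\<^bsub>ring_of_integers\<^esub> of_nat 1)"
      using I.a_rcos_sum[OF cO[of n] cO[of 1]] by (simp add: FactRing_def)
    finally show ?case by (simp add: ring_of_integers_def add.commute)
  qed
  have "?c 1 [^]\<^bsub>add_monoid ?Q\<^esub> Coset.order (add_monoid ?Q) = \<one>\<^bsub>add_monoid ?Q\<^esub>"
    using c[of 1] group.pow_order_eq_1[OF Q.add.is_group, of "?c 1"] by simp
  moreover have "Coset.order (add_monoid ?Q) = ideal_norm I" by (simp add: Coset.order_def ideal_norm_def)
  ultimately have "?c (ideal_norm I) = I" unfolding pow by (simp add: FactRing_def)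
  moreover have "of_nat (ideal_norm I) \<in> ?c (ideal_norm I)"
    using int_idealD(2)[OF ii] by (auto simp: a_r_coset_def' ring_of_integers_def)
  ultimately show ?thesis by simp
qed

text \<open>A product of two nonzero ideals contains a product of nonzero elements of a field, so it
  is nonzero; it lies in both factors.\<close>

lemma ideal_family_prod_props:
  fixes J :: "'i \<Rightarrow> 'a::field_char_0 set"
  assumes "finite A" "\<And>i. i \<in> A \<Longrightarrow> ideal (J i) ring_of_integers" "\<And>i. i \<in> A \<Longrightarrow> J i \<noteq> {0}"
  shows "ideal (ideal_family_prod A J) ring_of_integers \<and> ideal_family_prod A J \<noteq> {0} \<and>
    (\<forall>i\<in>A. ideal_family_prod A J \<subseteq> J i)"
  using assms
proof (induction A rule: finite_induct)
  interpret R: cring "ring_of_integers :: 'a ring" by (rule cring_ring_of_integers)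
  interpret M: comm_monoid "ideals_set (ring_of_integers :: 'a ring)" by (rule R.ideals_set_is_comm_monoid)
  case empty
  have "(1::'a) \<in> carrier ring_of_integers" by (simp add: ring_of_integers_def algebraic_int_one)
  then have "carrier (ring_of_integers :: 'a ring) \<noteq> {0}" by force
  moreover have "ideal_family_prod {} J = carrier ring_of_integers"
    unfolding ideal_family_prod_def M.finprod_empty by (simp add: ideals_set_def)
  ultimately show ?case using R.oneideal by simp
next
  interpret R: cring "ring_of_integers :: 'a ring" by (rule cring_ring_of_integers)
  interpret M: comm_monoid "ideals_set (ring_of_integers :: 'a ring)" by (rule R.ideals_set_is_comm_monoid)
  case (insert i A)
  let ?P = "ideal_family_prod A J"
  have IH: "ideal ?P ring_of_integers" "?P \<noteq> {0}" "\<forall>i\<in>A. ?P \<subseteq> J i" using insert by auto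
  have Ji: "ideal (J i) ring_of_integers" "J i \<noteq> {0}" using insert.prems by auto
  have "ideal_family_prod (insert i A) J = J i \<otimes>\<^bsub>ideals_set ring_of_integers\<^esub> ?P"
    unfolding ideal_family_prod_def using insert by (intro M.finprod_insert) (auto simp: ideals_set_def)
  then have eq: "ideal_family_prod (insert i A) J = J i \<cdot>\<^bsub>ring_of_integers\<^esub> ?P" by (simp add: ideals_set_def)
  obtain x where x: "x \<in> J i" "x \<noteq> 0" using Ji int_idealD(2)[OF ideal_imp_int_ideal[OF Ji(1)]] by blast
  obtain y where y: "y \<in> ?P" "y \<noteq> 0" using IH int_idealD(2)[OF ideal_imp_int_ideal[OF IH(1)]] by blast
  have "x * y \<in> J i \<cdot>\<^bsub>ring_of_integers\<^esub> ?P"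
    using ideal_prod.prod[OF x(1) y(1), of ring_of_integers] by (simp add: ring_of_integers_def)
  then have "J i \<cdot>\<^bsub>ring_of_integers\<^esub> ?P \<noteq> {0}" using x y by (metis mult_eq_0_iff singletonD)
  moreover have "J i \<cdot>\<^bsub>ring_of_integers\<^esub> ?P \<subseteq> J i \<inter> ?P" by (rule R.ideal_prod_inter[OF Ji(1) IH(1)])
  ultimately show ?case using R.ideal_prod_is_ideal[OF Ji(1) IH(1)] IH(3) unfolding eq by blast
qed

section \<open>Primitive elements\<close>

text \<open>A Vandermonde argument: a kernel vector of the conjugates of the powers of \<alpha> is a
  polynomial of degree below d with d distinct roots. So these powers form a basis of K over the
  rationals, inside the generated field.\<close>

lemma generates_field_if_conjugates_distinct:
  fixes \<alpha> :: "'a::field_char_0"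
  assumes K: "number_field TYPE('a)" and inj: "inj (\<lambda>\<sigma> :: 'a emb. Rep_emb \<sigma> \<alpha>)"
  shows "generates_field \<alpha>"
proof -
  define n where "n = CARD('a emb)"
  obtain h :: "'a emb \<Rightarrow> nat" where h: "bij_betw h UNIV {0..<n}"
    using ex_bij_betw_finite_nat[of "UNIV :: 'a emb set"] by (auto simp: n_def)
  define b where "b j = \<alpha> ^ h j" for j
  have "x = 0" if x: "emb_matrix b *v x = 0" for x
  proof -
    define p where "p = (\<Sum>j\<in>UNIV. monom (x $ j) (h j))"
    have root: "poly p (Rep_emb \<sigma> \<alpha>) = 0" for \<sigma>
    proof -
      have "(emb_matrix b *v x) $ \<sigma> = 0" using x by simp
      then show ?thesis
        by (simp add: p_def poly_sum poly_monom emb_matrix_def matrix_vector_mult_def b_def Rep_emb_simps[OF K] mult.commute)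
    qed
    have hlt: "h j < n" for j using h by (auto simp: bij_betw_def)
    have deg: "degree p < n"
    proof -
      have "degree p \<le> n - 1" unfolding p_def
      proof (rule degree_sum_le)
        show "degree (monom (x $ j) (h j)) \<le> n - 1" for j
          using degree_monom_le[of "x $ j" "h j"] hlt[of j] by linarith
      qed simp
      moreover have "n > 0" by (simp add: n_def)
      ultimately show ?thesis by simp
    qed
    have p0: "p = 0"
    proof (rule ccontr)
      assume p: "p \<noteq> 0"
      have "card (range (\<lambda>\<sigma> :: 'a emb. Rep_emb \<sigma> \<alpha>)) \<le> card {z. poly p z = 0}"
        using root by (intro card_mono poly_roots_finite[OF p]) auto
      also have "\<dots> \<le> degree p" by (rule poly_roots_degree[OF p])
      finally show False using deg card_image[OF inj] by (simp add: n_def)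
    qed
    have "x $ j = 0" for j
    proof -
      have "coeff p (h j) = (\<Sum>i\<in>UNIV. if i = j then x $ i else 0)"
        unfolding p_def coeff_sum using h by (intro sum.cong) (auto simp: bij_betw_def inj_eq)
      then show ?thesis using p0 by simp
    qed
    then show "x = 0" by (simp add: vec_eq_iff)
  qed
  then have "det (emb_matrix b) \<noteq> 0"
    by (metis invertible_det_nz invertible_left_inverse matrix_left_invertible_ker)
  then have b: "rat_spanning b" by (rule rat_spanning_if_det[OF K])
  let ?R = "ring_of_type_algebra :: 'a ring"
  interpret R: field ?R by (rule field_from_type_algebra)
  let ?G = "generate_field ?R (\<rat> \<union> {\<alpha>})"
  have add: "x + y \<in> ?G" if "x \<in> ?G" "y \<in> ?G" for x y
    using generate_field.eng_add[OF that] by (simp add: ring_of_type_algebra_def)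
  have mult: "x * y \<in> ?G" if "x \<in> ?G" "y \<in> ?G" for x y
    using generate_field.eng_mult[OF that] by (simp add: ring_of_type_algebra_def)
  have rat: "of_rat q \<in> ?G" for q by (rule generate_field.incl) simp
  have pow: "\<alpha> ^ k \<in> ?G" for k
  proof (induction k)
    case 0 then show ?case using rat[of 1] by simp
  next
    case (Suc k) then show ?case using mult[OF generate_field.incl[of \<alpha> "\<rat> \<union> {\<alpha>}"]] by simp
  qed
  have "x \<in> ?G" for x
  proof -
    have "\<exists>c. x = (\<Sum>j\<in>UNIV. of_rat (c j) * b j)" using b unfolding rat_spanning_def by (rule spec)
    then obtain c where c: "x = (\<Sum>j\<in>UNIV. of_rat (c j) * b j)" by blast
    have "(\<Sum>j\<in>A. of_rat (c j) * b j) \<in> ?G" if "finite A" for A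
      using that
    proof (induction A rule: finite_induct)
      case empty then show ?case using rat[of 0] by simp
    next
      case (insert j A)
      then show ?case using add[OF mult[OF rat pow]] by (simp add: b_def)
    qed
    then show ?thesis unfolding c by simp
  qed
  then show ?thesis unfolding generates_field_def by blast
qed

text \<open>A closed interval of length m + 1 contains m + 1 consecutive integers, one more than can
  be bad; here it is the interval centred at -t.\<close>

lemma integer_in_interval_avoiding:
  fixes t :: real
  assumes "finite Bad" "card Bad \<le> m"
  obtains c :: int where "c \<notin> Bad" "\<bar>t + of_int c\<bar> \<le> (real m + 1) / 2"
proof -
  define lo where "lo = \<lceil>- (real m + 1) / 2 - t\<rceil>"
  have "card {lo..lo + int m} = Suc m" by simp
  then have "\<not> {lo..lo + int m} \<subseteq> Bad" using assms card_mono[of Bad "{lo..lo + int m}"] by auto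
  then obtain c where c: "c \<in> {lo..lo + int m}" "c \<notin> Bad" by blast
  have lo: "- (real m + 1) / 2 - t \<le> of_int lo" "of_int lo < - (real m + 1) / 2 - t + 1"
    unfolding lo_def by linarith+
  have "real_of_int lo \<le> real_of_int c" "real_of_int c \<le> real_of_int (lo + int m)"
    using c(1) by (simp_all only: of_int_le_iff atLeastAtMost_iff)
  then have "of_int lo \<le> real_of_int c" "real_of_int c \<le> of_int lo + real m" by simp_all
  then have l: "- ((real m + 1) / 2) \<le> t + of_int c" and "t + of_int c \<le> t + (of_int lo + real m)"
    using lo(1) by linarith+
  note this(2)
  also have "t + (of_int lo + real m) \<le> t + ((- (real m + 1) / 2 - t + 1) + real m)" using lo(2) by simp
  also have "\<dots> = (real m + 1) / 2" by (simp add: field_simps)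
  finally have "t + of_int c \<le> (real m + 1) / 2" .
  with l have "\<bar>t + of_int c\<bar> \<le> (real m + 1) / 2" by linarith
  then show ?thesis using that c(2) by blast
qed

text \<open>When the value at \<open>k\<close> is chosen, only the forms in \<open>P2\<close>, whose
  coefficients vanish on all of \<open>T\<close>, must be decided; each excludes at most one
  integer. The others can still be made nonzero by the coordinates in \<open>T\<close>. Every form
  is charged to exactly one coordinate, so the costs (m + 1) / 2 add up to half the number of
  coordinates plus forms.\<close>

lemma avoid_affine_forms:
  fixes t :: "'k \<Rightarrow> real" and \<beta> :: "'p \<Rightarrow> 'k \<Rightarrow> complex" and a :: "'p \<Rightarrow> complex"
  assumes "finite T" "finite P" "\<And>p. p \<in> P \<Longrightarrow> \<exists>k\<in>T. \<beta> p k \<noteq> 0"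
  shows "\<exists>c :: 'k \<Rightarrow> int. (\<Sum>k\<in>T. \<bar>t k + of_int (c k)\<bar>) \<le> (real (card T) + real (card P)) / 2 \<and>
    (\<forall>p\<in>P. a p + (\<Sum>k\<in>T. of_int (c k) * \<beta> p k) \<noteq> 0)"
  using assms
proof (induction T arbitrary: P a rule: finite_induct)
  case empty
  then have "P = {}" by blast
  then show ?case by simp
next
  case (insert k T)
  define P2 where "P2 = {p \<in> P. \<forall>l\<in>T. \<beta> p l = 0}"
  define P1 where "P1 = P - P2"
  have fin: "finite P1" "finite P2" using insert.prems(1) by (auto simp: P1_def P2_def)
  have cardP: "card P = card P1 + card P2"
    unfolding P1_def using insert.prems(1) by (subst card_Diff_subset) (auto simp: P2_def card_mono)
  have k2: "\<beta> p k \<noteq> 0" if "p \<in> P2" for p using insert.prems(2)[of p] that by (auto simp: P2_def)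
  define Bad :: "int set" where "Bad = {c. \<exists>p\<in>P2. a p + of_int c * \<beta> p k = 0}"
  define sol where "sol p = (THE c :: int. a p + of_int c * \<beta> p k = 0)" for p
  have "Bad \<subseteq> sol ` P2"
  proof
    fix c assume "c \<in> Bad"
    then obtain p where p: "p \<in> P2" "a p + of_int c * \<beta> p k = 0" by (auto simp: Bad_def)
    have "sol p = c" unfolding sol_def
    proof (rule the_equality)
      show "a p + of_int c * \<beta> p k = 0" by (rule p(2))
    next
      fix c' :: int assume "a p + of_int c' * \<beta> p k = 0"
      then have "of_int c' * \<beta> p k = of_int c * \<beta> p k" using p(2) by (metis add_left_cancel)
      then show "c' = c" using k2[OF p(1)] by simp
    qed
    then show "c \<in> sol ` P2" using p(1) by blast
  qed
  then have Bad: "finite Bad" "card Bad \<le> card P2"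
    using fin(2) finite_subset surj_card_le by (blast, metis)
  obtain c0 where c0: "c0 \<notin> Bad" "\<bar>t k + of_int c0\<bar> \<le> (real (card P2) + 1) / 2"
    by (rule integer_in_interval_avoiding[OF Bad])
  \<comment> \<open>The contribution of the chosen coordinate is absorbed into the constant terms of
    the remaining forms.\<close>
  define a' where "a' p = a p + of_int c0 * \<beta> p k" for p
  have "\<exists>l\<in>T. \<beta> p l \<noteq> 0" if "p \<in> P1" for p using that by (auto simp: P1_def P2_def)
  from insert.IH[OF fin(1) this, of a'] obtain c where
    c: "(\<Sum>k\<in>T. \<bar>t k + of_int (c k)\<bar>) \<le> (real (card T) + real (card P1)) / 2"
      "\<And>p. p \<in> P1 \<Longrightarrow> a' p + (\<Sum>k\<in>T. of_int (c k) * \<beta> p k) \<noteq> 0" by blast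
  define c' where "c' = c(k := c0)"
  have T': "(\<Sum>l\<in>T. f l (c' l)) = (\<Sum>l\<in>T. f l (c l))" for f :: "'k \<Rightarrow> int \<Rightarrow> 'z::comm_monoid_add"
    using insert.hyps by (intro sum.cong) (auto simp: c'_def)
  have ck: "c' k = c0" by (simp add: c'_def)
  have "(\<Sum>l\<in>insert k T. \<bar>t l + of_int (c' l)\<bar>) \<le> (real (card (insert k T)) + real (card P)) / 2"
    using insert.hyps c(1) c0(2) T'[of "\<lambda>l m. \<bar>t l + of_int m\<bar>"] cardP by (simp add: ck field_simps)
  moreover have "a p + (\<Sum>l\<in>insert k T. of_int (c' l) * \<beta> p l) \<noteq> 0" if p: "p \<in> P" for p
  proof -
    have sum: "a p + (\<Sum>l\<in>insert k T. of_int (c' l) * \<beta> p l) = a' p + (\<Sum>l\<in>T. of_int (c l) * \<beta> p l)"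
      using insert.hyps T'[of "\<lambda>l m. of_int m * \<beta> p l"] by (simp add: ck a'_def)
    show ?thesis
    proof (cases "p \<in> P2")
      case True
      then have "(\<Sum>l\<in>T. of_int (c l) * \<beta> p l) = 0" by (intro sum.neutral) (auto simp: P2_def)
      then show ?thesis unfolding sum using c0(1) True by (auto simp: Bad_def a'_def)
    next
      case False
      then show ?thesis unfolding sum using c(2) p by (simp add: P1_def)
    qed
  qed
  ultimately show ?case by blast
qed

lemma card_ordered_pairs:
  "2 * card {(x, y). x < (y :: 'n::{finite,linorder})} + CARD('n) = CARD('n) * CARD('n)"
proof -
  let ?L = "{(x, y). x < (y :: 'n)}" and ?G = "{(x, y). y < (x :: 'n)}" and ?E = "{(x, y). x = (y :: 'n)}"
  have "?G = prod.swap ` ?L" by auto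
  then have G: "card ?G = card ?L" by (simp add: card_image)
  have "?E = (\<lambda>x. (x, x)) ` UNIV" by auto
  then have E: "card ?E = CARD('n)" by (simp add: card_image inj_on_def)
  have "(UNIV :: ('n \<times> 'n) set) = (?L \<union> ?G) \<union> ?E" by auto
  then have "CARD('n \<times> 'n) = card ((?L \<union> ?G) \<union> ?E)" by simp
  also have "\<dots> = card (?L \<union> ?G) + card ?E" by (rule card_Un_disjoint) auto
  also have "card (?L \<union> ?G) = card ?L + card ?G" by (rule card_Un_disjoint) auto
  finally show ?thesis using G E by simp
qed

theorem theorem1p3:
  fixes I :: "'a::field_char_0 set"
    and J :: "nat \<Rightarrow> 'a set"
    and s d r2 :: nat
    and NI NJ \<Delta> :: real
  assumes K: "number_field TYPE('a)"
    and d: "d = number_field_degree TYPE('a)" "d \<ge> 2"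
    and r2: "r2 = complex_pairs TYPE('a)"
    and \<Delta>: "\<Delta> = real_of_int (discriminant TYPE('a))"
    and I: "ideal I ring_of_integers"
    and s: "s \<ge> 1"
    and J: "\<And>i. i \<in> {1..s} \<Longrightarrow> ideal (J i) ring_of_integers"
           "\<And>i. i \<in> {1..s} \<Longrightarrow> J i \<noteq> {0}"
           "\<And>i. i \<in> {1..s} \<Longrightarrow> J i \<subset> I"
           "inj_on J {1..s}"
    and NI: "NI = real (ideal_norm I)"
    and NJ: "NJ = real (ideal_norm (ideal_family_prod {1..s} J))"
  shows "\<exists>\<alpha> \<in> I - (\<Union>i\<in>{1..s}. J i). generates_field \<alpha> \<and>
    weil_height \<alpha> \<le>
      (real d * NJ * \<bar>\<Delta>\<bar> powr (1/2) * ((real d ^ 2 - real d + 4) * NJ + 4 * NI)) / (4 * NI)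
      * max 1 ((2 / pi) ^ r2 *
          ((\<Sum>i=1..s. NI / real (ideal_norm (J i)))
           - (real s - 1) * NI / NJ
           + NJ ^ (d - 1) / \<bar>\<Delta>\<bar> powr (1/2)))"
proof -
  define P where "P = ideal_family_prod {1..s} J"
  define M where "M = ideal_norm P"
  have P: "ideal P ring_of_integers" "P \<noteq> {0}" "\<And>i. i \<in> {1..s} \<Longrightarrow> P \<subseteq> J i"
    using ideal_family_prod_props[of "{1..s}" J] J(1,2) unfolding P_def by auto
  have iI: "int_ideal I" and iP: "int_ideal P" and iJ: "\<And>i. i \<in> {1..s} \<Longrightarrow> int_ideal (J i)"
    using ideal_imp_int_ideal I P(1) J(1) by blast+
  have PI: "P \<subseteq> I" using P(3)[of 1] J(3)[of 1] s by auto
  have I0: "I \<noteq> {0}" using PI P(2) int_idealD(2)[OF iP] by blast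
  have NI0: "NI > 0" unfolding NI using ideal_norm_pos[OF K iI I0] by simp
  have NIJ: "NI \<le> NJ" unfolding NI NJ P_def[symmetric] using ideal_norm_mono[OF K iI iP P(2) PI] by simp
  have NJM: "NJ = real M" by (simp add: NJ M_def P_def)
  have M1: "M \<ge> 1" using ideal_norm_pos[OF K iP P(2)] by (simp add: M_def)
  \<comment> \<open>Hence \<open>M\<close> times any algebraic integer lies in every
    \<open>J i\<close>, and adding it changes neither membership of \<open>x\<close> in
    \<open>I\<close> nor its absence from the \<open>J i\<close>.\<close>
  have MP: "of_nat M \<in> P" unfolding M_def by (rule ideal_norm_mem[OF K P(1,2)])
  obtain x where x: "x \<in> I" "\<And>i. i \<in> {1..s} \<Longrightarrow> x \<notin> J i"
    using ideal_not_union_of_proper_subideals[OF K iI, of "{1..s}" J] iJ J(2,3) I0 by auto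
  obtain \<omega> :: "'a emb \<Rightarrow> 'a" where \<omega>: "rat_spanning \<omega>" "\<forall>j. algebraic_int (\<omega> j)"
    "\<forall>j \<sigma>. (cmod (Rep_emb \<sigma> (\<omega> j)))\<^sup>2 \<le> \<bar>real_of_int (discriminant TYPE('a))\<bar> + real (number_field_degree TYPE('a))"
    using short_rat_basis[OF K] d by blast
  have "\<exists>q. x = (\<Sum>j\<in>UNIV. of_rat (q j) * \<omega> j)" using \<omega>(1) unfolding rat_spanning_def by (rule spec)
  then obtain q where q: "x = (\<Sum>j\<in>UNIV. of_rat (q j) * \<omega> j)" by blast
  let ?Pairs = "{(\<sigma>, \<tau>). \<sigma> < (\<tau> :: 'a emb)}"
  \<comment> \<open>The coordinates of \<open>x\<close> with respect to the scaled basis of the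
    vectors \<open>M * \<omega> j\<close>; \<open>a\<close> and \<open>\<beta>\<close> are the
    constant terms and coefficients of the differences of two conjugates.\<close>
  define t where "t j = real_of_rat (q j / of_nat M)" for j
  define a where "a = (\<lambda>(\<sigma>, \<tau>). Rep_emb \<sigma> x - Rep_emb \<tau> x)"
  define \<beta> where "\<beta> = (\<lambda>(\<sigma>, \<tau>) j. Rep_emb \<sigma> (of_nat M * \<omega> j) - Rep_emb \<tau> (of_nat M * \<omega> j))"
  \<comment> \<open>A form without linear part would come from two embeddings that agree on a basis,
    hence from equal ones.\<close>
  have "\<exists>j\<in>UNIV. \<beta> p j \<noteq> 0" if p: "p \<in> ?Pairs" for p
  proof (rule ccontr)
    assume no: "\<not> ?thesis"
    obtain \<sigma> \<tau> where st: "p = (\<sigma>, \<tau>)" "\<sigma> < \<tau>" using p by auto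
    have eq: "Rep_emb \<sigma> (\<omega> j) = Rep_emb \<tau> (\<omega> j)" for j
      using no M1 by (auto simp: st \<beta>_def Rep_emb_simps[OF K] right_diff_distrib[symmetric])
    have "Rep_emb \<sigma> = Rep_emb \<tau>"
    proof
      fix y
      have "\<exists>c. y = (\<Sum>j\<in>UNIV. of_rat (c j) * \<omega> j)" using \<omega>(1) unfolding rat_spanning_def by (rule spec)
      then obtain c where c: "y = (\<Sum>j\<in>UNIV. of_rat (c j) * \<omega> j)" by blast
      show "Rep_emb \<sigma> y = Rep_emb \<tau> y" unfolding c by (simp add: Rep_emb_simps[OF K] eq)
    qed
    then show False using st(2) by (simp add: Rep_emb_inject)
  qed
  from avoid_affine_forms[of UNIV ?Pairs \<beta> t a, OF _ _ this] obtain c :: "'a emb \<Rightarrow> int" where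
    c: "(\<Sum>j\<in>UNIV. \<bar>t j + of_int (c j)\<bar>) \<le> (real CARD('a emb) + real (card ?Pairs)) / 2"
      "\<forall>p\<in>?Pairs. a p + (\<Sum>j\<in>UNIV. of_int (c j) * \<beta> p j) \<noteq> 0" by auto
  define \<alpha> where "\<alpha> = x + (\<Sum>j\<in>UNIV. of_int (c j) * (of_nat M * \<omega> j))"
  have diff: "\<alpha> - x \<in> P"
  proof -
    have "of_int (c j) * (of_nat M * \<omega> j) \<in> P" for j
      by (intro int_idealD(4)[OF iP algebraic_int_of_int] int_idealD(5)[OF iP _ MP]) (use \<omega>(2) in blast)
    then show ?thesis unfolding \<alpha>_def by (simp add: int_ideal_sum[OF iP])
  qed
  have \<alpha>I: "\<alpha> \<in> I" using int_idealD(3)[OF iI x(1), of "\<alpha> - x"] diff PI by auto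
  have \<alpha>J: "\<alpha> \<notin> J i" if i: "i \<in> {1..s}" for i
  proof
    assume "\<alpha> \<in> J i"
    then have "\<alpha> - (\<alpha> - x) \<in> J i" using int_idealD(6)[OF iJ[OF i]] diff P(3)[OF i] by blast
    then show False using x(2)[OF i] by simp
  qed
  have sep: "Rep_emb \<sigma> \<alpha> \<noteq> Rep_emb \<tau> \<alpha>" if "\<sigma> < \<tau>" for \<sigma> \<tau> :: "'a emb"
  proof
    assume eq: "Rep_emb \<sigma> \<alpha> = Rep_emb \<tau> \<alpha>"
    have "Rep_emb \<sigma> \<alpha> - Rep_emb \<tau> \<alpha> = a (\<sigma>, \<tau>) + (\<Sum>j\<in>UNIV. of_int (c j) * \<beta> (\<sigma>, \<tau>) j)"
      unfolding \<alpha>_def a_def \<beta>_def by (simp add: Rep_emb_simps[OF K] sum_subtractf right_diff_distrib)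
    then show False using c(2) that eq by auto
  qed
  have gen: "generates_field \<alpha>"
    by (rule generates_field_if_conjugates_distinct[OF K], rule injI) (metis sep linorder_neqE)
  define D where "D = \<bar>\<Delta>\<bar>"
  have D1: "D \<ge> 1" using discriminant_nonzero[OF K] unfolding D_def \<Delta> by linarith
  have cmod_le: "cmod (Rep_emb \<sigma> \<alpha>) \<le> real d * (real d + 1) / 4 * (NJ * sqrt (D + real d))" for \<sigma>
  proof -
    have \<alpha>: "\<alpha> = (\<Sum>j\<in>UNIV. of_rat (q j / of_nat M + of_int (c j)) * (of_nat M * \<omega> j))"
      unfolding \<alpha>_def q sum.distrib[symmetric]
      using M1 by (intro sum.cong) (simp_all add: of_rat_add of_rat_divide distrib_right)
    have "cmod (Rep_emb \<sigma> \<alpha>) \<le> (\<Sum>j\<in>UNIV. cmod (Rep_emb \<sigma> (of_rat (q j / of_nat M + of_int (c j)) * (of_nat M * \<omega> j))))"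
      unfolding \<alpha> Rep_emb_simps(10)[OF K] by (rule norm_sum)
    also have "\<dots> = (\<Sum>j\<in>UNIV. \<bar>t j + of_int (c j)\<bar> * (NJ * cmod (Rep_emb \<sigma> (\<omega> j))))"
    proof (rule sum.cong[OF refl])
      fix j
      have "real_of_rat (q j / of_nat M + of_int (c j)) = t j + of_int (c j)"
        by (simp add: t_def of_rat_add)
      then show "cmod (Rep_emb \<sigma> (of_rat (q j / of_nat M + of_int (c j)) * (of_nat M * \<omega> j))) =
        \<bar>t j + of_int (c j)\<bar> * (NJ * cmod (Rep_emb \<sigma> (\<omega> j)))"
        by (simp only: Rep_emb_simps[OF K] norm_mult cmod_of_rat norm_of_nat NJM)
    qed
    also have "\<dots> \<le> (\<Sum>j\<in>UNIV. \<bar>t j + of_int (c j)\<bar> * (NJ * sqrt (D + real d)))"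
    proof (intro sum_mono mult_left_mono)
      fix j
      show "cmod (Rep_emb \<sigma> (\<omega> j)) \<le> sqrt (D + real d)"
        using \<omega>(3) by (intro real_le_rsqrt) (simp add: D_def \<Delta> d(1))
    qed (auto simp: NJM)
    also have "\<dots> = (\<Sum>j\<in>UNIV. \<bar>t j + of_int (c j)\<bar>) * (NJ * sqrt (D + real d))"
      by (simp add: sum_distrib_right)
    also have "\<dots> \<le> real d * (real d + 1) / 4 * (NJ * sqrt (D + real d))"
    proof (rule mult_right_mono)
      have "2 * real (card ?Pairs) + real d = real d * real d"
        using card_ordered_pairs[where 'n = "'a emb"] unfolding card_emb[OF K] d(1)[symmetric]
        by (simp flip: of_nat_add of_nat_mult)
      then have "(real CARD('a emb) + real (card ?Pairs)) / 2 = real d * (real d + 1) / 4"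
        unfolding card_emb[OF K] d(1)[symmetric] by (simp add: field_simps)
      then show "(\<Sum>j\<in>UNIV. \<bar>t j + of_int (c j)\<bar>) \<le> real d * (real d + 1) / 4" using c(1) by simp
    qed (use D1 in \<open>auto simp: NJM\<close>)
    finally show ?thesis .
  qed
  define A where "A = real d * NJ * \<bar>\<Delta>\<bar> powr (1/2) * ((real d ^ 2 - real d + 4) * NJ + 4 * NI) / (4 * NI)"
  have d2: "real d \<ge> 2" using d(2) by simp
  have NJ1: "NJ \<ge> 1" using M1 by (simp add: NJM)
  \<comment> \<open>Since \<open>NI \<le> NJ\<close>, the term \<open>NJ\<close> in the numerator
    may be lowered to \<open>NI\<close>, which then cancels; 4 + 4 gives the constant 8.\<close>
  have low: "real d * NJ * sqrt D * ((real d)\<^sup>2 - real d + 8) / 4 \<le> A"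
  proof -
    have "((real d)\<^sup>2 - real d + 8) * NI \<le> (real d ^ 2 - real d + 4) * NJ + 4 * NI"
    proof -
      have "(real d)\<^sup>2 - real d + 4 \<ge> 0" using d2 by (simp add: power2_eq_square)
      then have "((real d)\<^sup>2 - real d + 4) * NI \<le> ((real d)\<^sup>2 - real d + 4) * NJ" using NIJ by (intro mult_left_mono)
      then show ?thesis by (simp add: algebra_simps)
    qed
    then have "real d * NJ * sqrt D * (((real d)\<^sup>2 - real d + 8) * NI)
        \<le> real d * NJ * sqrt D * ((real d ^ 2 - real d + 4) * NJ + 4 * NI)"
      using NJ1 D1 by (intro mult_left_mono) auto
    then have "real d * NJ * sqrt D * (((real d)\<^sup>2 - real d + 8) * NI) / (4 * NI)
        \<le> real d * NJ * sqrt D * ((real d ^ 2 - real d + 4) * NJ + 4 * NI) / (4 * NI)"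
      using NI0 by (intro divide_right_mono) auto
    also have "\<dots> = A" unfolding A_def D_def by (simp add: powr_half_sqrt)
    finally have "real d * NJ * sqrt D * (((real d)\<^sup>2 - real d + 8) * NI) / (4 * NI) \<le> A" .
    then show ?thesis using NI0 by simp
  qed
  \<comment> \<open>\<open>D \<ge> 1\<close> separates the discriminant: D + d \<le> D (d + 1). The
    remaining root of d + 1 is at most (d + 2) / 2.\<close>
  have "(real d + 1) * sqrt (D + real d) \<le> sqrt D * ((real d)\<^sup>2 - real d + 8)"
  proof -
    have "D + real d \<le> D * (real d + 1)" using mult_right_mono[OF D1, of "real d"] by (simp add: algebra_simps)
    then have "sqrt (D + real d) \<le> sqrt D * sqrt (real d + 1)"
      by (metis real_sqrt_le_iff real_sqrt_mult)
    moreover have "sqrt (real d + 1) \<le> (real d + 2) / 2"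
      by (rule real_le_lsqrt) (auto simp: power2_eq_square field_simps)
    ultimately have "sqrt (D + real d) \<le> sqrt D * ((real d + 2) / 2)"
      using D1 by (smt (verit) mult_left_mono real_sqrt_ge_0_iff)
    then have "(real d + 1) * sqrt (D + real d) \<le> (real d + 1) * (sqrt D * ((real d + 2) / 2))"
      by (intro mult_left_mono) auto
    also have "\<dots> = sqrt D * ((real d + 1) * (real d + 2) / 2)" by simp
    also have "\<dots> \<le> sqrt D * ((real d)\<^sup>2 - real d + 8)"
    proof (intro mult_left_mono)
      \<comment> \<open>Twice the difference of the two sides is d^2 - 5 d + 14, which is this
        square plus 31/4.\<close>
      have "0 \<le> (real d - 5 / 2)\<^sup>2" by simp
      then show "(real d + 1) * (real d + 2) / 2 \<le> (real d)\<^sup>2 - real d + 8"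
        by (simp add: power2_eq_square field_simps)
    qed (use D1 in auto)
    finally show ?thesis .
  qed
  then have "(real d * NJ / 4) * ((real d + 1) * sqrt (D + real d)) \<le> (real d * NJ / 4) * (sqrt D * ((real d)\<^sup>2 - real d + 8))"
    using NJ1 by (intro mult_left_mono) auto
  then have up: "real d * (real d + 1) / 4 * (NJ * sqrt (D + real d)) \<le> A"
    using low by (simp add: mult_ac)
  \<comment> \<open>Used twice: the height estimate asks for a bound of at least 1, and a
    nonnegative \<open>A\<close> may be multiplied by the maximum in the claim.\<close>
  have A1: "A \<ge> 1"
  proof -
    have "(real d)\<^sup>2 - real d + 8 \<ge> 4" using d2 by (simp add: power2_eq_square)
    then have "1 * 1 * 1 * 4 \<le> real d * NJ * sqrt D * ((real d)\<^sup>2 - real d + 8)"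
      using d2 NJ1 D1 by (intro mult_mono) auto
    then show ?thesis using low by simp
  qed
  have "weil_height \<alpha> \<le> A"
    using cmod_le up by (intro weil_height_algebraic_int_le[OF K int_idealD(1)[OF iI \<alpha>I] A1]) (rule order_trans)
  also have "A \<le> A * max 1 y" for y using A1 mult_left_mono[of 1 "max 1 y" A] by simp
  finally show ?thesis using \<alpha>I \<alpha>J gen unfolding A_def by blast
qed

end
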